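(* Let $\Omega$ be a Polish space and let $\mu$ be a finite (positive) Borel measure on $\Omega$. Let $X$ be an L-convex, $\sigma$-order continuous complex quasi-Banach function space over $\mu$, let $\Phi_0,\Phi_1$ be Young functions with $\Phi_0,\Phi_1\in\Delta_2$, let $0<\theta<1$, and let $\Phi$ be such that $\Phi^{-1}=(\Phi_0^{-1})^{1-\theta}(\Phi_1^{-1})^{\theta}$. Then $$[X^{\Phi_0},X^{\Phi_1}]_{\theta}=X^{\Phi}.$$
   Context: All spaces are complex. $L^0(\mu)$ is the space of ($\mu$-a.e. classes of) measurable functions $f:\Omega\to\mathbb{C}$. A quasi-norm on a complex vector space $X$ is a function $\|\cdot\|_X:X\to[0,\infty)$ with $\|x\|_X=0\iff x=0$, $\|\alpha x\|_X=|\alpha|\|x\|_X$, and $\|x_1+x_2\|_X\le K(\|x_1\|_X+\|x_2\|_X)$ for some constant $K\ge1$. A quasi-Banach function space over $\mu$ is a linear subspace $X\subseteq L^0(\mu)$ with a complete quasi-norm such that (a) $f\in L^0(\mu)$, $g\in X$, $|f|\le|g|$ a.e. imply $f\in X$ and $\|f\|_X\le\|g\|_X$; (b) $\chi_\Omega\in X$. It is $\sigma$-order continuous if whenever $0\le f_n\uparrow f$ $\mu$-a.e. with $f_n,f\in X$, then $\|f-f_n\|_X\to0$. It is L-convex if there is $0<\varepsilon<1$ such that whenever $f\in X$ and $0\le f_i\le f$ ($i=1,\dots,n$, any $n\in\mathbb{N}$) satisfy $\frac{f_1+\cdots+f_n}{n}\ge(1-\varepsilon)f$, then $\max_{1\le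 i\le n}\|f_i\|_X\ge\varepsilon\|f\|_X$. A Young function is a function $\Phi:[0,\infty)\to[0,\infty)$ that is strictly increasing, continuous, convex, with $\Phi(0)=0$ and $\lim_{t\to\infty}\Phi(t)=\infty$; $\Phi\in\Delta_2$ means there is $C>1$ with $\Phi(2t)\le C\Phi(t)$ for all $t\ge0$. The function $\Phi$ with $\Phi^{-1}=(\Phi_0^{-1})^{1-\theta}(\Phi_1^{-1})^{\theta}$ (pointwise product of powers on $[0,\infty)$) is again a Young function. $\widetilde{X}^{\Phi}:=\{f\in L^0(\mu):\Phi(|f|)\in X\}$, $X^{\Phi}:=\{f\in L^0(\mu):\exists\,c>0,\ |f|/c\in\widetilde{X}^{\Phi}\}$, with quasi-norm $\|f\|_{X^{\Phi}}:=\inf\{k>0:|f|/k\in\widetilde{X}^{\Phi},\ \|\Phi(|f|/k)\|_X\le1\}$. Complex method (Kalton–Mitrea). For quasi-Banach spaces $X_0,X_1$ continuously included in a common Hausdorff topological vector space (here $L^0(\mu)$ with convergence in measure), let $U=\{z\in\mathbb{C}:0<\operatorname{Re}z<1\}$. A function with values in a quasi-Banach space is analytic if locally it is the sum of a convergent power series. Let $\mathcal{F}$ be the space of bounded analytic functions $F:U\to X_0+X_1$ which extend continuously to $\overline{U}$ and whose traces $t\mapsto F(j+it)$ are bounded continuous functions from $\mathbb{R}$ into $X_j$, $j=0,1$, with $\|F\|_{\mathcal{F}}:=\max_{j=0,1}\sup_{t\in\mathbb{R}}\|F(j+it)\|_{X_j}$. Then $[X_0,X_1]_\theta:=\{F(\theta):F\in\mathcal{F}\}$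 with $\|x\|_\theta:=\inf\{\|F\|_{\mathcal{F}}:F\in\mathcal{F},\,F(\theta)=x\}$. The equality of spaces is understood as equality of sets of functions with equivalent quasi-norms. *)

theory Defs
  imports "HOL-Analysis.Analysis"
begin

(* Elements of L^0(M) are represented by measurable functions 'a \<Rightarrow> complex, and two
   representatives are the same element iff they agree almost everywhere. A space of
   (classes of) functions is the set of all representatives of its elements together with its
   quasi-norm; the value of qnorm outside elems is irrelevant. *)

record 'a fun_space =
  elems :: "('a \<Rightarrow> complex) set"
  qnorm :: "('a \<Rightarrow> complex) \<Rightarrow> real"

definition L0_subspace :: "'a measure \<Rightarrow> ('a \<Rightarrow> complex) set \<Rightarrow> bool" where
  "L0_subspace M V \<longleftrightarrow>
     V \<subseteq> borel_measurable M \<and>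
     (\<forall>f\<in>V. \<forall>g\<in>borel_measurable M. (AE x in M. g x = f x) \<longrightarrow> g \<in> V) \<and>
     (\<lambda>x. 0) \<in> V \<and>
     (\<forall>f\<in>V. \<forall>g\<in>V. (\<lambda>x. f x + g x) \<in> V) \<and>
     (\<forall>f\<in>V. \<forall>a. (\<lambda>x. a * f x) \<in> V)"

definition is_quasi_norm :: "'a measure \<Rightarrow> 'a fun_space \<Rightarrow> bool" where
  "is_quasi_norm M X \<longleftrightarrow>
     (\<forall>f\<in>elems X. 0 \<le> qnorm X f) \<and>
     (\<forall>f\<in>elems X. qnorm X f = 0 \<longleftrightarrow> (AE x in M. f x = 0)) \<and>
     (\<forall>f\<in>elems X. \<forall>a. qnorm X (\<lambda>x. a * f x) = cmod a * qnorm X f) \<and>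
     (\<exists>K\<ge>1. \<forall>f\<in>elems X. \<forall>g\<in>elems X. qnorm X (\<lambda>x. f x + g x) \<le> K * (qnorm X f + qnorm X g))"

definition qnorm_complete :: "'a fun_space \<Rightarrow> bool" where
  "qnorm_complete X \<longleftrightarrow>
     (\<forall>u. (\<forall>n. u n \<in> elems X) \<and>
          (\<forall>e>0. \<exists>n0. \<forall>m\<ge>n0. \<forall>n\<ge>n0. qnorm X (\<lambda>x. u m x - u n x) < e) \<longrightarrow>
          (\<exists>f\<in>elems X. (\<lambda>n::nat. qnorm X (\<lambda>x. u n x - f x)) \<longlonglongrightarrow> 0))"

definition quasi_banach_function_space :: "'a measure \<Rightarrow> 'a fun_space \<Rightarrow> bool" where
  "quasi_banach_function_space M X \<longleftrightarrow>
     L0_subspace M (elems X) \<and> is_quasi_norm M X \<and> qnorm_complete X \<and>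
     (\<forall>f\<in>borel_measurable M. \<forall>g\<in>elems X.
        (AE x in M. cmod (f x) \<le> cmod (g x)) \<longrightarrow> f \<in> elems X \<and> qnorm X f \<le> qnorm X g) \<and>
     (\<lambda>x. 1) \<in> elems X"

(* In the next two definitions elements with 0 \<le> f a.e. are represented by real-valued functions. *)

definition sigma_order_continuous :: "'a measure \<Rightarrow> 'a fun_space \<Rightarrow> bool" where
  "sigma_order_continuous M X \<longleftrightarrow>
     (\<forall>(u :: nat \<Rightarrow> 'a \<Rightarrow> real) f.
        (\<forall>n. (\<lambda>x. complex_of_real (u n x)) \<in> elems X) \<and>
        (\<lambda>x. complex_of_real (f x)) \<in> elems X \<and>
        (AE x in M. (\<forall>n. 0 \<le> u n x) \<and> incseq (\<lambda>n. u n x) \<and> (\<lambda>n. u n x) \<longlonglongrightarrow> f x) \<longrightarrow>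
        (\<lambda>n. qnorm X (\<lambda>x. complex_of_real (f x - u n x))) \<longlonglongrightarrow> 0)"

definition L_convex :: "'a measure \<Rightarrow> 'a fun_space \<Rightarrow> bool" where
  "L_convex M X \<longleftrightarrow>
     (\<exists>\<epsilon>::real. 0 < \<epsilon> \<and> \<epsilon> < 1 \<and>
        (\<forall>(n::nat) (f :: 'a \<Rightarrow> real) (g :: nat \<Rightarrow> 'a \<Rightarrow> real).
           1 \<le> n \<and>
           (\<lambda>x. complex_of_real (f x)) \<in> elems X \<and>
           (\<forall>i\<in>{1..n}. g i \<in> borel_measurable M \<and> (AE x in M. 0 \<le> g i x \<and> g i x \<le> f x)) \<and>
           (AE x in M. (\<Sum>i=1..n. g i x) / real n \<ge> (1 - \<epsilon>) * f x) \<longrightarrow>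
           Max ((\<lambda>i. qnorm X (\<lambda>x. complex_of_real (g i x))) ` {1..n})
             \<ge> \<epsilon> * qnorm X (\<lambda>x. complex_of_real (f x))))"

(* Functions on [0,\<infinity>) are total functions on the reals whose values at negative
   arguments are never used. *)

definition young_function :: "(real \<Rightarrow> real) \<Rightarrow> bool" where
  "young_function \<Phi> \<longleftrightarrow>
     (\<forall>t\<ge>0. 0 \<le> \<Phi> t) \<and> strict_mono_on {0..} \<Phi> \<and> continuous_on {0..} \<Phi> \<and>
     convex_on {0..} \<Phi> \<and> \<Phi> 0 = 0 \<and> filterlim \<Phi> at_top at_top"

definition Delta2 :: "(real \<Rightarrow> real) \<Rightarrow> bool" where
  "Delta2 \<Phi> \<longleftrightarrow> (\<exists>C>1. \<forall>t\<ge>0. \<Phi> (2 * t) \<le> C * \<Phi> t)"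

abbreviation inv_half :: "(real \<Rightarrow> real) \<Rightarrow> real \<Rightarrow> real" where
  "inv_half \<Phi> \<equiv> inv_into {0..} \<Phi>"

definition orlicz_tilde :: "'a measure \<Rightarrow> 'a fun_space \<Rightarrow> (real \<Rightarrow> real) \<Rightarrow> ('a \<Rightarrow> complex) set" where
  "orlicz_tilde M X \<Phi> =
     {f \<in> borel_measurable M. (\<lambda>x. complex_of_real (\<Phi> (cmod (f x)))) \<in> elems X}"

definition orlicz :: "'a measure \<Rightarrow> 'a fun_space \<Rightarrow> (real \<Rightarrow> real) \<Rightarrow> 'a fun_space" where
  "orlicz M X \<Phi> =
     \<lparr> elems = {f \<in> borel_measurable M.
                  \<exists>c>0. (\<lambda>x. complex_of_real (cmod (f x) / c)) \<in> orlicz_tilde M X \<Phi>},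
       qnorm = (\<lambda>f. Inf {k. k > 0 \<and>
                  (\<lambda>x. complex_of_real (cmod (f x) / k)) \<in> orlicz_tilde M X \<Phi> \<and>
                  qnorm X (\<lambda>x. complex_of_real (\<Phi> (cmod (f x) / k))) \<le> 1}) \<rparr>"

definition sum_space :: "'a measure \<Rightarrow> 'a fun_space \<Rightarrow> 'a fun_space \<Rightarrow> 'a fun_space" where
  "sum_space M X0 X1 =
     \<lparr> elems = {h \<in> borel_measurable M.
                  \<exists>f\<in>elems X0. \<exists>g\<in>elems X1. AE x in M. h x = f x + g x},
       qnorm = (\<lambda>h. Inf {qnorm X0 f + qnorm X1 g | f g.
                  f \<in> elems X0 \<and> g \<in> elems X1 \<and> (AE x in M. h x = f x + g x)}) \<rparr>"

definition qcontinuous_on ::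
    "'a fun_space \<Rightarrow> 'b::topological_space set \<Rightarrow> ('b \<Rightarrow> 'a \<Rightarrow> complex) \<Rightarrow> bool" where
  "qcontinuous_on X S F \<longleftrightarrow>
     (\<forall>z\<in>S. F z \<in> elems X) \<and>
     (\<forall>z\<in>S. ((\<lambda>w. qnorm X (\<lambda>x. F w x - F z x)) \<longlongrightarrow> 0) (at z within S))"

definition qbounded_on :: "'a fun_space \<Rightarrow> 'b set \<Rightarrow> ('b \<Rightarrow> 'a \<Rightarrow> complex) \<Rightarrow> bool" where
  "qbounded_on X S F \<longleftrightarrow>
     (\<forall>z\<in>S. F z \<in> elems X) \<and> (\<exists>B. \<forall>z\<in>S. qnorm X (F z) \<le> B)"

definition qanalytic_on ::
    "'a fun_space \<Rightarrow> complex set \<Rightarrow> (complex \<Rightarrow> 'a \<Rightarrow> complex) \<Rightarrow> bool" where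
  "qanalytic_on X S F \<longleftrightarrow>
     (\<forall>z\<in>S. F z \<in> elems X) \<and>
     (\<forall>z0\<in>S. \<exists>r>0. ball z0 r \<subseteq> S \<and>
        (\<exists>a :: nat \<Rightarrow> 'a \<Rightarrow> complex. (\<forall>k. a k \<in> elems X) \<and>
           (\<forall>z\<in>ball z0 r.
              (\<lambda>n. qnorm X (\<lambda>x. F z x - (\<Sum>k<n. (z - z0) ^ k * a k x))) \<longlonglongrightarrow> 0)))"

definition strip :: "complex set" where
  "strip = {z. 0 < Re z \<and> Re z < 1}"

(* F is defined on all complex numbers, but only its values on the closed strip matter: there
   it is the (unique) continuous extension of its restriction to the open strip. *)

definition calF ::
    "'a measure \<Rightarrow> 'a fun_space \<Rightarrow> 'a fun_space \<Rightarrow> (complex \<Rightarrow> 'a \<Rightarrow> complex) set" where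
  "calF M X0 X1 =
     {F. qanalytic_on (sum_space M X0 X1) strip F \<and>
         qbounded_on (sum_space M X0 X1) strip F \<and>
         qcontinuous_on (sum_space M X0 X1) (closure strip) F \<and>
         qbounded_on X0 UNIV (\<lambda>t::real. F (Complex 0 t)) \<and>
         qcontinuous_on X0 UNIV (\<lambda>t::real. F (Complex 0 t)) \<and>
         qbounded_on X1 UNIV (\<lambda>t::real. F (Complex 1 t)) \<and>
         qcontinuous_on X1 UNIV (\<lambda>t::real. F (Complex 1 t))}"

definition calF_norm ::
    "'a fun_space \<Rightarrow> 'a fun_space \<Rightarrow> (complex \<Rightarrow> 'a \<Rightarrow> complex) \<Rightarrow> real" where
  "calF_norm X0 X1 F =
     max (SUP t::real. qnorm X0 (F (Complex 0 t))) (SUP t::real. qnorm X1 (F (Complex 1 t)))"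

definition complex_interp ::
    "'a measure \<Rightarrow> 'a fun_space \<Rightarrow> 'a fun_space \<Rightarrow> real \<Rightarrow> 'a fun_space" where
  "complex_interp M X0 X1 \<theta> =
     \<lparr> elems = {f \<in> borel_measurable M.
                  \<exists>F\<in>calF M X0 X1. AE x in M. F (complex_of_real \<theta>) x = f x},
       qnorm = (\<lambda>f. Inf {calF_norm X0 X1 F | F.
                  F \<in> calF M X0 X1 \<and> (AE x in M. F (complex_of_real \<theta>) x = f x)}) \<rparr>"

definition same_space :: "'a fun_space \<Rightarrow> 'a fun_space \<Rightarrow> bool" where
  "same_space X Y \<longleftrightarrow>
     elems X = elems Y \<and>
     (\<exists>c>0. \<exists>C>0. \<forall>f\<in>elems X. c * qnorm Y f \<le> qnorm X f \<and> qnorm X f \<le> C * qnorm Y f)"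

end

theory Submission
  imports Defs "HOL-Complex_Analysis.Complex_Analysis"
    "HOL-Computational_Algebra.Fundamental_Theorem_Algebra"
begin

text \<open>
  If \<open>\<Phi>(|f| / k)\<close> lies in the unit ball of \<open>X\<close>, put \<open>f\<^sub>j = \<Phi>\<^sub>j\<^sup>-\<^sup>1(\<Phi>(|f| / k))\<close>; then
  \<open>F(z) = k sgn(f) f\<^sub>0\<^sup>1\<^sup>-\<^sup>z f\<^sub>1\<^sup>z\<close> is an admissible function with \<open>F(\<theta>) = f\<close>, all limits being dominated.

  Conversely, L-convexity is bootstrapped to a bound for power means of small exponent \<open>p\<close>: taking
  maxima of pairs turns the statement about proportions near 1 into a polynomial bound for small
  proportions. An analytic \<open>F\<close> has a version that is holomorphic pointwise almost everywhere.
  Transport it to the unit disc, multiply by \<open>\<lambda>\<^sup>z\<^sup>-\<^sup>\<theta>\<close> with \<open>\<lambda> = \<Phi>\<^sub>0\<^sup>-\<^sup>1(s) / \<Phi>\<^sub>1\<^sup>-\<^sup>1(s)\<close> and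
  \<open>s = \<Phi>(|f| / c)\<close>, and use subharmonicity of the \<open>p\<close>-th power of the modulus on circles of radius
  close to 1, discretized over roots of unity. Pointwise, \<open>s\<close> is then dominated by a \<open>p\<close>-th power
  mean of finitely many functions \<open>\<Phi>\<^sub>j(|F|)\<close> from a ball of \<open>X\<close>. That the values of \<open>F\<close> inside
  the strip lie only in the sum space does no harm, because they are close to the boundary values.
\<close>

section \<open>Ideal quasi-normed spaces, Orlicz spaces and sums\<close>

text \<open>Three obstacles shape the argument. X is only quasi-normed, so integrals and maximum
  principles for X-valued functions are out of reach. The sole averaging principle is L-convexity,
  which speaks of finitely many functions and yields power means only for some small p; hence circle
  means are finite sums, and subharmonicity is needed for |H|^p with p \<le> 1, zeros of H included.
  The multiplier \<lambda>^(z - \<theta>) depends on the point x, so it cannot act on X-valued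
  functions as a scalar. The values of F on a circle are therefore split in the sum space with
  bounds uniform over 1/N \<le> \<lambda> \<le> N, and the multiplier enters only at fixed x. The
  radius depends on N; first the number of roots and then N tends to infinity, each time at the
  price of one quasi-triangle constant. The strip is not compact and the traces are merely bounded
  and continuous, so nothing is uniform at infinity. On the disc, infinity becomes two boundary
  points; a weight that vanishes there and equals 1 at the centre makes compactness of the circle
  applicable.\<close>

locale qideal =
  fixes M :: "'a measure" and X :: "'a fun_space" and K :: real
  assumes K1: "1 \<le> K"
    and meas: "\<And>f. f \<in> elems X \<Longrightarrow> f \<in> borel_measurable M"
    and nonneg: "\<And>f. f \<in> elems X \<Longrightarrow> 0 \<le> qnorm X f"
    and ideal: "\<And>f g. f \<in> borel_measurable M \<Longrightarrow> g \<in> elems X \<Longrightarrow>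
       (AE x in M. cmod (f x) \<le> cmod (g x)) \<Longrightarrow> f \<in> elems X \<and> qnorm X f \<le> qnorm X g"
    and zero: "(\<lambda>x. 0) \<in> elems X"
    and add: "\<And>f g. f \<in> elems X \<Longrightarrow> g \<in> elems X \<Longrightarrow> (\<lambda>x. f x + g x) \<in> elems X"
    and triangle: "\<And>f g. f \<in> elems X \<Longrightarrow> g \<in> elems X \<Longrightarrow>
       qnorm X (\<lambda>x. f x + g x) \<le> K * (qnorm X f + qnorm X g)"
    and scale: "\<And>f a. f \<in> elems X \<Longrightarrow> (\<lambda>x. a * f x) \<in> elems X"
    and qnorm_scale: "\<And>f a. f \<in> elems X \<Longrightarrow> qnorm X (\<lambda>x. a * f x) = cmod a * qnorm X f"
begin

lemma idealD:
  assumes "f \<in> borel_measurable M" "g \<in> elems X" "AE x in M. cmod (f x) \<le> cmod (g x)"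
  shows "f \<in> elems X" "qnorm X f \<le> qnorm X g"
  using ideal[OF assms] by auto

lemma AE_cong:
  assumes "f \<in> borel_measurable M" "g \<in> elems X" "AE x in M. f x = g x"
  shows "f \<in> elems X" "qnorm X f = qnorm X g"
proof -
  have 1: "AE x in M. cmod (f x) \<le> cmod (g x)" "AE x in M. cmod (g x) \<le> cmod (f x)"
    using assms(3) by (auto elim!: eventually_mono)
  show f: "f \<in> elems X" using idealD[OF assms(1,2) 1(1)] by auto
  show "qnorm X f = qnorm X g"
    using idealD[OF assms(1,2) 1(1)] idealD[OF meas[OF assms(2)] f 1(2)] by auto
qed

lemma qnorm_zero [simp]: "qnorm X (\<lambda>x. 0) = 0"
  using qnorm_scale[OF zero, of 0] by simp

lemma diff: "f \<in> elems X \<Longrightarrow> g \<in> elems X \<Longrightarrow> (\<lambda>x. f x - g x) \<in> elems X"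
  using add[OF _ scale, of f g "-1"] by simp

lemma qnorm_minus: "f \<in> elems X \<Longrightarrow> qnorm X (\<lambda>x. - f x) = qnorm X f"
  using qnorm_scale[of f "-1"] by simp

lemma triangle_diff: 
  assumes "f \<in> elems X" "g \<in> elems X"
  shows "qnorm X (\<lambda>x. f x - g x) \<le> K * (qnorm X f + qnorm X g)"
  using triangle[OF assms(1) scale[OF assms(2), of "-1"]] qnorm_minus[OF assms(2)] by simp

lemma qnorm_diff_commute:
  assumes "f \<in> elems X" "g \<in> elems X"
  shows "qnorm X (\<lambda>x. f x - g x) = qnorm X (\<lambda>x. g x - f x)"
  using qnorm_minus[OF diff[OF assms]] by simp

lemma qnorm_le_approx:
  assumes "f \<in> elems X" "g \<in> elems X"
  shows "qnorm X f \<le> K * (qnorm X (\<lambda>x. f x - g x) + qnorm X g)"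
  using triangle[OF diff[OF assms] assms(2)] by simp

lemma qnorm_scale_real:
  "f \<in> elems X \<Longrightarrow> 0 \<le> c \<Longrightarrow> qnorm X (\<lambda>x. complex_of_real c * f x) = c * qnorm X f"
  using qnorm_scale[of f "complex_of_real c"] by simp

lemma sum_mem:
  fixes n :: nat
  assumes "\<And>k. k < n \<Longrightarrow> f k \<in> elems X"
  shows "(\<lambda>x. \<Sum>k<n. f k x) \<in> elems X"
  using assms
proof (induction n)
  case (Suc n)
  then show ?case by (auto intro: add)
qed (simp add: zero)

text \<open>Peeling off the first summand each time gives the k-th one the weight K^(k+1). In later
  norm bounds this growth is beaten by terms that decay like (2K)^-k.\<close>

lemma qnorm_sum:
  assumes "\<And>k. k < n \<Longrightarrow> f k \<in> elems X"
  shows "qnorm X (\<lambda>x. \<Sum>k<n. f k x) \<le> (\<Sum>k<n. K ^ Suc k * qnorm X (f k))"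
  using assms
proof (induction n arbitrary: f)
  case (Suc n)
  have "qnorm X (\<lambda>x. \<Sum>k<Suc n. f k x) = qnorm X (\<lambda>x. f 0 x + (\<Sum>k<n. f (Suc k) x))"
    by (simp only: sum.lessThan_Suc_shift)
  also have "\<dots> \<le> K * (qnorm X (f 0) + qnorm X (\<lambda>x. \<Sum>k<n. f (Suc k) x))"
    by (intro triangle sum_mem) (use Suc in auto)
  also have "\<dots> \<le> K * (qnorm X (f 0) + (\<Sum>k<n. K ^ Suc k * qnorm X (f (Suc k))))"
    using K1 Suc.IH[of "\<lambda>k. f (Suc k)"] Suc.prems by (intro mult_left_mono add_left_mono) auto
  also have "\<dots> = (\<Sum>k<Suc n. K ^ Suc k * qnorm X (f k))"
    unfolding sum.lessThan_Suc_shift by (simp add: sum_distrib_left algebra_simps)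
  finally show ?case .
qed simp

lemma indicator_mem:
  assumes "f \<in> elems X" "B \<in> sets M"
  shows "(\<lambda>x. f x * indicator B x) \<in> elems X" "qnorm X (\<lambda>x. f x * indicator B x) \<le> qnorm X f"
proof -
  have "(\<lambda>x. f x * indicator B x) \<in> borel_measurable M" using meas[OF assms(1)] assms(2) by measurable
  moreover have "AE x in M. cmod (f x * indicator B x) \<le> cmod (f x)"
    by (auto simp: indicator_def norm_mult)
  ultimately show "(\<lambda>x. f x * indicator B x) \<in> elems X" "qnorm X (\<lambda>x. f x * indicator B x) \<le> qnorm X f"
    using idealD[OF _ assms(1)] by blast+
qed

end

text \<open>Both the Luxemburg quasi-norm and the quasi-norm of a sum are infima of admissible
  constants; \<open>R f k\<close> reads "k is admissible for f". Each law is asked of single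
  admissible constants, and only up to a smaller constant, which the infimum does not notice. The
  law for 0 ranges over k > 0 because 0 itself need not be admissible.\<close>

lemma qideal_Inf:
  fixes Z :: "'a fun_space" and R :: "('a \<Rightarrow> complex) \<Rightarrow> real \<Rightarrow> bool"
  assumes K: "1 \<le> K"
    and mem: "\<And>f. f \<in> elems Z \<longleftrightarrow> f \<in> borel_measurable M \<and> (\<exists>k. R f k)"
    and qn: "\<And>f. f \<in> elems Z \<Longrightarrow> qnorm Z f = Inf {k. R f k}"
    and pos: "\<And>f k. R f k \<Longrightarrow> 0 \<le> k"
    and ideal: "\<And>f g k. f \<in> borel_measurable M \<Longrightarrow> g \<in> borel_measurable M \<Longrightarrow>
      (AE x in M. cmod (f x) \<le> cmod (g x)) \<Longrightarrow> R g k \<Longrightarrow> \<exists>l\<le>k. R f l"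
    and zero: "\<And>k. 0 < k \<Longrightarrow> \<exists>l\<le>k. R (\<lambda>x. 0) l"
    and add: "\<And>f g k l. f \<in> borel_measurable M \<Longrightarrow> g \<in> borel_measurable M \<Longrightarrow> R f k \<Longrightarrow> R g l \<Longrightarrow>
      \<exists>m\<le>K * (k + l). R (\<lambda>x. f x + g x) m"
    and scale: "\<And>f a k. f \<in> borel_measurable M \<Longrightarrow> a \<noteq> 0 \<Longrightarrow> R f k \<Longrightarrow> \<exists>l\<le>cmod a * k. R (\<lambda>x. a * f x) l"
  shows "qideal M Z K"
proof -
  have meas: "f \<in> borel_measurable M" if "f \<in> elems Z" for f using that mem by blast
  have le: "f \<in> elems Z \<and> qnorm Z f \<le> k" if "f \<in> borel_measurable M" "\<exists>l\<le>k. R f l" for f k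
  proof -
    have f: "f \<in> elems Z" using that mem by blast
    have "bdd_below {k. R f k}" using pos by (intro bdd_belowI[of _ 0]) auto
    then show ?thesis using f that(2) cInf_lower[of _ "{k. R f k}"] unfolding qn[OF f] by force
  qed
  have approx: "\<exists>l<k. R f l" if "f \<in> elems Z" "qnorm Z f < k" for f k
    using cInf_lessD[of "{k. R f k}" k] that mem unfolding qn[OF that(1)] by auto
  have nonneg: "0 \<le> qnorm Z f" if "f \<in> elems Z" for f
    unfolding qn[OF that] using that mem pos by (intro cInf_greatest) auto
  have upper: "f \<in> elems Z \<and> qnorm Z f \<le> c"
    if "f \<in> borel_measurable M" "\<And>k. c < k \<Longrightarrow> \<exists>l\<le>k. R f l" for f c
    using le[OF that(1) that(2)[of "c + 1"]] le[OF that(1) that(2)] by (auto intro: dense_ge)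
  have z: "(\<lambda>x. 0) \<in> elems Z" "qnorm Z (\<lambda>x. 0) = 0"
    using upper[of "\<lambda>x. 0" 0] zero nonneg[of "\<lambda>x. 0"] by auto
  have sc: "(\<lambda>x. a * f x) \<in> elems Z \<and> qnorm Z (\<lambda>x. a * f x) \<le> cmod a * qnorm Z f"
    if f: "f \<in> elems Z" and a: "a \<noteq> 0" for f a
  proof (rule upper)
    show "(\<lambda>x. a * f x) \<in> borel_measurable M" using meas[OF f] by measurable
    fix k assume "cmod a * qnorm Z f < k"
    then have "qnorm Z f < k / cmod a" using a by (simp add: field_simps)
    from approx[OF f this] obtain l where l: "l < k / cmod a" "R f l" by blast
    have "cmod a * l \<le> k" using l(1) a by (simp add: field_simps)
    then show "\<exists>l\<le>k. R (\<lambda>x. a * f x) l" using scale[OF meas[OF f] a l(2)] order_trans by blast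
  qed
  show ?thesis
  proof
    show "f \<in> elems Z \<and> qnorm Z f \<le> qnorm Z g"
      if "f \<in> borel_measurable M" "g \<in> elems Z" "AE x in M. cmod (f x) \<le> cmod (g x)" for f g
    proof (rule upper[OF that(1)])
      fix k assume "qnorm Z g < k"
      from approx[OF that(2) this] obtain l where l: "l < k" "R g l" by blast
      from ideal[OF that(1) meas[OF that(2)] that(3) l(2)] l(1) show "\<exists>l\<le>k. R f l"
        by (meson less_imp_le order_trans)
    qed
    have plus: "(\<lambda>x. f x + g x) \<in> elems Z \<and> qnorm Z (\<lambda>x. f x + g x) \<le> K * (qnorm Z f + qnorm Z g)"
      if f: "f \<in> elems Z" and g: "g \<in> elems Z" for f g
    proof (rule upper)
      show "(\<lambda>x. f x + g x) \<in> borel_measurable M" using meas[OF f] meas[OF g] by measurable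
      fix k assume "K * (qnorm Z f + qnorm Z g) < k"
      then have lt: "qnorm Z f + qnorm Z g < k / K" using K by (simp add: field_simps)
      define e where "e = (k / K - (qnorm Z f + qnorm Z g)) / 2"
      have e: "0 < e" "2 * e = k / K - (qnorm Z f + qnorm Z g)" using lt by (auto simp: e_def)
      obtain i j where ij: "i < qnorm Z f + e" "R f i" "j < qnorm Z g + e" "R g j"
        using approx[OF f, of "qnorm Z f + e"] approx[OF g, of "qnorm Z g + e"] e(1) by auto
      have "i + j \<le> k / K" using ij(1,3) e(2) by linarith
      then have "K * (i + j) \<le> k" using K by (simp add: field_simps)
      then show "\<exists>l\<le>k. R (\<lambda>x. f x + g x) l" using add[OF meas[OF f] meas[OF g] ij(2,4)] order_trans by blast
    qed
    show "(\<lambda>x. f x + g x) \<in> elems Z" "qnorm Z (\<lambda>x. f x + g x) \<le> K * (qnorm Z f + qnorm Z g)"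
      if "f \<in> elems Z" "g \<in> elems Z" for f g using plus[OF that] by auto
    fix f a assume f: "f \<in> elems Z"
    show "(\<lambda>x. a * f x) \<in> elems Z" using sc[OF f] z by (cases "a = 0") auto
    show "qnorm Z (\<lambda>x. a * f x) = cmod a * qnorm Z f"
    proof (cases "a = 0")
      case False
      have "qnorm Z f \<le> cmod (1 / a) * qnorm Z (\<lambda>x. a * f x)"
        using sc[of "\<lambda>x. a * f x" "1 / a"] sc[OF f False] False by simp
      then show ?thesis using sc[OF f False] False by (auto simp: norm_divide field_simps)
    qed (use z in simp)
  qed (use K meas nonneg z in auto)
qed

text \<open>These laws hold for every convex function vanishing at 0 that increases, and they can be
  read off from the inverse of the interpolated function. So one calculus of modulars serves
  \<Phi>0, \<Phi>1 and \<Phi>; convexity enters separately, for the triangle inequality.\<close>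

locale star_young =
  fixes \<Phi> :: "real \<Rightarrow> real"
  assumes zero0 [simp]: "\<Phi> 0 = 0"
    and Phi_mono: "\<And>s t. 0 \<le> s \<Longrightarrow> s \<le> t \<Longrightarrow> \<Phi> s \<le> \<Phi> t"
    and star: "\<And>c t. 0 \<le> c \<Longrightarrow> c \<le> 1 \<Longrightarrow> 0 \<le> t \<Longrightarrow> \<Phi> (c * t) \<le> c * \<Phi> t"
begin

lemma Phi_nonneg: "0 \<le> t \<Longrightarrow> 0 \<le> \<Phi> t"
  using Phi_mono[of 0 t] by simp

lemma measurable_comp [measurable]:
  fixes f :: "'a \<Rightarrow> complex"
  assumes [measurable]: "f \<in> borel_measurable M"
  shows "(\<lambda>x. \<Phi> (cmod (f x))) \<in> borel_measurable M"
proof -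
  \<comment> \<open>Values at negative arguments are arbitrary, so monotonicity on the whole line
    requires the cut at 0.\<close>
  have "Fun.mono (\<lambda>t. \<Phi> (max 0 t))" by (intro monoI Phi_mono) auto
  then have [measurable]: "(\<lambda>t. \<Phi> (max 0 t)) \<in> borel_measurable borel" by (rule borel_measurable_mono)
  have "(\<lambda>x. \<Phi> (max 0 (cmod (f x)))) \<in> borel_measurable M" by measurable
  then show ?thesis by simp
qed

lemma measurable_comp_div:
  fixes f :: "'a \<Rightarrow> complex"
  assumes [measurable]: "f \<in> borel_measurable M" and "0 < c"
  shows "(\<lambda>x. \<Phi> (cmod (f x) / c)) \<in> borel_measurable M"
proof -
  have "(\<lambda>x. \<Phi> (cmod (complex_of_real (1/c) * f x))) \<in> borel_measurable M" by measurable
  then show ?thesis using assms(2) by (simp add: norm_divide norm_mult)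
qed

lemma star_div: "1 \<le> c \<Longrightarrow> 0 \<le> t \<Longrightarrow> \<Phi> (t / c) \<le> \<Phi> t / c"
  using star[of "1/c" t] by simp

end

locale star_orlicz = qideal M X K + star_young \<Phi>
  for M :: "'a measure" and X K and \<Phi> :: "real \<Rightarrow> real"
begin

abbreviation Y :: "'a fun_space" where "Y \<equiv> orlicz M X \<Phi>"

abbreviation modular :: "real \<Rightarrow> ('a \<Rightarrow> complex) \<Rightarrow> 'a \<Rightarrow> complex" where
  "modular k f \<equiv> \<lambda>x. complex_of_real (\<Phi> (cmod (f x) / k))"

lemma orlicz_mem:
  "f \<in> elems Y \<longleftrightarrow> f \<in> borel_measurable M \<and> (\<exists>c>0. modular c f \<in> elems X)"
proof -
  have "(\<lambda>x. complex_of_real (cmod (f x) / c)) \<in> orlicz_tilde M X \<Phi> \<longleftrightarrow> modular c f \<in> elems X" 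
    if "f \<in> borel_measurable M" "0 < c" for c
    using that unfolding orlicz_tilde_def by (simp add: norm_divide)
  then show ?thesis unfolding orlicz_def by auto
qed

lemma orlicz_qnorm:
  assumes "f \<in> borel_measurable M"
  shows "qnorm Y f = Inf {k. 0 < k \<and> modular k f \<in> elems X \<and> qnorm X (modular k f) \<le> 1}"
proof -
  have "{k. k > 0 \<and> (\<lambda>x. complex_of_real (cmod (f x) / k)) \<in> orlicz_tilde M X \<Phi> \<and>
                  qnorm X (\<lambda>x. complex_of_real (\<Phi> (cmod (f x) / k))) \<le> 1}
    = {k. 0 < k \<and> modular k f \<in> elems X \<and> qnorm X (modular k f) \<le> 1}"
    using assms unfolding orlicz_tilde_def by (auto simp add: norm_divide)
  then show ?thesis unfolding orlicz_def by simp
qed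

lemma modular_mono:
  assumes "f \<in> borel_measurable M" "g \<in> borel_measurable M" "AE x in M. cmod (f x) / k \<le> cmod (g x) / l"
    and "0 < k" "0 < l" "modular l g \<in> elems X"
  shows "modular k f \<in> elems X" "qnorm X (modular k f) \<le> qnorm X (modular l g)"
proof -
  have "modular k f \<in> borel_measurable M"
    using measurable_comp_div[OF assms(1,4)] by measurable
  moreover have "AE x in M. cmod (modular k f x) \<le> cmod (modular l g x)"
    using assms(3)
  proof eventually_elim
    case (elim x)
    then show ?case using Phi_mono[of "cmod (f x) / k" "cmod (g x) / l"] Phi_nonneg[of "cmod (f x) / k"]
       assms(4,5) by simp
  qed
  ultimately show "modular k f \<in> elems X" "qnorm X (modular k f) \<le> qnorm X (modular l g)"
    using idealD[OF _ assms(6)] by blast+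
qed

text \<open>Turns any bound on a modular into membership in the unit ball: enlarging the scale by c
  divides the modular by c.\<close>

lemma modular_star:
  assumes "f \<in> borel_measurable M" "0 < k" "1 \<le> c" "modular k f \<in> elems X"
  shows "modular (k * c) f \<in> elems X" "qnorm X (modular (k * c) f) \<le> qnorm X (modular k f) / c"
proof -
  have 1: "modular (k * c) f \<in> borel_measurable M"
    proof -
    have "0 < k * c" using assms(2,3) by (intro mult_pos_pos) auto
    from measurable_comp_div[OF assms(1) this] show ?thesis by measurable
  qed
  have 2: "(\<lambda>x. complex_of_real (1/c) * modular k f x) \<in> elems X"
    and 3: "qnorm X (\<lambda>x. complex_of_real (1/c) * modular k f x) = qnorm X (modular k f) / c"
    by (rule scale[OF assms(4)], subst qnorm_scale_real[OF assms(4)]) (use assms(3) in auto)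
  have "cmod (modular (k * c) f x) \<le> cmod (complex_of_real (1/c) * modular k f x)" for x
    using star_div[of c "cmod (f x) / k"] Phi_nonneg[of "cmod (f x) / (k*c)"] 
      Phi_nonneg[of "cmod (f x) / k"] assms(2,3)
    by (simp add: norm_mult norm_divide)
  then show "modular (k * c) f \<in> elems X" "qnorm X (modular (k * c) f) \<le> qnorm X (modular k f) / c"
    using idealD[OF 1 2] 3 by auto
qed

lemma unit_set_nonempty:
  assumes "f \<in> elems Y"
  shows "{k. 0 < k \<and> modular k f \<in> elems X \<and> qnorm X (modular k f) \<le> 1} \<noteq> {}"
proof -
  obtain c where c: "c > 0" "modular c f \<in> elems X" and f: "f \<in> borel_measurable M" using assms orlicz_mem by auto
  \<comment> \<open>The summand 1 makes the dilation factor at least 1, as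
    \<open>modular_star\<close> demands.\<close>
  let ?c = "1 + qnorm X (modular c f)"
  have ge: "1 \<le> ?c" using nonneg[OF c(2)] by simp
  have "qnorm X (modular c f) / ?c \<le> 1" using ge by (simp add: field_simps)
  then have "c * ?c > 0 \<and> modular (c * ?c) f \<in> elems X \<and> qnorm X (modular (c * ?c) f) \<le> 1"
    using modular_star[OF f c(1) ge c(2)] c ge by (auto intro: order_trans)
  then show ?thesis by blast
qed

lemma orlicz_qnorm_nonneg: "f \<in> elems Y \<Longrightarrow> 0 \<le> qnorm Y f"
  using orlicz_qnorm[of f] unit_set_nonempty[of f] orlicz_mem[of f] by (auto intro!: cInf_greatest)

lemma orlicz_qnorm_le:
  assumes "f \<in> borel_measurable M" "0 < k" "modular k f \<in> elems X" "qnorm X (modular k f) \<le> 1"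
  shows "f \<in> elems Y" "qnorm Y f \<le> k"
proof -
  show "f \<in> elems Y" using assms orlicz_mem by auto
  show "qnorm Y f \<le> k" unfolding orlicz_qnorm[OF assms(1)]
    using assms by (intro cInf_lower bdd_belowI[of _ 0]) auto
qed

text \<open>The strict inequality avoids the question whether the infimum is attained.\<close>

lemma modular_le1:
  assumes "f \<in> elems Y" "qnorm Y f < k"
  shows "modular k f \<in> elems X" "qnorm X (modular k f) \<le> 1"
proof -
  have f: "f \<in> borel_measurable M" using assms orlicz_mem by auto
  obtain l where l: "0 < l" "modular l f \<in> elems X" "qnorm X (modular l f) \<le> 1" "l < k"
    using cInf_lessD[OF unit_set_nonempty[OF assms(1)]] assms(2) orlicz_qnorm[OF f] by auto
  have "AE x in M. cmod (f x) / k \<le> cmod (f x) / l" using l by (auto intro!: divide_left_mono)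
  then show "modular k f \<in> elems X" "qnorm X (modular k f) \<le> 1"
    using modular_mono[OF f f _ _ l(1) l(2), of k] l by auto
qed

end

locale convex_orlicz = star_orlicz +
  assumes conv: "convex_on {0..} \<Phi>"
begin

text \<open>Convexity with weights k/(k+l) and l/(k+l) bounds the modular at scale k+l by K only; a
  further dilation by K brings it down to 1. In this way the Orlicz space inherits the constant K of
  X.\<close>

lemma modular_add:
  assumes fm [measurable]: "f \<in> borel_measurable M" and gm [measurable]: "g \<in> borel_measurable M"
    and k0: "0 < k" and F: "modular k f \<in> elems X" "qnorm X (modular k f) \<le> 1"
    and l0: "0 < l" and G: "modular l g \<in> elems X" "qnorm X (modular l g) \<le> 1"
  shows "modular (K * (k + l)) (\<lambda>x. f x + g x) \<in> elems X" "qnorm X (modular (K * (k + l)) (\<lambda>x. f x + g x)) \<le> 1"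
proof -
  let ?u = "k / (k + l)" and ?v = "l / (k + l)"
  have uv: "0 \<le> ?u" "0 \<le> ?v" "?u + ?v = 1" using k0 l0 by (auto simp: add_divide_distrib[symmetric])
  have S: "(\<lambda>x. complex_of_real ?u * modular k f x + complex_of_real ?v * modular l g x) \<in> elems X"
    (is "?S \<in> _") using add[OF scale scale] F G by blast
  have "qnorm X ?S \<le> K * (?u * qnorm X (modular k f) + ?v * qnorm X (modular l g))"
    using triangle[OF scale[OF F(1)] scale[OF G(1)], of ?u ?v]
    unfolding qnorm_scale_real[OF F(1) uv(1)] qnorm_scale_real[OF G(1) uv(2)] .
  also have "\<dots> \<le> K * (?u * 1 + ?v * 1)"
    using K1 uv F G by (intro mult_left_mono add_mono) auto
  finally have SK: "qnorm X ?S \<le> K" using uv by simp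
  have kl: "0 < k + l" using k0 l0 by simp
  have m: "modular (k + l) (\<lambda>x. f x + g x) \<in> borel_measurable M"
    using measurable_comp_div[OF _ kl, of "\<lambda>x. f x + g x" M] by measurable
  have "cmod (modular (k + l) (\<lambda>x. f x + g x) x) \<le> cmod (?S x)" for x
  proof -
    have "cmod (f x + g x) / (k + l) \<le> ?u * (cmod (f x) / k) + ?v * (cmod (g x) / l)"
      using norm_triangle_ineq[of "f x" "g x"] k0 l0 by (simp add: add_divide_distrib[symmetric] divide_right_mono)
    then have "\<Phi> (cmod (f x + g x) / (k + l)) \<le> \<Phi> (?u * (cmod (f x) / k) + ?v * (cmod (g x) / l))"
      using kl by (intro Phi_mono) auto
    also have "\<dots> \<le> ?u * \<Phi> (cmod (f x) / k) + ?v * \<Phi> (cmod (g x) / l)"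
      by (rule conv[unfolded convex_on_def real_scaleR_def, THEN conjunct2, rule_format]) (use uv k0 l0 in auto)
    finally have 1: "\<Phi> (cmod (f x + g x) / (k + l)) \<le> ?u * \<Phi> (cmod (f x) / k) + ?v * \<Phi> (cmod (g x) / l)" .
    have 2: "0 \<le> \<Phi> (cmod (f x + g x) / (k + l))" using kl by (intro Phi_nonneg) auto
    have "?S x = complex_of_real (?u * \<Phi> (cmod (f x) / k) + ?v * \<Phi> (cmod (g x) / l))" by simp
    then have "cmod (?S x) = \<bar>?u * \<Phi> (cmod (f x) / k) + ?v * \<Phi> (cmod (g x) / l)\<bar>"
      using norm_of_real by metis
    then show ?thesis using 1 2 by simp
  qed
  then have "modular (k + l) (\<lambda>x. f x + g x) \<in> elems X" "qnorm X (modular (k + l) (\<lambda>x. f x + g x)) \<le> K"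
    using idealD[OF m S] SK by auto
  moreover from this(2) have "qnorm X (modular (k + l) (\<lambda>x. f x + g x)) / K \<le> 1" using K1 by simp
  ultimately have "modular ((k + l) * K) (\<lambda>x. f x + g x) \<in> elems X" "qnorm X (modular ((k + l) * K) (\<lambda>x. f x + g x)) \<le> 1"
    using modular_star[of "\<lambda>x. f x + g x" "k + l" K] K1 kl by (auto intro: order_trans)
  then show "modular (K * (k + l)) (\<lambda>x. f x + g x) \<in> elems X" "qnorm X (modular (K * (k + l)) (\<lambda>x. f x + g x)) \<le> 1"
    by (simp_all add: mult.commute)
qed

lemma qideal_orlicz: "qideal M Y K"
proof (rule qideal_Inf[where R = "\<lambda>f k. 0 < k \<and> modular k f \<in> elems X \<and> qnorm X (modular k f) \<le> 1"])
  show "f \<in> elems Y \<longleftrightarrow> f \<in> borel_measurable M \<and> (\<exists>k. 0 < k \<and> modular k f \<in> elems X \<and> qnorm X (modular k f) \<le> 1)" for f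
    using orlicz_mem[of f] unit_set_nonempty[of f] by auto
  show "qnorm Y f = Inf {k. 0 < k \<and> modular k f \<in> elems X \<and> qnorm X (modular k f) \<le> 1}" if "f \<in> elems Y" for f
    using orlicz_qnorm orlicz_mem that by blast
next
  fix f g :: "'a \<Rightarrow> complex" and k :: real
  assume f: "f \<in> borel_measurable M" and g: "g \<in> borel_measurable M" and le: "AE x in M. cmod (f x) \<le> cmod (g x)"
    and k: "0 < k \<and> modular k g \<in> elems X \<and> qnorm X (modular k g) \<le> 1"
  have "AE x in M. cmod (f x) / k \<le> cmod (g x) / k"
    using le by eventually_elim (use k in \<open>auto intro: divide_right_mono\<close>)
  from modular_mono[OF f g this] k
  show "\<exists>l\<le>k. 0 < l \<and> modular l f \<in> elems X \<and> qnorm X (modular l f) \<le> 1" by fastforce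
next
  fix f :: "'a \<Rightarrow> complex" and a :: complex and k
  assume a: "a \<noteq> 0" and k: "0 < k \<and> modular k f \<in> elems X \<and> qnorm X (modular k f) \<le> 1"
  have "modular (cmod a * k) (\<lambda>x. a * f x) = modular k f" using a by (auto simp: norm_mult fun_eq_iff)
  then show "\<exists>l\<le>cmod a * k. 0 < l \<and> modular l (\<lambda>x. a * f x) \<in> elems X \<and> qnorm X (modular l (\<lambda>x. a * f x)) \<le> 1"
    using a k by (intro exI[of _ "cmod a * k"]) simp
next
  fix f g :: "'a \<Rightarrow> complex" and k l
  assume "f \<in> borel_measurable M" "g \<in> borel_measurable M"
    "0 < k \<and> modular k f \<in> elems X \<and> qnorm X (modular k f) \<le> 1" "0 < l \<and> modular l g \<in> elems X \<and> qnorm X (modular l g) \<le> 1"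
  then show "\<exists>m\<le>K * (k + l). 0 < m \<and> modular m (\<lambda>x. f x + g x) \<in> elems X \<and> qnorm X (modular m (\<lambda>x. f x + g x)) \<le> 1"
    using modular_add[of f g k l] K1 by (intro exI[of _ "K * (k + l)"]) simp
qed (use K1 zero in auto)

end

section \<open>The sum of two ideal spaces\<close>

lemma qideal_sum_space:
  assumes "qideal M X0 K" "qideal M X1 K"
  shows "qideal M (sum_space M X0 X1) K"
proof -
  interpret A: qideal M X0 K by fact
  interpret B: qideal M X1 K by fact
  define R where "R h k \<longleftrightarrow> (\<exists>f\<in>elems X0. \<exists>g\<in>elems X1. (AE x in M. h x = f x + g x) \<and> k = qnorm X0 f + qnorm X1 g)" for h k
  have RI: "R h (qnorm X0 f + qnorm X1 g)" if "f \<in> elems X0" "g \<in> elems X1" "AE x in M. h x = f x + g x" for f g h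
    unfolding R_def using that by blast
  show ?thesis
  proof (rule qideal_Inf[where R = R, OF A.K1])
    show "h \<in> elems (sum_space M X0 X1) \<longleftrightarrow> h \<in> borel_measurable M \<and> (\<exists>k. R h k)" for h
      by (auto simp: sum_space_def R_def)
    show "qnorm (sum_space M X0 X1) h = Inf {k. R h k}" for h
      unfolding sum_space_def R_def by (auto intro!: arg_cong[where f = Inf])
    show "0 \<le> k" if "R h k" for h k using that A.nonneg B.nonneg by (auto simp: R_def)
    show "\<exists>l\<le>k. R (\<lambda>x. 0) l" if "0 < k" for k
      using that A.zero B.zero by (intro exI[of _ 0]) (auto simp: R_def intro!: bexI[of _ "\<lambda>x. 0"])
  next
    fix h h' k assume [measurable]: "h \<in> borel_measurable M" "h' \<in> borel_measurable M"
      and le: "AE x in M. cmod (h x) \<le> cmod (h' x)" and "R h' k"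
    then obtain f g where fg: "f \<in> elems X0" "g \<in> elems X1" "AE x in M. h' x = f x + g x" "k = qnorm X0 f + qnorm X1 g"
      by (auto simp: R_def)
    have [measurable]: "f \<in> borel_measurable M" "g \<in> borel_measurable M" using fg A.meas B.meas by auto
    \<comment> \<open>Multiplying a splitting of h' by q gives one of h. The case distinction keeps
      |q| \<le> 1 everywhere, also on the exceptional null set. Where h' vanishes, division by zero
      gives 0, which is right because h vanishes there too.\<close>
    define q where "q x = (if cmod (h x) \<le> cmod (h' x) then h x / h' x else 0)" for x
    have [measurable]: "q \<in> borel_measurable M" unfolding q_def by measurable
    have q1: "cmod (q x) \<le> 1" for x unfolding q_def by (auto simp: norm_divide divide_le_eq_1)
    have a: "(\<lambda>x. q x * f x) \<in> elems X0" "qnorm X0 (\<lambda>x. q x * f x) \<le> qnorm X0 f"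
      by (rule A.idealD[OF _ fg(1)]; use q1 in \<open>auto simp: norm_mult mult_left_le_one_le\<close>)+
    have b: "(\<lambda>x. q x * g x) \<in> elems X1" "qnorm X1 (\<lambda>x. q x * g x) \<le> qnorm X1 g"
      by (rule B.idealD[OF _ fg(2)]; use q1 in \<open>auto simp: norm_mult mult_left_le_one_le\<close>)+
    have hq: "AE x in M. h x = q x * h' x" using le by eventually_elim (auto simp: q_def)
    have "AE x in M. h x = q x * f x + q x * g x"
      using hq fg(3) by eventually_elim (simp add: distrib_left)
    then have "R h (qnorm X0 (\<lambda>x. q x * f x) + qnorm X1 (\<lambda>x. q x * g x))" by (rule RI[OF a(1) b(1)])
    then show "\<exists>l\<le>k. R h l" using a(2) b(2) fg(4) add_mono by blast
  next
    fix h h' k l assume "R h k" "R h' l"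
    then obtain f g f' g' where fg: "f \<in> elems X0" "g \<in> elems X1" "AE x in M. h x = f x + g x" "k = qnorm X0 f + qnorm X1 g"
      and fg': "f' \<in> elems X0" "g' \<in> elems X1" "AE x in M. h' x = f' x + g' x" "l = qnorm X0 f' + qnorm X1 g'"
      by (auto simp: R_def)
    have "AE x in M. h x + h' x = (f x + f' x) + (g x + g' x)" using fg(3) fg'(3) by eventually_elim auto
    then have "R (\<lambda>x. h x + h' x) (qnorm X0 (\<lambda>x. f x + f' x) + qnorm X1 (\<lambda>x. g x + g' x))"
      by (rule RI[OF A.add[OF fg(1) fg'(1)] B.add[OF fg(2) fg'(2)]])
    moreover have "qnorm X0 (\<lambda>x. f x + f' x) + qnorm X1 (\<lambda>x. g x + g' x) \<le> K * (k + l)"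
      using A.triangle[OF fg(1) fg'(1)] B.triangle[OF fg(2) fg'(2)] unfolding fg(4) fg'(4) by (simp add: algebra_simps)
    ultimately show "\<exists>m\<le>K * (k + l). R (\<lambda>x. h x + h' x) m" by blast
  next
    fix h a k assume "R h k"
    then obtain f g where fg: "f \<in> elems X0" "g \<in> elems X1" "AE x in M. h x = f x + g x" "k = qnorm X0 f + qnorm X1 g"
      by (auto simp: R_def)
    have "AE x in M. a * h x = a * f x + a * g x" using fg(3) by eventually_elim (simp add: distrib_left)
    then have "R (\<lambda>x. a * h x) (qnorm X0 (\<lambda>x. a * f x) + qnorm X1 (\<lambda>x. a * g x))"
      by (rule RI[OF A.scale[OF fg(1)] B.scale[OF fg(2)]])
    then show "\<exists>l\<le>cmod a * k. R (\<lambda>x. a * h x) l"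
      using A.qnorm_scale[OF fg(1)] B.qnorm_scale[OF fg(2)] fg(4) by (auto simp: distrib_left)
  qed
qed

lemma sum_space_split:
  assumes "h \<in> elems (sum_space M X0 X1)" "qnorm (sum_space M X0 X1) h < k"
  obtains f g where "f \<in> elems X0" "g \<in> elems X1" "AE x in M. h x = f x + g x" "qnorm X0 f + qnorm X1 g < k"
proof -
  let ?V = "{qnorm X0 f + qnorm X1 g | f g. f \<in> elems X0 \<and> g \<in> elems X1 \<and> (AE x in M. h x = f x + g x)}"
  have ne: "?V \<noteq> {}" using assms(1) by (auto simp: sum_space_def)
  have "\<exists>v\<in>?V. v < k" by (rule cInf_lessD[OF ne]) (use assms(2) in \<open>simp add: sum_space_def\<close>)
  then show ?thesis using that by blast
qed

lemma sum_space_le: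
  assumes "qideal M X0 K" "qideal M X1 K"
    and "f \<in> elems X0" "g \<in> elems X1" "AE x in M. h x = f x + g x" "h \<in> borel_measurable M"
  shows "h \<in> elems (sum_space M X0 X1)" "qnorm (sum_space M X0 X1) h \<le> qnorm X0 f + qnorm X1 g"
proof -
  interpret A: qideal M X0 K by fact
  interpret B: qideal M X1 K by fact
  show "h \<in> elems (sum_space M X0 X1)" using assms by (auto simp: sum_space_def)
  have "bdd_below {qnorm X0 f + qnorm X1 g | f g. f \<in> elems X0 \<and> g \<in> elems X1 \<and> (AE x in M. h x = f x + g x)}"
    using A.nonneg B.nonneg by (intro bdd_belowI[of _ 0]) fastforce
  then show "qnorm (sum_space M X0 X1) h \<le> qnorm X0 f + qnorm X1 g"
    unfolding sum_space_def using assms(3-5) by (auto intro!: cInf_lower)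
qed

section \<open>L-convexity and power means\<close>

locale lconvex_space = qideal +
  assumes complete: "qnorm_complete X"
    and definite: "\<And>f. f \<in> elems X \<Longrightarrow> qnorm X f = 0 \<Longrightarrow> AE x in M. f x = 0"
    and order_continuous: "sigma_order_continuous M X"
    and lconvex: "L_convex M X"
    and const_one: "(\<lambda>x. 1) \<in> elems X"
begin

text \<open>Order continuity speaks of increasing sequences. The tail suprema s n of |u n| decrease
  to 0, so |g| - s n increases to |g|, and the difference of the two is s n.\<close>

lemma dominated_convergence:
  fixes u :: "nat \<Rightarrow> 'a \<Rightarrow> complex"
  assumes [measurable]: "\<And>n. u n \<in> borel_measurable M" and g: "g \<in> elems X"
    and le: "\<And>n. AE x in M. cmod (u n x) \<le> cmod (g x)"
    and lim: "AE x in M. (\<lambda>n. u n x) \<longlonglongrightarrow> 0"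
  shows "(\<lambda>n. qnorm X (u n)) \<longlonglongrightarrow> 0"
proof -
  have [measurable]: "g \<in> borel_measurable M" by (rule meas[OF g])
  \<comment> \<open>Cut at |g| so that the suprema exist at every point, not only where the
    domination holds.\<close>
  define b where "b n x = min (cmod (u n x)) (cmod (g x))" for n x
  define s where "s n x = (SUP m\<in>{n..}. b m x)" for n x
  have bdd: "bdd_above ((\<lambda>m. b m x) ` {n..})" for n x
    by (rule bdd_aboveI[of _ "cmod (g x)"]) (auto simp: b_def)
  have [measurable]: "b n \<in> borel_measurable M" for n unfolding b_def by measurable
  have [measurable]: "s n \<in> borel_measurable M" for n
    unfolding s_def using bdd by (intro borel_measurable_cSUP) auto
  have s_le: "s n x \<le> cmod (g x)" for n x unfolding s_def by (rule cSUP_least) (auto simp: b_def)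
  have b_s: "b n x \<le> s n x" for n x unfolding s_def by (rule cSUP_upper) (auto simp: bdd)
  have b0: "0 \<le> b n x" for n x by (simp add: b_def)
  have s0: "0 \<le> s n x" for n x using b_s b0 order_trans by blast
  have s_dec: "s (Suc n) x \<le> s n x" for n x
    unfolding s_def by (rule cSUP_subset_mono) (auto simp: bdd)
  have s_lim: "(\<lambda>n. s n x) \<longlonglongrightarrow> 0" if ux: "(\<lambda>n. u n x) \<longlonglongrightarrow> 0" for x
  proof (rule LIMSEQ_I)
    fix e :: real assume e: "0 < e"
    obtain N where N: "\<And>n. n \<ge> N \<Longrightarrow> cmod (u n x) < e/2"
      using LIMSEQ_D[OF ux, of "e/2"] e by auto
    have "s n x \<le> e/2" if "n \<ge> N" for n unfolding s_def
    proof (rule cSUP_least)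
      fix m assume "m \<in> {n..}"
      then show "b m x \<le> e/2" using N[of m] that by (simp add: b_def min_le_iff_disj)
    qed simp
    then show "\<exists>no. \<forall>n\<ge>no. norm (s n x - 0) < e" using e s0 by (intro exI[of _ N]) (force simp: abs_of_nonneg)
  qed
  have inX: "(\<lambda>x. complex_of_real (w x)) \<in> elems X \<and> qnorm X (\<lambda>x. complex_of_real (w x)) \<le> qnorm X g"
    if [measurable]: "w \<in> borel_measurable M" and "\<And>x. 0 \<le> w x" "\<And>x. w x \<le> cmod (g x)" for w
    using that by (intro ideal g) auto
  have "(\<lambda>n. qnorm X (\<lambda>x. complex_of_real (cmod (g x) - (cmod (g x) - s n x)))) \<longlonglongrightarrow> 0"
  proof (rule order_continuous[unfolded sigma_order_continuous_def, rule_format], intro conjI allI)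
    show "(\<lambda>x. complex_of_real (cmod (g x) - s n x)) \<in> elems X" for n
      using inX[of "\<lambda>x. cmod (g x) - s n x"] s_le s0 by auto
    show "(\<lambda>x. complex_of_real (cmod (g x))) \<in> elems X" using inX[of "\<lambda>x. cmod (g x)"] by auto
    show "AE x in M. (\<forall>n. 0 \<le> cmod (g x) - s n x) \<and> incseq (\<lambda>n. cmod (g x) - s n x) \<and>
            (\<lambda>n. cmod (g x) - s n x) \<longlonglongrightarrow> cmod (g x)"
      using lim
    proof eventually_elim
      case (elim x)
      then show ?case using s_le s_dec tendsto_diff[OF tendsto_const s_lim[OF elim], of "cmod (g x)"]
        by (auto intro!: incseq_SucI)
    qed
  qed
  then have s_null: "(\<lambda>n. qnorm X (\<lambda>x. complex_of_real (s n x))) \<longlonglongrightarrow> 0" by simp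
  have bound: "norm (qnorm X (u n)) \<le> qnorm X (\<lambda>x. complex_of_real (s n x))" for n
  proof -
    have "AE x in M. cmod (u n x) \<le> cmod (complex_of_real (s n x))"
      using le[of n]
    proof eventually_elim
      case (elim x)
      then show ?case using b_s[of n x] s0[of n x] by (simp add: b_def)
    qed
    then show ?thesis using inX[of "s n"] s_le s0 idealD[of "u n"] nonneg[of "u n"] by auto
  qed
  show ?thesis by (rule Lim_null_comparison[OF always_eventually[OF allI[OF bound]] s_null])
qed

text \<open>The series of |v k| / (2K)^k is Cauchy, since the decay outweighs the weights K^(k+1);
  its limit g dominates all partial sums almost everywhere, and C = |g x| works. This is the bridge
  from quasi-norms to pointwise statements, in place of convergence in measure.\<close>

lemma AE_growth:
  fixes v :: "nat \<Rightarrow> 'a \<Rightarrow> complex"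
  assumes v: "\<And>k. v k \<in> elems X" "\<And>k. qnorm X (v k) \<le> 1"
  shows "AE x in M. \<exists>C. \<forall>k. cmod (v k x) \<le> C * (2 * K) ^ k"
proof -
  have K0: "0 < K" using K1 by simp
  have [measurable]: "v k \<in> borel_measurable M" for k using v meas by auto
  define y where "y k x = complex_of_real (cmod (v k x) / (2 * K) ^ k)" for k x
  have y: "y k \<in> elems X" "qnorm X (y k) \<le> 1 / (2 * K) ^ k" for k
  proof -
    have m: "y k \<in> borel_measurable M" unfolding y_def by measurable
    let ?c = "complex_of_real (1 / (2 * K) ^ k)"
    have e: "AE x in M. cmod (y k x) \<le> cmod (?c * v k x)"
      using K0 by (auto simp: y_def norm_mult norm_divide norm_power)
    show "y k \<in> elems X" by (rule idealD(1)[OF m scale[OF v(1)] e])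
    have "qnorm X (y k) \<le> qnorm X (\<lambda>x. ?c * v k x)" by (rule idealD(2)[OF m scale[OF v(1)] e])
    also have "\<dots> = 1 / (2 * K) ^ k * qnorm X (v k)"
      by (rule qnorm_scale_real[OF v(1)]) (use K0 in auto)
    also have "\<dots> \<le> 1 / (2 * K) ^ k * 1" using K0 v(2) by (intro mult_left_mono) auto
    finally show "qnorm X (y k) \<le> 1 / (2 * K) ^ k" by simp
  qed
  define S where "S n x = (\<Sum>k<n. y k x)" for n x
  have S: "S n \<in> elems X" for n unfolding S_def by (rule sum_mem) (rule y)
  have tail: "qnorm X (\<lambda>x. S n x - S m x) \<le> 2 * K * (1/2) ^ m" if "m \<le> n" for m n
  proof -
    have *: "(\<Sum>k<m+d. y k x) = (\<Sum>k<m. y k x) + (\<Sum>k<d. y (m + k) x)" for d :: nat and x and m by (induction d) auto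
    have "S n x - S m x = (\<Sum>k<n-m. y (m + k) x)" for x
      using *[where d = "n - m" and m = m and x = x] that by (simp add: S_def)
    then have "qnorm X (\<lambda>x. S n x - S m x) = qnorm X (\<lambda>x. \<Sum>k<n-m. y (m + k) x)" by simp
    also have "\<dots> \<le> (\<Sum>k<n-m. K ^ Suc k * qnorm X (y (m + k)))" by (rule qnorm_sum) (rule y)
    also have "\<dots> \<le> (\<Sum>k<n-m. K * (1/2) ^ m * (1/2) ^ k)"
    proof (rule sum_mono)
      fix k
      have "K ^ Suc k * qnorm X (y (m + k)) \<le> K ^ Suc k * (1 / (2 * K) ^ (m + k))"
        using K0 y(2) by (intro mult_left_mono) auto
      also have "\<dots> = K * (1/2)^m * (1/2)^k * (1 / K ^ m)"
        using K0 by (simp add: power_add power_mult_distrib field_simps)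
      also have "\<dots> \<le> K * (1/2)^m * (1/2)^k * 1"
        using K1 K0 by (intro mult_left_mono) auto
      finally show "K ^ Suc k * qnorm X (y (m + k)) \<le> K * (1/2) ^ m * (1/2) ^ k" by simp
    qed
    also have "\<dots> = K * (1/2) ^ m * (\<Sum>k<n-m. (1/2) ^ k)" by (simp add: sum_distrib_left)
    also have "\<dots> \<le> K * (1/2) ^ m * 2"
      using K0 by (intro mult_left_mono) (auto simp: sum_gp_strict)
    finally show ?thesis by simp
  qed
  have "\<exists>n0. \<forall>m\<ge>n0. \<forall>n\<ge>n0. qnorm X (\<lambda>x. S m x - S n x) < e" if "0 < e" for e
  proof -
    obtain n0 where n0: "(1/2) ^ n0 < e / (2 * K)" using real_arch_pow_inv[of "e / (2 * K)" "1/2"] \<open>0 < e\<close> K0 by auto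
    have *: "qnorm X (\<lambda>x. S m x - S n x) < e" if "n0 \<le> m" "m \<le> n" for m n
    proof -
      have "qnorm X (\<lambda>x. S m x - S n x) \<le> 2 * K * (1/2) ^ m"
        using tail[OF that(2)] qnorm_diff_commute[OF S S] by metis
      also have "\<dots> \<le> 2 * K * (1/2) ^ n0" using K0 that by (intro mult_left_mono power_decreasing) auto
      also have "\<dots> < e" using n0 K0 by (simp add: field_simps)
      finally show ?thesis .
    qed
    show ?thesis
    proof (intro exI allI impI)
      fix m n assume "n0 \<le> m" "n0 \<le> n"
      then show "qnorm X (\<lambda>x. S m x - S n x) < e"
        using *[of m n] *[of n m] qnorm_diff_commute[OF S S, of m n] by (cases "m \<le> n") auto
    qed
  qed
  then obtain g where g: "g \<in> elems X" and lim: "(\<lambda>n. qnorm X (\<lambda>x. S n x - g x)) \<longlonglongrightarrow> 0"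
    using complete S unfolding qnorm_complete_def by blast
  have [measurable]: "g \<in> borel_measurable M" "S n \<in> borel_measurable M" for n using g S meas by auto
  have Smono: "Re (S n x) \<le> Re (S m x)" if "n \<le> m" for n m x
    unfolding S_def y_def Re_sum using that K0 by (intro sum_mono2) auto
  have "AE x in M. Re (S n x) \<le> cmod (g x)" for n
  proof -
    \<comment> \<open>The excess of a partial sum over |g|. Since the partial sums increase, it lies
      below |S m - g| for every m \<ge> n, so its quasi-norm is 0.\<close>
    define h where "h x = complex_of_real (max 0 (Re (S n x) - cmod (g x)))" for x
    have m: "h \<in> borel_measurable M" unfolding h_def by measurable
    have h: "h \<in> elems X \<and> qnorm X h \<le> qnorm X (\<lambda>x. S m x - g x)" if "n \<le> m" for m
    proof (rule ideal[OF m diff[OF S g]], rule AE_I2)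
      fix x
      have "Re (S n x) - cmod (g x) \<le> cmod (S m x - g x)"
        using Smono[OF that, of x] norm_triangle_ineq2[of "S m x" "g x"] complex_Re_le_cmod[of "S m x"] by linarith
      then show "cmod (h x) \<le> cmod (S m x - g x)" by (simp add: h_def)
    qed
    have "qnorm X h \<le> 0"
      by (rule LIMSEQ_le_const[OF lim]) (use h in auto)
    then have "AE x in M. h x = 0" using h[of n] nonneg[of h] definite[of h] by auto
    then show ?thesis by eventually_elim (auto simp: h_def max_def split: if_splits)
  qed
  then have "AE x in M. \<forall>n. Re (S n x) \<le> cmod (g x)" by (simp add: AE_all_countable)
  then show ?thesis
  proof eventually_elim
    case (elim x)
    have "cmod (v k x) \<le> cmod (g x) * (2 * K) ^ k" for k
    proof -
      have "Re (y k x) \<le> Re (S (Suc k) x)"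
        unfolding S_def Re_sum by (rule member_le_sum) (use K0 in \<open>auto simp: y_def\<close>)
      also have "\<dots> \<le> cmod (g x)" using elim by auto
      finally show ?thesis using K0 by (simp add: y_def field_simps)
    qed
    then show ?case by blast
  qed
qed

text \<open>Real representatives, non-negative at every point, so that powers, maxima and counting
  need no exceptional sets.\<close>

definition pos_le :: "real \<Rightarrow> ('a \<Rightarrow> real) \<Rightarrow> bool" where
  "pos_le c u \<longleftrightarrow> (\<forall>x. 0 \<le> u x) \<and> (\<lambda>x. complex_of_real (u x)) \<in> elems X \<and> qnorm X (\<lambda>x. complex_of_real (u x)) \<le> c"

lemma pos_le_measurable: "pos_le c u \<Longrightarrow> u \<in> borel_measurable M"
proof -
  assume "pos_le c u"
  then have "(\<lambda>x. Re (complex_of_real (u x))) \<in> borel_measurable M"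
    unfolding pos_le_def by (intro borel_measurable_Re[THEN measurable_compose_rev] meas) auto
  then show "u \<in> borel_measurable M" by simp
qed

lemma pos_le_mono:
  assumes "u \<in> borel_measurable M" "\<And>x. 0 \<le> u x" "AE x in M. u x \<le> v x" "pos_le c v"
  shows "pos_le c u"
proof -
  have "(\<lambda>x. complex_of_real (u x)) \<in> borel_measurable M" using assms(1) by measurable
  moreover have "AE x in M. cmod (complex_of_real (u x)) \<le> cmod (complex_of_real (v x))"
    using assms(3) assms(2) by (auto elim!: eventually_mono intro: order_trans)
  ultimately show ?thesis
    using idealD[of "\<lambda>x. complex_of_real (u x)" "\<lambda>x. complex_of_real (v x)"] assms(2,4)
    unfolding pos_le_def by auto
qed

lemma pos_le_scale: "pos_le c u \<Longrightarrow> 0 \<le> a \<Longrightarrow> pos_le (a * c) (\<lambda>x. a * u x)"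
  using scale[of "\<lambda>x. complex_of_real (u x)" a] qnorm_scale_real[of "\<lambda>x. complex_of_real (u x)" a]
  unfolding pos_le_def by (auto intro: mult_left_mono)

lemma pos_le_weaken: "pos_le c u \<Longrightarrow> c \<le> d \<Longrightarrow> pos_le d u"
  unfolding pos_le_def by auto

lemma pos_le_sum:
  fixes n :: nat
  assumes "\<And>k. k < n \<Longrightarrow> pos_le (c k) (u k)"
  shows "pos_le (\<Sum>k<n. K ^ Suc k * c k) (\<lambda>x. \<Sum>k<n. u k x)"
proof -
  have "qnorm X (\<lambda>x. \<Sum>k<n. complex_of_real (u k x)) \<le> (\<Sum>k<n. K ^ Suc k * qnorm X (\<lambda>x. complex_of_real (u k x)))"
    by (rule qnorm_sum) (use assms in \<open>auto simp: pos_le_def\<close>)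
  also have "\<dots> \<le> (\<Sum>k<n. K ^ Suc k * c k)"
    using assms K1 by (intro sum_mono mult_left_mono) (auto simp: pos_le_def)
  finally show ?thesis
    using assms sum_mem[of n "\<lambda>k x. complex_of_real (u k x)"] unfolding pos_le_def by (auto intro!: sum_nonneg)
qed

lemma pos_le_max:
  assumes "pos_le c u" "pos_le c v"
  shows "pos_le (2 * K * c) (\<lambda>x. max (u x) (v x))"
proof (rule pos_le_mono)
  show "pos_le (2 * K * c) (\<lambda>x. u x + v x)"
  proof -
    have "qnorm X (\<lambda>x. complex_of_real (u x) + complex_of_real (v x)) \<le> 
        K * (qnorm X (\<lambda>x. complex_of_real (u x)) + qnorm X (\<lambda>x. complex_of_real (v x)))"
      using assms by (intro triangle) (auto simp: pos_le_def)
    also have "\<dots> \<le> K * (c + c)" using assms K1 by (intro mult_left_mono add_mono) (auto simp: pos_le_def)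
    finally show ?thesis using assms add[of "\<lambda>x. complex_of_real (u x)" "\<lambda>x. complex_of_real (v x)"]
      by (auto simp: pos_le_def)
  qed
  show "(\<lambda>x. max (u x) (v x)) \<in> borel_measurable M" using assms[THEN pos_le_measurable] by measurable
qed (use assms in \<open>auto simp: pos_le_def le_max_iff_disj\<close>)

end

lemma length_filter_product:
  "length (filter (\<lambda>(u, v). P u \<and> P v) (List.product xs ys)) = length (filter P xs) * length (filter P ys)"
  by (induction xs) (auto simp: filter_map o_def)

lemma sum_list_filter_count:
  fixes c :: "nat \<Rightarrow> real"
  shows "(\<Sum>u\<leftarrow>us. 1 + (\<Sum>k<m. c k * of_bool (P k u))) = real (length us) + (\<Sum>k<m. c k * real (length (filter (P k) us)))"
proof (induction us)
  case (Cons u us)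
  have "(\<Sum>k<m. c k * real (length (filter (P k) (u # us)))) =
     (\<Sum>k<m. c k * of_bool (P k u)) + (\<Sum>k<m. c k * real (length (filter (P k) us)))"
    unfolding sum.distrib[symmetric] by (intro sum.cong) (auto simp: algebra_simps)
  then show ?case using Cons.IH by simp
qed simp

lemma measurable_length_filter:
  assumes "\<And>u. u \<in> set us \<Longrightarrow> u \<in> borel_measurable M" "h \<in> borel_measurable M"
  shows "(\<lambda>x. real (length (filter (\<lambda>u. h x \<le> (u x :: real)) us))) \<in> borel_measurable M"
  using assms(1)
proof (induction us)
  case (Cons u us)
  have [measurable]: "u \<in> borel_measurable M" "h \<in> borel_measurable M" using Cons assms by auto
  have [measurable]: "(\<lambda>x. real (length (filter (\<lambda>u. h x \<le> u x) us))) \<in> borel_measurable M" using Cons by auto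
  have "(\<lambda>x. real (length (filter (\<lambda>u. h x \<le> u x) (u # us)))) =
     (\<lambda>x. (if h x \<le> u x then 1 else 0) + real (length (filter (\<lambda>u. h x \<le> u x) us)))" by auto
  also have "\<dots> \<in> borel_measurable M" by measurable
  finally show ?case .
qed simp

context lconvex_space
begin

text \<open>L-convexity is applied to the truncations of h to the sets where h \<le> u. Each lies
  below its u, hence in the ball, and together they average to h times the proportion of those u
  that reach h.\<close>

lemma quantile_step:
  obtains \<epsilon> :: real where "0 < \<epsilon>" "\<epsilon> < 1"
    "\<And>us c h. us \<noteq> [] \<Longrightarrow> (\<And>u. u \<in> set us \<Longrightarrow> pos_le c u) \<Longrightarrow> h \<in> borel_measurable M \<Longrightarrow> (\<And>x. 0 \<le> h x) \<Longrightarrow>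
       (\<And>x. real (length (filter (\<lambda>u. \<not> h x \<le> u x) us)) \<le> \<epsilon> * length us) \<Longrightarrow> pos_le (c / \<epsilon>) h"
proof -
  from lconvex obtain \<epsilon> :: real where \<epsilon>: "0 < \<epsilon>" "\<epsilon> < 1" and L:
    "\<And>n f g. 1 \<le> n \<Longrightarrow> (\<lambda>x. complex_of_real (f x)) \<in> elems X \<Longrightarrow>
           (\<forall>i\<in>{1..n}. g i \<in> borel_measurable M \<and> (AE x in M. 0 \<le> g i x \<and> g i x \<le> f x)) \<Longrightarrow>
           (AE x in M. (\<Sum>i=1..n. g i x) / real n \<ge> (1 - \<epsilon>) * f x) \<Longrightarrow>
           Max ((\<lambda>i. qnorm X (\<lambda>x. complex_of_real (g i x))) ` {1..n})
             \<ge> \<epsilon> * qnorm X (\<lambda>x. complex_of_real (f x))"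
    unfolding L_convex_def by blast
  show thesis
  proof (rule that[OF \<epsilon>])
    fix us c and h :: "'a \<Rightarrow> real"
    assume us: "us \<noteq> []" "\<And>u. u \<in> set us \<Longrightarrow> pos_le c u" and hm[measurable]: "h \<in> borel_measurable M" and h0: "\<And>x. 0 \<le> h x"
      and fl: "\<And>x. real (length (filter (\<lambda>u. \<not> h x \<le> u x) us)) \<le> \<epsilon> * length us"
    let ?n = "length us"
    have n: "1 \<le> ?n" using us by (simp add: Suc_leI)
    have [measurable]: "us ! i \<in> borel_measurable M" if "i < ?n" for i using us that pos_le_measurable by auto
    have pi: "pos_le c (us ! i)" if "i < ?n" for i using us that by auto
    \<comment> \<open>Since \<epsilon> < 1, at every point some u reaches h, so h lies below the sum
      of all u. The bound obtained depends on the length of the list; only membership is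
      kept.\<close>
    have hX: "(\<lambda>x. complex_of_real (h x)) \<in> elems X"
    proof -
      have "pos_le (\<Sum>k<?n. K ^ Suc k * c) h"
      proof (rule pos_le_mono[OF hm h0 _ pos_le_sum[of ?n "\<lambda>_. c" "\<lambda>k. us ! k", OF pi]], rule AE_I2)
        fix x
        have "real (length (filter (\<lambda>u. \<not> h x \<le> u x) us)) < real (length us)"
          using fl[of x] \<epsilon> n by (smt (verit) mult_less_cancel_right2 of_nat_0_less_iff Suc_le_eq One_nat_def)
        then have "\<exists>u\<in>set us. h x \<le> u x" using filter_True[of us "\<lambda>u. \<not> h x \<le> u x"] by fastforce
        then obtain i where i: "i < ?n" "h x \<le> (us ! i) x" by (auto simp: in_set_conv_nth)
        note i(2)
        also have "(us ! i) x \<le> (\<Sum>k<?n. (us ! k) x)"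
          by (rule member_le_sum) (use i pi in \<open>auto simp: pos_le_def\<close>)
        finally show "h x \<le> (\<Sum>k<?n. (us ! k) x)" .
      qed
      then show ?thesis by (simp add: pos_le_def)
    qed
    define g where "g i x = h x * of_bool (h x \<le> (us ! (i - 1)) x)" for i x
    have gm: "g i \<in> borel_measurable M" if "i \<in> {1..?n}" for i
    proof -
      have [measurable]: "us ! (i - 1) \<in> borel_measurable M" using that by auto
      show ?thesis unfolding g_def of_bool_def by measurable
    qed
    have gp: "pos_le c (g i)" if "i \<in> {1..?n}" for i
    proof (rule pos_le_mono[OF gm[OF that]])
      show "pos_le c (us ! (i - 1))" using that by (intro pi) auto
      then show "AE x in M. g i x \<le> (us ! (i - 1)) x" by (auto simp: g_def pos_le_def)
    qed (use h0 in \<open>auto simp: g_def\<close>)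
    have cnt: "(\<Sum>i=1..?n. g i x) = h x * (?n - real (length (filter (\<lambda>u. \<not> h x \<le> u x) us)))" for x
    proof -
      have "(\<Sum>i=1..?n. g i x) = (\<Sum>i<?n. h x * of_bool (h x \<le> (us ! i) x))"
        unfolding g_def by (rule sum.reindex_bij_witness[of _ Suc "\<lambda>i. i - 1"]) auto
      also have "\<dots> = h x * (\<Sum>u\<leftarrow>us. of_bool (h x \<le> u x))"
        by (simp add: sum_list_sum_nth atLeast0LessThan sum_distrib_left)
      also have "(\<Sum>u\<leftarrow>us. of_bool (h x \<le> u x)) = ?n - real (length (filter (\<lambda>u. \<not> h x \<le> u x) us))"
        by (induction us) auto
      finally show ?thesis .
    qed
    have "\<epsilon> * qnorm X (\<lambda>x. complex_of_real (h x)) \<le> Max ((\<lambda>i. qnorm X (\<lambda>x. complex_of_real (g i x))) ` {1..?n})"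
    proof (rule L[OF n hX])
      show "\<forall>i\<in>{1..?n}. g i \<in> borel_measurable M \<and> (AE x in M. 0 \<le> g i x \<and> g i x \<le> h x)"
        using gm h0 by (auto simp: g_def)
      show "AE x in M. (1 - \<epsilon>) * h x \<le> (\<Sum>i=1..?n. g i x) / real ?n"
      proof (rule AE_I2)
        fix x
        have "h x * (\<epsilon> * ?n) \<ge> h x * real (length (filter (\<lambda>u. \<not> h x \<le> u x) us))"
          by (rule mult_left_mono[OF fl h0])
        then show "(1 - \<epsilon>) * h x \<le> (\<Sum>i=1..?n. g i x) / real ?n"
          unfolding cnt using n by (subst pos_le_divide_eq) (auto simp: algebra_simps)
      qed
    qed
    also have "\<dots> \<le> c" using gp n by (subst Max_le_iff) (auto simp: pos_le_def)
    finally show "pos_le (c / \<epsilon>) h" using hX h0 \<epsilon> by (auto simp: pos_le_def field_simps)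
  qed
qed

text \<open>Replacing a family by its pairwise maxima squares the proportion of indices at which
  it stays below \<open>h\<close> and costs only a factor \<open>2 * K\<close>; so L-convexity, a statement about
  proportions near 1, yields polynomial control for small proportions.\<close>

lemma quantile:
  obtains \<epsilon> :: real where "0 < \<epsilon>" "\<epsilon> < 1"
    "\<And>a us c h. us \<noteq> [] \<Longrightarrow> (\<And>u. u \<in> set us \<Longrightarrow> pos_le c u) \<Longrightarrow> h \<in> borel_measurable M \<Longrightarrow> (\<And>x. 0 \<le> h x) \<Longrightarrow>
       (\<And>x. (real (length (filter (\<lambda>u. \<not> h x \<le> u x) us)) / length us) ^ (2 ^ a) \<le> \<epsilon>) \<Longrightarrow>
       pos_le ((2 * K) ^ a * c / \<epsilon>) h"
proof -
  obtain \<epsilon> :: real where \<epsilon>: "0 < \<epsilon>" "\<epsilon> < 1" and Q: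
    "\<And>us c h. us \<noteq> [] \<Longrightarrow> (\<And>u. u \<in> set us \<Longrightarrow> pos_le c u) \<Longrightarrow> h \<in> borel_measurable M \<Longrightarrow> (\<And>x. 0 \<le> h x) \<Longrightarrow>
       (\<And>x. real (length (filter (\<lambda>u. \<not> h x \<le> u x) us)) \<le> \<epsilon> * length us) \<Longrightarrow> pos_le (c / \<epsilon>) h"
    using quantile_step by metis
  show thesis
  proof (rule that[OF \<epsilon>])
    fix a us c and h :: "'a \<Rightarrow> real"
    assume "us \<noteq> []" "\<And>u. u \<in> set us \<Longrightarrow> pos_le c u" "h \<in> borel_measurable M" "\<And>x. 0 \<le> h x"
     "\<And>x. (real (length (filter (\<lambda>u. \<not> h x \<le> u x) us)) / length us) ^ (2 ^ a) \<le> \<epsilon>"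
    then show "pos_le ((2 * K) ^ a * c / \<epsilon>) h"
    proof (induction a arbitrary: us c)
      case 0
      have "real (length (filter (\<lambda>u. \<not> h x \<le> u x) us)) \<le> \<epsilon> * length us" for x
        using 0(5)[of x] 0(1) by (simp add: field_simps)
      then show ?case using Q[of us c h] 0 by simp
    next
      case (Suc a)
      let ?us = "map (\<lambda>(u, v) x. max (u x) (v x)) (List.product us us)"
      have "length (filter (\<lambda>u. \<not> h x \<le> u x) ?us) = (length (filter (\<lambda>u. \<not> h x \<le> u x) us))\<^sup>2" for x
      proof -
        have "length (filter (\<lambda>u. \<not> h x \<le> u x) ?us) = length (filter (\<lambda>(u, v). \<not> h x \<le> u x \<and> \<not> h x \<le> v x) (List.product us us))"
          unfolding filter_map length_map o_def
          by (rule arg_cong[where f = length], rule filter_cong) (auto simp: le_max_iff_disj)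
        then show ?thesis by (simp add: length_filter_product power2_eq_square)
      qed
      then have "(real (length (filter (\<lambda>u. \<not> h x \<le> u x) ?us)) / length ?us) ^ (2 ^ a) \<le> \<epsilon>" for x
        using Suc.prems(5)[of x] by (simp add: power_divide power_mult[symmetric] power2_eq_square power_mult_distrib power_add[symmetric] mult_2[symmetric])
      moreover have "pos_le (2 * K * c) u" if "u \<in> set ?us" for u
        using that Suc.prems(2) pos_le_max by auto
      moreover have "?us \<noteq> []" using Suc.prems(1) by (cases us) auto
      ultimately have "pos_le ((2 * K) ^ a * (2 * K * c) / \<epsilon>) h"
        using Suc.prems by (intro Suc.IH[of ?us "2 * K * c"]) auto
      then show ?case by (simp add: ac_simps)
    qed
  qed
qed

end

text \<open>Layers with ratio D: if D^k \<le> t < D^(k+1), then t^p is at most (D^p)^(k+1) =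
  2^(k+1), the weight of the highest layer reached.\<close>

lemma powr_level_bound:
  fixes D p t :: real
  assumes "1 < D" "D powr p = 2" "0 < p" "0 \<le> t" "t < D ^ m"
  shows "t powr p \<le> 1 + (\<Sum>k<m. 2 ^ Suc k * of_bool (D ^ k \<le> t))"
  using assms(5)
proof (induction m)
  case 0
  then show ?case using assms powr_mono2[of p t 1] by simp
next
  case (Suc m)
  show ?case
  proof (cases "t < D ^ m")
    case True
    then show ?thesis using Suc.IH by (simp add: sum_nonneg add_increasing2)
  next
    case False
    have "t powr p \<le> (D ^ Suc m) powr p" using Suc.prems assms by (intro powr_mono2) auto
    also have "\<dots> = (D powr p) ^ Suc m"
      using assms(1) by (simp add: powr_power powr_realpow[symmetric] powr_powr powr_mult mult.commute del: power_Suc)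
    also have "\<dots> = 2 ^ Suc m" using assms by simp
    also have "\<dots> \<le> 1 + (\<Sum>k<Suc m. 2 ^ Suc k * of_bool (D ^ k \<le> t))"
      using False by (simp add: sum_nonneg)
    finally show ?thesis .
  qed
qed

context lconvex_space
begin

text \<open>Call level k rich at x if a proportion at least 4^-(k+1) of the u reaches D^k s', where
  s' = s / D. If no level were rich, the layer bound would keep the mean of (u / s')^p below 2,
  whereas the hypothesis makes it at least D^p = 2. So s' is covered by the pieces e k living on the
  rich sets, and \<open>quantile\<close> bounds D^k e k by a power of 2K that D^k outweighs.\<close>

lemma power_mean:
  obtains p C :: real where "0 < p" "p \<le> 1" "0 < C"
    "\<And>us c s. us \<noteq> [] \<Longrightarrow> (\<And>u. u \<in> set us \<Longrightarrow> pos_le c u) \<Longrightarrow> s \<in> borel_measurable M \<Longrightarrow> (\<And>x. 0 \<le> s x) \<Longrightarrow>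
       (\<And>x. length us * s x powr p \<le> (\<Sum>u\<leftarrow>us. u x powr p)) \<Longrightarrow> pos_le (C * c) s"
proof -
  obtain \<epsilon> :: real where \<epsilon>: "0 < \<epsilon>" "\<epsilon> < 1" and Q:
    "\<And>a us c h. us \<noteq> [] \<Longrightarrow> (\<And>u. u \<in> set us \<Longrightarrow> pos_le c u) \<Longrightarrow> h \<in> borel_measurable M \<Longrightarrow> (\<And>x. 0 \<le> h x) \<Longrightarrow>
       (\<And>x. (real (length (filter (\<lambda>u. \<not> h x \<le> u x) us)) / length us) ^ (2 ^ a) \<le> \<epsilon>) \<Longrightarrow>
       pos_le ((2 * K) ^ a * c / \<epsilon>) h"
    using quantile by metis
  have K0: "0 < K" using K1 by simp
  \<comment> \<open>D = (2K)^3: two factors of 2K per level pay for the pairwise maxima in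
    \<open>quantile\<close>, and the third leaves the decay (2K)^-k against the weights K^(k+1) of
    the sum over levels.\<close>
  define D where "D = 8 * K ^ 3"
  have D8: "8 \<le> D" using K1 one_le_power[of K 3] by (simp add: D_def)
  then have D1: "1 < D" and D0: "0 < D" by auto
  define p where "p = ln 2 / ln D"
  have p: "0 < p" "p \<le> 1" unfolding p_def using D8 by auto
  have Dp: "D powr p = 2" unfolding p_def powr_def using D1 by auto
  \<comment> \<open>With exponent 2^(2k+2+a0), a proportion 1 - 4^-(k+1) turns into at most
    exp(-2^a0), which is below \<epsilon>.\<close>
  obtain a0 :: nat where a0: "ln (1 / \<epsilon>) < 2 ^ a0" using real_arch_pow[of 2] by auto
  define C1 where "C1 = (2 * K) ^ (2 + a0) / \<epsilon>"
  have C1: "0 < C1" unfolding C1_def using K0 \<epsilon> by simp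
  show thesis
  proof (rule that[OF p])
    show "0 < D * (2 * K * C1)" using D0 K0 C1 by simp
    fix us c s
    assume us: "us \<noteq> []" "\<And>u. u \<in> set us \<Longrightarrow> pos_le c u" and sm[measurable]: "s \<in> borel_measurable M"
      and s0: "\<And>x. 0 \<le> s x" and main: "\<And>x. length us * s x powr p \<le> (\<Sum>u\<leftarrow>us. u x powr p)"
    have um: "u \<in> borel_measurable M" "\<And>x. 0 \<le> u x" if "u \<in> set us" for u
      using us(2)[OF that] pos_le_measurable by (auto simp: pos_le_def)
    have c0: "0 \<le> c" using us nonneg unfolding pos_le_def by (metis hd_in_set order_trans)
    define n where "n = length us"
    have n: "0 < n" using us by (simp add: n_def)
    define s' where "s' x = s x / D" for x
    have s'0: "0 \<le> s' x" for x using s0 D0 by (simp add: s'_def)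
    define N where "N k x = real (length (filter (\<lambda>u. D ^ k * s' x \<le> u x) us))" for k x
    have [measurable]: "N k \<in> borel_measurable M" for k
      unfolding N_def using um by (intro measurable_length_filter) (auto simp: s'_def)
    have [measurable]: "s' \<in> borel_measurable M" unfolding s'_def by measurable
    \<comment> \<open>The part of s' on the points where level k is rich; elsewhere it is 0, and no
      u falls below it.\<close>
    define e where "e k x = s' x * of_bool (n / 4 ^ Suc k \<le> N k x)" for k x
    have [measurable]: "e k \<in> borel_measurable M" for k unfolding e_def of_bool_def by measurable
    have e: "pos_le (C1 * c / (2 * K) ^ k) (e k)" for k
    proof -
      let ?a = "2 * k + 2 + a0"
      have "pos_le ((2 * K) ^ ?a * c / \<epsilon>) (\<lambda>x. D ^ k * e k x)"
      proof (rule Q[OF us])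
        fix x
        let ?f = "real (length (filter (\<lambda>u. \<not> D ^ k * e k x \<le> u x) us))"
        show "(?f / length us) ^ (2 ^ ?a) \<le> \<epsilon>"
        proof (cases "n / 4 ^ Suc k \<le> N k x")
          case True
          have "?f + N k x = n" unfolding N_def n_def of_nat_add[symmetric]
            using sum_length_filter_compl[of "\<lambda>u. D ^ k * s' x \<le> u x" us] True by (simp add: e_def N_def n_def)
          moreover have "a \<le> c - d" if "a + b = c" "d \<le> b" for a b c d :: real using that by linarith
          ultimately have "?f \<le> n - n / 4 ^ Suc k" using True by blast
          then have "?f / n \<le> (n - n / 4 ^ Suc k) / n" by (intro divide_right_mono) auto
          also have "\<dots> = 1 - 1 / 4 ^ Suc k" using n by (simp add: diff_divide_distrib)
          finally have "?f / n \<le> 1 - 1 / 4 ^ Suc k" .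
          also have "1 - 1 / 4 ^ Suc k \<le> exp (- (1 / 4 ^ Suc k :: real))" using exp_ge_add_one_self[of "- (1 / 4 ^ Suc k)"] by simp
          finally have "(?f / n) ^ (2 ^ ?a) \<le> exp (- (1 / 4 ^ Suc k)) ^ (2 ^ ?a)" by (intro power_mono) auto
          also have "\<dots> = exp (real (2 ^ ?a) * - (1 / 4 ^ Suc k))" by (rule exp_of_nat_mult[symmetric])
          also have "real (2 ^ ?a) * - (1 / 4 ^ Suc k) = - (2 ^ a0)"
            by (simp add: power_add power_mult)
          also have "exp (- (2 ^ a0)) \<le> exp (- ln (1 / \<epsilon>))" using a0 by simp
          also have "\<dots> = \<epsilon>" using \<epsilon> by (simp add: ln_div)
          finally show ?thesis unfolding n_def .
        next
          case False
          then have "filter (\<lambda>u. \<not> D ^ k * e k x \<le> u x) us = []" using um by (auto simp: e_def filter_empty_conv)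
          then show ?thesis using \<epsilon> by (simp add: power_0_left)
        qed
      qed (use s'0 D0 in \<open>auto simp: e_def\<close>)
      then have "pos_le (1 / D ^ k * ((2 * K) ^ ?a * c / \<epsilon>)) (\<lambda>x. 1 / D ^ k * (D ^ k * e k x))"
        using D0 by (intro pos_le_scale) auto
      moreover have "(\<lambda>x. 1 / D ^ k * (D ^ k * e k x)) = e k" using D0 by auto
      moreover have "1 / D ^ k * ((2 * K) ^ ?a * c / \<epsilon>) = C1 * c / (2 * K) ^ k"
      proof -
        have "D ^ k = ((2 * K) ^ 2) ^ k * (2 * K) ^ k"
          unfolding D_def power_mult_distrib[symmetric] by (simp add: power3_eq_cube power2_eq_square algebra_simps)
        moreover have "(2 * K) ^ ?a = ((2 * K) ^ 2) ^ k * (2 * K) ^ (2 + a0)"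
          by (simp add: power_add power_mult)
        ultimately show ?thesis unfolding C1_def using K0 by (simp add: field_simps)
      qed
      ultimately show ?thesis by simp
    qed
    have cover: "s' x \<le> (\<Sum>k<Suc n. e k x)" for x
    proof (cases "s x = 0")
      case True
      then show ?thesis using s'0 by (auto simp: s'_def e_def intro!: sum_nonneg)
    next
      case False
      then have sp: "0 < s x" using s0[of x] by simp
      then have s'p: "0 < s' x" using D0 by (simp add: s'_def)
      have "\<exists>k<Suc n. n / 4 ^ Suc k \<le> N k x"
      proof (rule ccontr)
        assume "\<not> ?thesis"
        then have lt: "N k x < n / 4 ^ Suc k" if "k < Suc n" for k using that by force
        \<comment> \<open>At level n the threshold n / 4^(n+1) is at most 1, so a poor level n means
          that no u reaches D^n s'. This bounds all ratios u / s' and explains why n + 1 levels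
          suffice.\<close>
        have "real n \<le> 4 ^ Suc n" 
        proof -
          have "real n < 2 ^ n" by (rule of_nat_less_two_power)
          also have "(2::real) ^ n \<le> 4 ^ n" by (rule power_mono) auto
          also have "\<dots> \<le> 4 ^ Suc n" by simp
          finally show ?thesis by simp
        qed
        then have "real n / 4 ^ Suc n \<le> 1" by (subst divide_le_eq_1) auto
        then have "N n x < 1" using lt[of n] by linarith
        then have "filter (\<lambda>u. D ^ n * s' x \<le> u x) us = []" by (simp add: N_def)
        then have small: "u x / s' x < D ^ n" if "u \<in> set us" for u
          using that s'p by (auto simp: filter_empty_conv field_simps)
        \<comment> \<open>The gain 2 = D^p comes from passing to s / D; the chain ends with n + n (1
          - 2^-n), which is less than 2n.\<close>
        have "2 * n = D powr p * n" by (simp add: Dp)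
        also have "\<dots> = n * s x powr p / s' x powr p"
          using sp D0 by (simp add: s'_def powr_divide)
        also have "\<dots> \<le> (\<Sum>u\<leftarrow>us. u x powr p) / s' x powr p"
          using main[of x] by (intro divide_right_mono) (auto simp: n_def)
        also have "\<dots> = (\<Sum>u\<leftarrow>us. (u x / s' x) powr p)"
          unfolding divide_inverse sum_list_mult_const[symmetric]
          using um s'p by (intro arg_cong[where f = sum_list] map_cong) (auto simp: powr_mult inverse_powr)
        also have "\<dots> \<le> (\<Sum>u\<leftarrow>us. 1 + (\<Sum>k<n. 2 ^ Suc k * of_bool (D ^ k \<le> u x / s' x)))"
          by (rule sum_list_mono, rule powr_level_bound) (use D1 Dp p um s'p small in auto)
        also have "\<dots> = n + (\<Sum>k<n. 2 ^ Suc k * N k x)"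
          unfolding sum_list_filter_count N_def n_def using s'p by (simp add: field_simps)
        also have "\<dots> \<le> n + (\<Sum>k<n. 2 ^ Suc k * (n / 4 ^ Suc k))"
          using lt by (intro add_left_mono sum_mono mult_left_mono) (auto intro: less_imp_le)
        also have "\<dots> = n + n * (\<Sum>k<n. (1/2) ^ Suc k)"
        proof -
          have "(2::real) ^ Suc k * (n / 4 ^ Suc k) = n * (1/2) ^ Suc k" for k
          proof -
            have "(4::real) ^ Suc k = 2 ^ Suc k * 2 ^ Suc k" by (simp add: power_mult_distrib[symmetric])
            then show ?thesis by (simp add: field_simps)
          qed
          then show ?thesis by (simp only: sum_distrib_left)
        qed
        also have "(\<Sum>k<n. (1/2::real) ^ Suc k) = 1 - (1/2) ^ n" by (induction n) auto
        finally show False using n by (simp add: field_simps)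
      qed
      then obtain k where k: "k < Suc n" "n / 4 ^ Suc k \<le> N k x" by auto
      then have "s' x = e k x" by (simp add: e_def)
      also have "\<dots> \<le> (\<Sum>k<Suc n. e k x)"
        by (rule member_le_sum) (use k s'0 in \<open>auto simp: e_def\<close>)
      finally show ?thesis .
    qed
    have "pos_le (\<Sum>k<Suc n. K ^ Suc k * (C1 * c / (2 * K) ^ k)) s'"
      by (rule pos_le_mono[OF _ s'0 _ pos_le_sum]) (use cover e in auto)
    moreover have "(\<Sum>k<Suc n. K ^ Suc k * (C1 * c / (2 * K) ^ k)) \<le> 2 * K * C1 * c"
    proof -
      have "(\<Sum>k<Suc n. K ^ Suc k * (C1 * c / (2 * K) ^ k)) = K * C1 * c * (\<Sum>k<Suc n. (1/2) ^ k)"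
        unfolding sum_distrib_left using K0 by (intro sum.cong refl) (simp add: power_mult_distrib field_simps)
      also have "\<dots> \<le> K * C1 * c * 2"
        using K0 C1 c0 by (intro mult_left_mono) (auto simp: sum_gp_strict simp del: sum.lessThan_Suc)
      finally show ?thesis by simp
    qed
    ultimately have "pos_le (2 * K * C1 * c) s'" by (rule pos_le_weaken)
    then have "pos_le (D * (2 * K * C1 * c)) (\<lambda>x. D * s' x)" using D0 by (intro pos_le_scale) auto
    moreover have "(\<lambda>x. D * s' x) = s" using D0 by (auto simp: s'_def)
    ultimately show "pos_le (D * (2 * K * C1) * c) s" by (simp add: mult.assoc)
  qed
qed

end

section \<open>Holomorphic versions of vector-valued analytic functions\<close>

lemma star_young_young_function: "young_function \<Phi> \<Longrightarrow> star_young \<Phi>"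
proof
  assume Y: "young_function \<Phi>"
  show "\<Phi> 0 = 0" using Y by (simp add: young_function_def)
  show "\<Phi> s \<le> \<Phi> t" if "0 \<le> s" "s \<le> t" for s t
    using Y that strict_mono_onD[of "{0..}" \<Phi> s t] unfolding young_function_def by (cases "s = t") auto
  have C: "\<And>x y u v. 0 \<le> x \<Longrightarrow> 0 \<le> y \<Longrightarrow> 0 \<le> u \<Longrightarrow> 0 \<le> v \<Longrightarrow> u + v = 1 \<Longrightarrow> \<Phi> (u * x + v * y) \<le> u * \<Phi> x + v * \<Phi> y"
    using Y unfolding young_function_def convex_on_def by auto
  show "\<Phi> (c * t) \<le> c * \<Phi> t" if "0 \<le> c" "c \<le> 1" "0 \<le> t" for c t
    using C[of t 0 c "1 - c"] that \<open>\<Phi> 0 = 0\<close> by simp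
qed

section \<open>Orlicz spaces of doubling Young functions\<close>

locale young_orlicz = lconvex_space M X K for M :: "'a measure" and X K +
  fixes \<Phi> :: "real \<Rightarrow> real"
  assumes young: "young_function \<Phi>" and delta2: "Delta2 \<Phi>"
begin

sublocale convex_orlicz M X K \<Phi>
proof (intro convex_orlicz.intro star_orlicz.intro)
  show "qideal M X K" by (rule qideal_axioms)
  show "star_young \<Phi>" by (rule star_young_young_function[OF young])
  show "convex_orlicz_axioms \<Phi>" using young by unfold_locales (simp add: young_function_def)
qed

sublocale O: qideal M Y K by (rule qideal_orlicz)

lemma Phi_pos: "0 < t \<Longrightarrow> 0 < \<Phi> t"
  using young strict_mono_onD[of "{0..}" \<Phi> 0 t] unfolding young_function_def by auto

lemma Phi_superlinear: "0 < s \<Longrightarrow> s \<le> t \<Longrightarrow> t / s \<le> \<Phi> t / \<Phi> s"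
  using star[of "s / t" t] Phi_pos[of s] by (simp add: field_simps)

text \<open>The way back from modulars to functions: \<Phi> grows at least linearly beyond s, and
  the summand 1 covers t < s.\<close>

lemma linear_bound: "0 < s \<Longrightarrow> 0 \<le> t \<Longrightarrow> t / s \<le> 1 + \<Phi> t / \<Phi> s"
  using Phi_superlinear[of s t] Phi_pos[of s] Phi_nonneg[of t]
  by (cases "s \<le> t") (auto simp: add_increasing2)

text \<open>The doubling condition absorbs any change of scale into a power of C, so one admissible
  scale makes every scale admissible.\<close>

lemma modular_mem:
  assumes f: "f \<in> elems Y" and k: "0 < k"
  shows "modular k f \<in> elems X"
proof -
  have fm: "f \<in> borel_measurable M" using f orlicz_mem by auto
  obtain c where c: "0 < c" "modular c f \<in> elems X" using f orlicz_mem by auto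
  obtain C where C: "1 < C" "\<And>t. 0 \<le> t \<Longrightarrow> \<Phi> (2 * t) \<le> C * \<Phi> t" using delta2 by (auto simp: Delta2_def)
  have pow: "\<Phi> (2 ^ n * t) \<le> C ^ n * \<Phi> t" if "0 \<le> t" for n t
  proof (induction n)
    case (Suc n)
    have "\<Phi> (2 ^ Suc n * t) \<le> C * \<Phi> (2 ^ n * t)" using C(2)[of "2 ^ n * t"] that by (simp add: mult.assoc)
    also have "\<dots> \<le> C * (C ^ n * \<Phi> t)" using Suc C by (intro mult_left_mono) auto
    finally show ?case by (simp add: mult.assoc)
  qed simp
  obtain n :: nat where n: "c / k < 2 ^ n" using real_arch_pow[of 2] by auto
  have le: "\<Phi> (cmod (f x) / k) \<le> C ^ n * \<Phi> (cmod (f x) / c)" for x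
  proof -
    have "cmod (f x) / k = c / k * (cmod (f x) / c)" using c k by simp
    also have "\<dots> \<le> 2 ^ n * (cmod (f x) / c)" using n c by (intro mult_right_mono) auto
    finally have "\<Phi> (cmod (f x) / k) \<le> \<Phi> (2 ^ n * (cmod (f x) / c))" using k by (intro Phi_mono) auto
    also have "\<dots> \<le> C ^ n * \<Phi> (cmod (f x) / c)" using c by (intro pow) auto
    finally show ?thesis .
  qed
  have m: "modular k f \<in> borel_measurable M" using measurable_comp_div[OF fm k] by measurable
  have "AE x in M. cmod (modular k f x) \<le> cmod (complex_of_real (C ^ n) * modular c f x)"
    using le C(1) c(1) k by (intro AE_I2) (simp add: norm_mult norm_power Phi_nonneg)
  then show ?thesis using idealD(1)[OF m scale[OF c(2)]] by blast
qed

text \<open>As the modular of g lies in X at every scale, the modulars of u n at scale e/2 are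
  dominated in X and tend to 0; once they are below 1, the quasi-norm of u n is at most e/2.\<close>

lemma orlicz_dominated:
  fixes u :: "nat \<Rightarrow> 'a \<Rightarrow> complex"
  assumes um: "\<And>n. u n \<in> borel_measurable M" and g: "g \<in> elems Y"
    and le: "\<And>n. AE x in M. cmod (u n x) \<le> cmod (g x)"
    and lim: "AE x in M. (\<lambda>n. u n x) \<longlonglongrightarrow> 0"
  shows "(\<lambda>n. qnorm Y (u n)) \<longlonglongrightarrow> 0"
proof (rule LIMSEQ_I)
  fix e :: real assume e: "0 < e"
  have uO: "u n \<in> elems Y" for n using O.ideal[OF um g le] by auto
  have "(\<lambda>n. qnorm X (modular (e/2) (u n))) \<longlonglongrightarrow> 0"
  proof (rule dominated_convergence[OF _ modular_mem[OF g]])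
    have "(\<lambda>x. \<Phi> (cmod (u n x) / (e/2))) \<in> borel_measurable M" for n
      by (rule measurable_comp_div) (use um e in auto)
    then show "modular (e/2) (u n) \<in> borel_measurable M" for n by measurable
    show "AE x in M. cmod (modular (e/2) (u n) x) \<le> cmod (modular (e/2) g x)" for n
      using le[of n]
    proof eventually_elim
      case (elim x)
      have "\<Phi> (cmod (u n x) / (e/2)) \<le> \<Phi> (cmod (g x) / (e/2))"
        using elim e by (intro Phi_mono divide_right_mono divide_nonneg_pos) auto
      moreover have "0 \<le> \<Phi> (cmod (u n x) / (e/2))" using e by (intro Phi_nonneg) auto
      ultimately show ?case by simp
    qed
    show "AE x in M. (\<lambda>n. modular (e/2) (u n) x) \<longlonglongrightarrow> 0"
      using lim
    proof eventually_elim
      case (elim x)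
      have l: "(\<lambda>n. cmod (u n x) / (e/2)) \<longlonglongrightarrow> 0" using tendsto_divide[OF tendsto_norm[OF elim] tendsto_const, of "e/2"] e by simp
      then have "eventually (\<lambda>n. cmod (u n x) / (e/2) < 1) sequentially" by (rule order_tendstoD(2)) simp
      then have "eventually (\<lambda>n. norm (\<Phi> (cmod (u n x) / (e/2))) \<le> cmod (u n x) / (e/2) * \<Phi> 1) sequentially"
      proof eventually_elim
        case (elim n)
        then show ?case using star[of "cmod (u n x) / (e/2)" 1] e Phi_nonneg[of "cmod (u n x) / (e/2)"] by simp
      qed
      then have "(\<lambda>n. \<Phi> (cmod (u n x) / (e/2))) \<longlonglongrightarrow> 0"
        by (rule Lim_null_comparison) (use tendsto_mult_left_zero[OF l] in simp)
      then show ?case using tendsto_of_real[where 'a = complex] by force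
    qed
  qed (use e in auto)
  then have "eventually (\<lambda>n. qnorm X (modular (e/2) (u n)) < 1) sequentially" by (rule order_tendstoD(2)) simp
  then obtain N where N: "\<And>n. N \<le> n \<Longrightarrow> qnorm X (modular (e/2) (u n)) < 1" unfolding eventually_sequentially by auto
  have "norm (qnorm Y (u n) - 0) < e" if "N \<le> n" for n
    using orlicz_qnorm_le(2)[OF um, of "e/2" n] modular_mem[OF uO, of "e/2" n] N[OF that] e orlicz_qnorm_nonneg[OF uO, of n] by auto
  then show "\<exists>no. \<forall>n\<ge>no. norm (qnorm Y (u n) - 0) < e" by blast
qed

lemma orlicz_growth:
  fixes v :: "nat \<Rightarrow> 'a \<Rightarrow> complex"
  assumes v: "\<And>k. v k \<in> elems Y" "\<And>k. qnorm Y (v k) < c"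
  shows "AE x in M. \<exists>C. \<forall>k. cmod (v k x) \<le> C * (2 * K) ^ k"
proof -
  have c: "0 < c" using v(2)[of 0] orlicz_qnorm_nonneg[OF v(1), of 0] by simp
  have "AE x in M. \<exists>C. \<forall>k. cmod (modular c (v k) x) \<le> C * (2 * K) ^ k"
    by (rule AE_growth) (use modular_le1[OF v] in auto)
  then show ?thesis
  proof eventually_elim
    case (elim x)
    then obtain C where C: "\<And>k. cmod (modular c (v k) x) \<le> C * (2 * K) ^ k" by blast
    have "cmod (v k x) \<le> c * (1 + \<bar>C\<bar> / \<Phi> 1) * (2 * K) ^ k" for k
    proof -
      have K: "1 \<le> (2 * K) ^ k" using K1 by (intro one_le_power) simp
      have "cmod (v k x) / c \<le> 1 + \<Phi> (cmod (v k x) / c) / \<Phi> 1" using linear_bound[of 1 "cmod (v k x) / c"] c by simp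
      also have "\<dots> \<le> 1 + (C * (2 * K) ^ k) / \<Phi> 1"
        using C[of k] Phi_pos[of 1] by (intro add_left_mono divide_right_mono) auto
      also have "\<dots> \<le> (2 * K) ^ k + \<bar>C\<bar> / \<Phi> 1 * (2 * K) ^ k"
        using K Phi_pos[of 1] by (intro add_mono) (auto intro!: divide_right_mono mult_right_mono)
      also have "\<dots> = (1 + \<bar>C\<bar> / \<Phi> 1) * (2 * K) ^ k" by (simp add: algebra_simps)
      finally show ?thesis using c by (simp add: field_simps)
    qed
    then show ?case by blast
  qed
qed

end

text \<open>Isolates the conclusion of \<open>AE_growth\<close>. For the sum space it can be checked
  on the two summands separately, without proving that space complete.\<close>

locale growth_space = qideal +
  assumes growth: "\<And>v :: nat \<Rightarrow> _. (\<And>k. v k \<in> elems X) \<Longrightarrow> (\<And>k. qnorm X (v k) \<le> 1) \<Longrightarrow>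
    AE x in M. \<exists>C. \<forall>k. cmod (v k x) \<le> C * (2 * K) ^ k"
begin

text \<open>Along a subsequence with errors below (4K)^-k the rescaled errors stay in the unit ball.
  Their pointwise growth of order (2K)^k leaves a factor 2^-k, so this subsequence also converges
  pointwise to F.\<close>

lemma AE_limit_unique:
  fixes P :: "nat \<Rightarrow> 'a \<Rightarrow> complex"
  assumes F: "F \<in> elems X" and P: "\<And>n. P n \<in> elems X" and lim: "(\<lambda>n. qnorm X (\<lambda>x. F x - P n x)) \<longlonglongrightarrow> 0"
    and L: "AE x in M. (\<lambda>n. P n x) \<longlonglongrightarrow> L x"
  shows "AE x in M. F x = L x"
proof -
  have K0: "0 < K" using K1 by simp
  have "\<exists>n\<ge>k. qnorm X (\<lambda>x. F x - P n x) < 1 / (4 * K) ^ k" for k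
  proof -
    have "eventually (\<lambda>n. qnorm X (\<lambda>x. F x - P n x) < 1 / (4 * K) ^ k) sequentially"
      using K0 by (intro order_tendstoD(2)[OF lim]) auto
    then show ?thesis using eventually_happens'[OF sequentially_bot eventually_conj[OF _ eventually_ge_at_top[of k]]] by blast
  qed
  then obtain r where r: "\<And>k. k \<le> r k" "\<And>k. qnorm X (\<lambda>x. F x - P (r k) x) < 1 / (4 * K) ^ k" by metis
  have rlim: "filterlim r sequentially sequentially"
    using r(1) by (intro filterlim_at_top_mono[OF filterlim_ident]) auto
  have "AE x in M. \<exists>C. \<forall>k. cmod (complex_of_real ((4 * K) ^ k) * (F x - P (r k) x)) \<le> C * (2 * K) ^ k"
  proof (rule growth)
    fix k
    show "(\<lambda>x. complex_of_real ((4 * K) ^ k) * (F x - P (r k) x)) \<in> elems X"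
      by (rule scale[OF diff[OF F P]])
    have "qnorm X (\<lambda>x. complex_of_real ((4 * K) ^ k) * (F x - P (r k) x)) = (4 * K) ^ k * qnorm X (\<lambda>x. F x - P (r k) x)"
      by (rule qnorm_scale_real[OF diff[OF F P]]) (use K0 in auto)
    also have "\<dots> \<le> 1" using r(2)[of k] K0 by (simp add: field_simps)
    finally show "qnorm X (\<lambda>x. complex_of_real ((4 * K) ^ k) * (F x - P (r k) x)) \<le> 1" .
  qed
  with L show ?thesis
  proof eventually_elim
    case (elim x)
    then obtain C where C: "\<And>k. cmod (complex_of_real ((4 * K) ^ k) * (F x - P (r k) x)) \<le> C * (2 * K) ^ k" by blast
    have bd: "norm (F x - P (r k) x) \<le> C * (1/2) ^ k" for k
    proof -
      have "\<bar>(4 * K) ^ k\<bar> = (4 * K) ^ k" using K0 by (intro abs_of_nonneg zero_le_power) simp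
      with C[of k] have "(4 * K) ^ k * cmod (F x - P (r k) x) \<le> C * (2 * K) ^ k" unfolding norm_mult norm_of_real by simp
      moreover have "(4 * K) ^ k = 2 ^ k * (2 * K) ^ k" unfolding power_mult_distrib[symmetric] by simp
      ultimately have "(2 * K) ^ k * (2 ^ k * cmod (F x - P (r k) x)) \<le> (2 * K) ^ k * C" by (simp only: ac_simps)
      moreover have "0 < (2 * K) ^ k" using K0 by (intro zero_less_power) simp
      ultimately have "2 ^ k * cmod (F x - P (r k) x) \<le> C" by (rule mult_left_le_imp_le)
      then have "cmod (F x - P (r k) x) \<le> C / 2 ^ k" by (subst pos_le_divide_eq) (auto simp: mult.commute)
      also have "C / 2 ^ k = C * (1/2) ^ k" by (simp add: power_divide)
      finally show ?thesis by simp
    qed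
    have "(\<lambda>k. C * (1/2) ^ k) \<longlonglongrightarrow> 0" by (intro tendsto_mult_right_zero LIMSEQ_power_zero) auto
    then have "(\<lambda>k. F x - P (r k) x) \<longlonglongrightarrow> 0" by (rule Lim_null_comparison[OF always_eventually[OF allI[OF bd]]])
    from tendsto_diff[OF tendsto_const[of "F x"] this] have "(\<lambda>k. P (r k) x) \<longlonglongrightarrow> F x" by simp
    moreover have "(\<lambda>k. P (r k) x) \<longlonglongrightarrow> L x" using filterlim_compose[OF elim(1) rlim] .
    ultimately show ?case by (rule LIMSEQ_unique)
  qed
qed

text \<open>Bounded partial sums at one point at distance r/2 bound the coefficients by a multiple
  of (r/2)^-k in quasi-norm. Pointwise this costs another (2K)^k, so the series converges at almost
  every x on the smaller ball of radius r/(4K).\<close>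

lemma local_version:
  assumes F: "qanalytic_on X S F" and z0: "z0 \<in> S"
  obtains \<rho> P where "0 < \<rho>" "ball z0 \<rho> \<subseteq> S" 
    "AE x in M. (\<lambda>z. P z x) holomorphic_on ball z0 \<rho>"
    "\<forall>z\<in>ball z0 \<rho>. AE x in M. F z x = P z x"
proof -
  have K0: "0 < K" using K1 by simp
  define V where "V r a \<longleftrightarrow> (\<forall>k. a k \<in> elems X) \<and>
       (\<forall>z\<in>ball z0 r. (\<lambda>n. qnorm X (\<lambda>x. F z x - (\<Sum>k<n. (z - z0) ^ k * a k x))) \<longlonglongrightarrow> 0)"
    for r and a :: "nat \<Rightarrow> 'a \<Rightarrow> complex"
  have "\<exists>r>0. ball z0 r \<subseteq> S \<and> (\<exists>a. V r a)"
    unfolding V_def by (rule F[unfolded qanalytic_on_def, THEN conjunct2, rule_format, OF z0])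
  then obtain r a where r: "0 < r" "ball z0 r \<subseteq> S" and V: "V r a" by blast
  have a: "a k \<in> elems X" for k using V by (simp add: V_def)
  have lim: "(\<lambda>n. qnorm X (\<lambda>x. F z x - (\<Sum>k<n. (z - z0) ^ k * a k x))) \<longlonglongrightarrow> 0" if "z \<in> ball z0 r" for z
    using V that unfolding V_def by blast
  have FX: "F z \<in> elems X" if "z \<in> S" for z using F that by (auto simp: qanalytic_on_def)
  define P where "P z x = (\<Sum>k. a k x * (z - z0) ^ k)" for z x
  define w where "w = complex_of_real (r / 2)"
  have w: "w \<noteq> 0" "cmod w = r / 2" "z0 + w \<in> ball z0 r" using r by (auto simp: w_def dist_norm)
  have part: "(\<lambda>x. \<Sum>k<n. (z - z0) ^ k * a k x) \<in> elems X" for n z by (intro sum_mem scale a)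
  let ?q = "\<lambda>n. qnorm X (\<lambda>x. F (z0 + w) x - (\<Sum>k<n. (z0 + w - z0) ^ k * a k x))"
  have "bounded (range ?q)" using lim[OF w(3)] by (intro convergent_imp_bounded) auto
  then obtain B where B: "\<And>n. \<bar>?q n\<bar> \<le> B" unfolding bounded_iff by auto
  have B0: "0 \<le> B" using B[of 0] by linarith
  \<comment> \<open>The k-th term is the difference of two consecutive errors, whence 2KB; the
    summand 1 makes c positive.\<close>
  define c where "c = 2 * K * B + 1"
  have c0: "0 < c" unfolding c_def using K0 B0 by (simp add: add_nonneg_pos)
  have coeff: "(r/2) ^ k * qnorm X (a k) \<le> c" for k
  proof -
    have "(r/2) ^ k * qnorm X (a k) = qnorm X (\<lambda>x. w ^ k * a k x)"
      using qnorm_scale[OF a, of "w ^ k"] w by (simp add: norm_power)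
    also have "(\<lambda>x. w ^ k * a k x) = (\<lambda>x. (F (z0 + w) x - (\<Sum>k<k. (z0 + w - z0) ^ k * a k x)) - 
          (F (z0 + w) x - (\<Sum>k<Suc k. (z0 + w - z0) ^ k * a k x)))" by auto
    also have "qnorm X \<dots> \<le> K * (?q k + ?q (Suc k))"
      proof (rule triangle_diff)
      have "z0 + w \<in> S" using w r by auto
      then show "(\<lambda>x. F (z0 + w) x - (\<Sum>k<n. (z0 + w - z0) ^ k * a k x)) \<in> elems X" for n
        by (intro diff part FX)
      then show "(\<lambda>x. F (z0 + w) x - (\<Sum>k<Suc k. (z0 + w - z0) ^ k * a k x)) \<in> elems X" .
    qed
    also have "\<dots> \<le> K * (B + B)" using K0 B[of k] B[of "Suc k"] by (intro mult_left_mono) auto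
    also have "\<dots> \<le> c" by (simp add: c_def)
    finally show ?thesis .
  qed
  have "AE x in M. \<exists>C. \<forall>k. cmod (complex_of_real ((r/2) ^ k / c) * a k x) \<le> C * (2 * K) ^ k"
  proof (rule growth)
    fix k
    show "(\<lambda>x. complex_of_real ((r/2) ^ k / c) * a k x) \<in> elems X" by (rule scale[OF a])
    show "qnorm X (\<lambda>x. complex_of_real ((r/2) ^ k / c) * a k x) \<le> 1"
      using qnorm_scale_real[OF a, of "(r/2) ^ k / c" k] coeff[of k] r(1) c0 by simp
  qed
  then have sm: "AE x in M. \<forall>z\<in>ball z0 (r / (4 * K)). (\<lambda>k. a k x * (z - z0) ^ k) sums P z x"
  proof eventually_elim
    case (elim x)
    then obtain C where C: "\<And>k. cmod (complex_of_real ((r/2) ^ k / c) * a k x) \<le> C * (2 * K) ^ k" by blast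
    show ?case
    proof
      fix z assume z: "z \<in> ball z0 (r / (4 * K))"
      define q where "q = cmod (z - z0) * (4 * K) / r"
      have q: "0 \<le> q" "q < 1" using z r(1) K0 by (auto simp: q_def dist_norm norm_minus_commute field_simps)
      have "cmod (a k x * (z - z0) ^ k) \<le> c * C * q ^ k" for k
      proof -
        have "(r/2) ^ k / c * cmod (a k x) \<le> C * (2 * K) ^ k" using C[of k] r(1) c0 by (simp add: norm_mult norm_divide norm_power)
        then have "cmod (a k x) \<le> c * C * ((2 * K) ^ k / (r/2) ^ k)" using r(1) c0 by (simp add: field_simps)
        then have "cmod (a k x) * cmod (z - z0) ^ k \<le> c * C * ((2 * K) ^ k / (r/2) ^ k) * cmod (z - z0) ^ k"
          by (intro mult_right_mono) auto
        also have "\<dots> = c * C * q ^ k" 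
        proof -
          have "q = (2 * K) / (r/2) * cmod (z - z0)" by (simp add: q_def)
          then show ?thesis by (simp only: power_mult_distrib power_divide ac_simps)
        qed
        finally show ?thesis by (simp add: norm_mult norm_power)
      qed
      moreover have "summable (\<lambda>k. c * C * q ^ k)" using q by (intro summable_mult summable_geometric) auto
      ultimately have "summable (\<lambda>k. a k x * (z - z0) ^ k)" by (rule summable_comparison_test'[of _ 0, rotated])
      then show "(\<lambda>k. a k x * (z - z0) ^ k) sums P z x" unfolding P_def by (rule summable_sums)
    qed
  qed
  have \<rho>: "r / (4 * K) \<le> r" using r(1) K1 by (simp add: field_simps)
  then have sub: "ball z0 (r / (4 * K)) \<subseteq> ball z0 r" by (simp add: subset_ball)
  show thesis
  proof (rule that)
    show "0 < r / (4 * K)" using r K0 by simp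
    show "ball z0 (r / (4 * K)) \<subseteq> S" using sub r by auto
    show "AE x in M. (\<lambda>z. P z x) holomorphic_on ball z0 (r / (4 * K))"
      using sm by eventually_elim (rule power_series_holomorphic, auto)
    show "\<forall>z\<in>ball z0 (r / (4 * K)). AE x in M. F z x = P z x"
    proof (rule ballI)
      fix z assume z: "z \<in> ball z0 (r / (4 * K))"
      show "AE x in M. F z x = P z x"
      proof (rule AE_limit_unique[OF FX part])
        show "z \<in> S" using z sub r by auto
        show "(\<lambda>n. qnorm X (\<lambda>x. F z x - (\<Sum>k<n. (z - z0) ^ k * a k x))) \<longlonglongrightarrow> 0" using lim z sub by auto
        show "AE x in M. (\<lambda>n. \<Sum>k<n. (z - z0) ^ k * a k x) \<longlonglongrightarrow> P z x"
          using sm by eventually_elim (use z in \<open>auto simp: sums_def mult.commute\<close>)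
      qed
    qed
  qed
qed

text \<open>Local versions agree only almost everywhere, for each z separately. Countably many balls
  suffice by the Lindeloef property, and overlaps are compared at the points of a countable dense
  set, so a single null set is discarded; continuity does the rest.\<close>

lemma holomorphic_version:
  assumes F: "qanalytic_on X S F"
  obtains G where "AE x in M. (\<lambda>z. G z x) holomorphic_on S" "\<And>z. z \<in> S \<Longrightarrow> AE x in M. F z x = G z x"
proof -
  define V where "V w \<rho> P \<longleftrightarrow> 0 < \<rho> \<and> ball w \<rho> \<subseteq> S \<and> (AE x in M. (\<lambda>z. P z x) holomorphic_on ball w \<rho>) \<and>
    (\<forall>z\<in>ball w \<rho>. AE x in M. F z x = P z x)" for w \<rho> P
  have "\<exists>\<rho> P. V w \<rho> P" if "w \<in> S" for w
  proof -
    from local_version[OF F that] obtain \<rho> P where "0 < \<rho>" "ball w \<rho> \<subseteq> S" 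
      "AE x in M. (\<lambda>z. P z x) holomorphic_on ball w \<rho>"
      "\<forall>z\<in>ball w \<rho>. AE x in M. F z x = P z x" .
    then have "V w \<rho> P" unfolding V_def by blast
    then show ?thesis by blast
  qed
  then obtain \<rho> P where V: "\<And>w. w \<in> S \<Longrightarrow> V w (\<rho> w) (P w)" by metis
  have P: "\<And>w. w \<in> S \<Longrightarrow> 0 < \<rho> w" "\<And>w. w \<in> S \<Longrightarrow> ball w (\<rho> w) \<subseteq> S"
    "\<And>w. w \<in> S \<Longrightarrow> AE x in M. (\<lambda>z. P w z x) holomorphic_on ball w (\<rho> w)"
    "\<And>w z. w \<in> S \<Longrightarrow> z \<in> ball w (\<rho> w) \<Longrightarrow> AE x in M. F z x = P w z x"
    using V unfolding V_def by auto
  obtain \<F>' where F': "\<F>' \<subseteq> (\<lambda>w. ball w (\<rho> w)) ` S" "countable \<F>'" "\<Union>\<F>' = (\<Union>w\<in>S. ball w (\<rho> w))"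
    using Lindelof[of "(\<lambda>w. ball w (\<rho> w)) ` S"] by auto
  obtain Z where Z: "countable Z" "Z \<subseteq> S" "\<F>' = (\<lambda>w. ball w (\<rho> w)) ` Z"
    using F'(1,2) countable_subset_image[of \<F>' "\<lambda>w. ball w (\<rho> w)" S] by auto
  have S: "(\<Union>w\<in>Z. ball w (\<rho> w)) = S" using F'(3) P(1,2) Z(3) by force
  obtain Q :: "complex set" where Q: "countable Q" "\<And>U. open U \<Longrightarrow> U \<noteq> {} \<Longrightarrow> \<exists>q\<in>Q. q \<in> U"
    using countable_dense_setE by blast
  \<comment> \<open>The ball depends on z but not on x; otherwise the almost everywhere equality
    with F z would be lost.\<close>
  define c where "c z = (SOME w. w \<in> Z \<and> z \<in> ball w (\<rho> w))" for z
  have c: "c z \<in> Z" "z \<in> ball (c z) (\<rho> (c z))" if "z \<in> S" for z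
  proof -
    have "\<exists>w. w \<in> Z \<and> z \<in> ball w (\<rho> w)" using S that by blast
    from someI_ex[OF this] show "c z \<in> Z" "z \<in> ball (c z) (\<rho> (c z))" unfolding c_def by blast+
  qed
  define G where "G z = P (c z) z" for z
  have 1: "AE x in M. \<forall>w\<in>Z. (\<lambda>z. P w z x) holomorphic_on ball w (\<rho> w)"
    using P(3) Z by (intro AE_ball_countable[THEN iffD2]) auto
  have 2: "AE x in M. \<forall>w\<in>Z. \<forall>v\<in>Z. \<forall>q\<in>Q. q \<in> ball w (\<rho> w) \<inter> ball v (\<rho> v) \<longrightarrow> P w q x = P v q x"
  proof (intro AE_ball_countable[THEN iffD2] Z Q ballI)
    fix w v q assume "w \<in> Z" "v \<in> Z"
    then show "AE x in M. q \<in> ball w (\<rho> w) \<inter> ball v (\<rho> v) \<longrightarrow> P w q x = P v q x"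
    proof (cases "q \<in> ball w (\<rho> w) \<inter> ball v (\<rho> v)")
      case True
      then have "AE x in M. F q x = P w q x" "AE x in M. F q x = P v q x"
        using P(4) \<open>w \<in> Z\<close> \<open>v \<in> Z\<close> Z(2) by auto
      then show ?thesis by eventually_elim auto
    qed auto
  qed
  show thesis
  proof (rule that)
    show "AE x in M. (\<lambda>z. G z x) holomorphic_on S"
      using 1 2
    proof eventually_elim
      case (elim x)
      have eq: "P w z x = P v z x" if wv: "w \<in> Z" "v \<in> Z" and z: "z \<in> ball w (\<rho> w) \<inter> ball v (\<rho> v)" for w v z
      proof (rule ccontr)
        assume ne: "P w z x \<noteq> P v z x"
        let ?U = "ball w (\<rho> w) \<inter> ball v (\<rho> v)"
        have "continuous_on ?U (\<lambda>z. P w z x - P v z x)"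
          by (intro continuous_on_diff holomorphic_on_imp_continuous_on
              holomorphic_on_subset[OF bspec[OF elim(1) wv(1)]] holomorphic_on_subset[OF bspec[OF elim(1) wv(2)]]) blast+
        then have "open (?U \<inter> (\<lambda>z. P w z x - P v z x) -` (- {0}))"
          by (intro continuous_open_preimage) auto
        moreover have "z \<in> ?U \<inter> (\<lambda>z. P w z x - P v z x) -` (- {0})" using z ne by auto
        ultimately obtain q where "q \<in> Q" "q \<in> ?U \<inter> (\<lambda>z. P w z x - P v z x) -` (- {0})" using Q(2) by blast
        then show False using elim(2) wv by auto
      qed
      have "(\<lambda>z. G z x) holomorphic_on (\<Union>w\<in>Z. ball w (\<rho> w))"
      proof (rule holomorphic_on_UN_open)
        fix w assume w: "w \<in> Z"
        have "P w z x = G z x" if "z \<in> ball w (\<rho> w)" for z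
        proof -
          have "z \<in> S" using that w S by auto
          then show ?thesis unfolding G_def using c that w by (intro eq) auto
        qed
        then show "(\<lambda>z. G z x) holomorphic_on ball w (\<rho> w)"
          by (rule holomorphic_transform[OF bspec[OF elim(1) w]])
      qed auto
      then show ?case using S by simp
    qed
    show "AE x in M. F z x = G z x" if "z \<in> S" for z unfolding G_def
      using P(4)[OF subsetD[OF Z(2) c(1)[OF that]] c(2)[OF that]] .
  qed
qed

end

section \<open>The couple of Orlicz spaces and its sum\<close>

locale orlicz_pair = A: young_orlicz M X K \<Phi>0 + B: young_orlicz M X K \<Phi>1
  for M :: "'a measure" and X K \<Phi>0 \<Phi>1
begin

abbreviation "X0 \<equiv> orlicz M X \<Phi>0"
abbreviation "X1 \<equiv> orlicz M X \<Phi>1"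
abbreviation "XS \<equiv> sum_space M X0 X1"

sublocale S: growth_space M XS K
proof (intro growth_space.intro growth_space_axioms.intro)
  show "qideal M XS K" by (rule qideal_sum_space) (rule A.qideal_orlicz B.qideal_orlicz)+
  fix v :: "nat \<Rightarrow> 'a \<Rightarrow> complex"
  assume v: "\<And>k. v k \<in> elems XS" "\<And>k. qnorm XS (v k) \<le> 1"
  \<comment> \<open>The bound 2 leaves room above 1, as the infimum over splittings need not be
    attained.\<close>
  have ex: "\<exists>p. fst p \<in> elems X0 \<and> snd p \<in> elems X1 \<and> (AE x in M. v k x = fst p x + snd p x) \<and> qnorm X0 (fst p) < 2 \<and> qnorm X1 (snd p) < 2" for k
  proof -
    have "qnorm XS (v k) < 2" using v(2)[of k] by linarith
    from sum_space_split[OF v(1) this] obtain a b where ab: "a \<in> elems X0" "b \<in> elems X1" "AE x in M. v k x = a x + b x" "qnorm X0 a + qnorm X1 b < 2" .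
    then show ?thesis using A.orlicz_qnorm_nonneg[OF ab(1)] B.orlicz_qnorm_nonneg[OF ab(2)] by (intro exI[of _ "(a, b)"]) auto
  qed
  define p where "p k = (SOME p. fst p \<in> elems X0 \<and> snd p \<in> elems X1 \<and> (AE x in M. v k x = fst p x + snd p x) \<and> qnorm X0 (fst p) < 2 \<and> qnorm X1 (snd p) < 2)" for k
  define a where "a k = fst (p k)" for k
  define b where "b k = snd (p k)" for k
  have ab: "\<And>k. a k \<in> elems X0" "\<And>k. b k \<in> elems X1" "\<And>k. AE x in M. v k x = a k x + b k x"
     "\<And>k. qnorm X0 (a k) < 2" "\<And>k. qnorm X1 (b k) < 2"
    using someI_ex[OF ex] unfolding a_def b_def p_def by auto
  have "AE x in M. \<forall>k. v k x = a k x + b k x" using ab(3) by (simp add: AE_all_countable)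
  with A.orlicz_growth[of a, OF ab(1,4)] B.orlicz_growth[of b, OF ab(2,5)]
  show "AE x in M. \<exists>C. \<forall>k. cmod (v k x) \<le> C * (2 * K) ^ k"
  proof eventually_elim
    case (elim x)
    then obtain C D where CD: "\<And>k. cmod (a k x) \<le> C * (2 * K) ^ k" "\<And>k. cmod (b k x) \<le> D * (2 * K) ^ k" by blast
    have "cmod (v k x) \<le> (C + D) * (2 * K) ^ k" for k
    proof -
      have "cmod (v k x) \<le> cmod (a k x) + cmod (b k x)" using elim(3) norm_triangle_ineq by auto
      also have "\<dots> \<le> (C + D) * (2 * K) ^ k" using CD[of k] by (simp add: algebra_simps)
      finally show ?thesis .
    qed
    then show ?case by blast
  qed
qed

text \<open>Cutting u n along the set where |g1| \<le> |g0| splits it measurably into parts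
  dominated by 2 g0 and 2 g1; the set is the same for all n, so both parts fall under dominated
  convergence.\<close>

lemma sum_dominated:
  fixes u :: "nat \<Rightarrow> 'a \<Rightarrow> complex"
  assumes um[measurable]: "\<And>n. u n \<in> borel_measurable M" and g: "g0 \<in> elems X0" "g1 \<in> elems X1"
    and le: "\<And>n. AE x in M. cmod (u n x) \<le> cmod (g0 x) + cmod (g1 x)"
    and lim: "AE x in M. (\<lambda>n. u n x) \<longlonglongrightarrow> 0"
  shows "(\<lambda>n. qnorm XS (u n)) \<longlonglongrightarrow> 0" "u n \<in> elems XS"
proof -
  have [measurable]: "g0 \<in> borel_measurable M" "g1 \<in> borel_measurable M" using g A.O.meas B.O.meas by auto
  define a where "a n x = (if cmod (g1 x) \<le> cmod (g0 x) then u n x else 0)" for n x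
  define b where "b n x = (if cmod (g1 x) \<le> cmod (g0 x) then 0 else u n x)" for n x
  have am [measurable]: "a n \<in> borel_measurable M" "b n \<in> borel_measurable M" for n unfolding a_def b_def by measurable
  have a: "AE x in M. cmod (a n x) \<le> cmod (2 * g0 x)" for n using le[of n] by eventually_elim (auto simp: a_def norm_mult)
  have b: "AE x in M. cmod (b n x) \<le> cmod (2 * g1 x)" for n using le[of n] by eventually_elim (auto simp: b_def norm_mult)
  have "(\<lambda>n. qnorm X0 (a n)) \<longlonglongrightarrow> 0"
    by (rule A.orlicz_dominated[OF am(1) A.O.scale[OF g(1)] a]) (use lim in \<open>eventually_elim, case_tac "cmod (g1 x) \<le> cmod (g0 x)"; simp add: a_def\<close>)
  moreover have "(\<lambda>n. qnorm X1 (b n)) \<longlonglongrightarrow> 0"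
    by (rule B.orlicz_dominated[OF am(2) B.O.scale[OF g(2)] b]) (use lim in \<open>eventually_elim, case_tac "cmod (g1 x) \<le> cmod (g0 x)"; simp add: b_def\<close>)
  ultimately have l: "(\<lambda>n. qnorm X0 (a n) + qnorm X1 (b n)) \<longlonglongrightarrow> 0" using tendsto_add by fastforce
  have aX: "a n \<in> elems X0" and bX: "b n \<in> elems X1" for n
    using A.O.idealD(1)[OF am(1) A.O.scale[OF g(1)] a] B.O.idealD(1)[OF am(2) B.O.scale[OF g(2)] b] by auto
  have s: "u n \<in> elems XS \<and> qnorm XS (u n) \<le> qnorm X0 (a n) + qnorm X1 (b n)" for n
    using sum_space_le[OF A.qideal_orlicz B.qideal_orlicz aX bX, of "u n" n n] by (auto simp: a_def b_def)
  show "u n \<in> elems XS" using s by auto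
  have bd: "norm (qnorm XS (u n)) \<le> qnorm X0 (a n) + qnorm X1 (b n)" for n using s[of n] S.nonneg[of "u n"] by auto
  show "(\<lambda>n. qnorm XS (u n)) \<longlonglongrightarrow> 0" by (rule Lim_null_comparison[OF always_eventually[OF allI[OF bd]] l])
qed

end

section \<open>Discrete subharmonicity\<close>

lemma powr_add_le_sum:
  fixes a b p :: real
  assumes "0 \<le> a" "0 \<le> b" "0 < p" "p \<le> 1"
  shows "(a + b) powr p \<le> a powr p + b powr p"
proof (cases "a = 0 \<or> b = 0")
  case False
  then have ab: "0 < a" "0 < b" using assms by auto
  have "(a + b) powr p = a * (a + b) powr (p - 1) + b * (a + b) powr (p - 1)"
  proof -
    have "(a + b) powr p = (a + b) powr (1 + (p - 1))" by simp
    also have "\<dots> = (a + b) * (a + b) powr (p - 1)" unfolding powr_add using ab by simp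
    finally show ?thesis by (simp add: distrib_right)
  qed
  also have "\<dots> \<le> a * a powr (p - 1) + b * b powr (p - 1)"
    using ab assms by (intro add_mono mult_left_mono powr_mono2') auto
  also have "\<dots> = a powr p + b powr p" using ab by (simp add: powr_diff)
  finally show ?thesis .
qed (use assms in auto)

section \<open>Averages over roots of unity\<close>

definition unity_root :: "nat \<Rightarrow> nat \<Rightarrow> complex" where
  "unity_root n j = exp (2 * of_real pi * \<i> * of_nat j / of_nat n)"

lemma norm_unity_root [simp]: "cmod (unity_root n j) = 1"
  unfolding unity_root_def by (simp add: norm_exp_eq_Re)

lemma sum_unity_root_power:
  assumes "0 < k" "k < n"
  shows "(\<Sum>j<n. unity_root n j ^ k) = 0"
proof -
  let ?z = "unity_root n k"
  have "?z \<noteq> 1" using assms complex_root_unity_eq_1[of n k] unfolding unity_root_def by (auto dest: nat_dvd_not_less)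
  have p: "unity_root n j ^ k = ?z ^ j" for j
    unfolding unity_root_def exp_of_nat_mult[symmetric] by (simp add: mult_ac)
  have "?z ^ n = 1" using assms complex_root_unity[of n k] unfolding unity_root_def by auto
  then show ?thesis unfolding p using geometric_sum[OF \<open>?z \<noteq> 1\<close>, of n] by simp
qed

lemma holomorphic_taylor_approx:
  assumes h: "h holomorphic_on ball 0 R" and r: "0 < r" "r < R" and e: "0 < (e::real)"
  obtains c N where "c 0 = h 0" "0 < N" "\<And>z. cmod z \<le> r \<Longrightarrow> cmod (h z - (\<Sum>k<N. c k * z ^ k)) < e"
proof -
  define c where "c k = (deriv ^^ k) h 0 / fact k" for k
  have sums: "(\<lambda>k. c k * z ^ k) sums h z" if "cmod z < R" for z
    using holomorphic_power_series[OF h, of z] that by (simp add: c_def)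
  define s where "s = (r + R) / 2"
  have s: "r < s" "s < R" "0 < s" using r by (auto simp: s_def)
  have "summable (\<lambda>k. c k * of_real s ^ k)" using sums[of "of_real s"] s by (auto simp: sums_iff)
  then have sm: "summable (\<lambda>k. norm (c k * of_real r ^ k))"
    by (rule powser_insidea) (use r s in auto)
  obtain N where N: "\<And>n. N \<le> n \<Longrightarrow> norm (\<Sum>i. norm (c (i + n) * of_real r ^ (i + n))) < e"
    using suminf_exist_split[OF e sm] by auto
  show thesis
  proof (rule that)
    show "c 0 = h 0" by (simp add: c_def)
    show "0 < Suc N" by simp
    fix z :: complex assume z: "cmod z \<le> r"
    have sz: "summable (\<lambda>k. c k * z ^ k)" "h z = (\<Sum>k. c k * z ^ k)" using sums[of z] z r by (auto simp: sums_iff)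
    have le: "norm (c k * z ^ k) \<le> norm (c k * of_real r ^ k)" for k
      using z r by (auto simp: norm_mult norm_power intro!: mult_left_mono power_mono)
    have sm': "summable (\<lambda>i. norm (c (i + Suc N) * of_real r ^ (i + Suc N)))"
      using sm by (subst summable_iff_shift)
    have sm'': "summable (\<lambda>i. norm (c (i + Suc N) * z ^ (i + Suc N)))"
      by (rule summable_comparison_test'[OF sm', of 0], simp only: real_norm_def abs_norm_cancel, rule le)
    have "h z - (\<Sum>k<Suc N. c k * z ^ k) = (\<Sum>i. c (i + Suc N) * z ^ (i + Suc N))"
      unfolding sz(2) by (subst suminf_split_initial_segment[OF sz(1), of "Suc N"]) simp
    also have "norm \<dots> \<le> (\<Sum>i. norm (c (i + Suc N) * z ^ (i + Suc N)))" by (rule summable_norm[OF sm''])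
    also have "\<dots> \<le> (\<Sum>i. norm (c (i + Suc N) * of_real r ^ (i + Suc N)))"
      by (rule suminf_le[OF le sm'' sm'])
    also have "\<dots> < e" using N[of "Suc N"] by simp
    finally show "cmod (h z - (\<Sum>k<Suc N. c k * z ^ k)) < e" .
  qed
qed

text \<open>Once n exceeds the degree of a Taylor polynomial, the roots of unity average it to
  exactly its constant term; only the uniform Taylor error remains.\<close>

lemma unity_root_average:
  assumes h: "h holomorphic_on ball 0 R" and r: "0 < r" "r < R"
  shows "(\<lambda>n. (\<Sum>j<n. h (of_real r * unity_root n j)) / of_nat n) \<longlonglongrightarrow> h 0"
proof (rule LIMSEQ_I)
  fix e :: real assume e: "0 < e"
  obtain c N where c: "c 0 = h 0" "0 < N" and ap: "\<And>z. cmod z \<le> r \<Longrightarrow> cmod (h z - (\<Sum>k<N. c k * z ^ k)) < e"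
    using holomorphic_taylor_approx[OF h r e] by blast
  have "norm ((\<Sum>j<n. h (of_real r * unity_root n j)) / of_nat n - h 0) < e" if n: "N \<le> n" for n
  proof -
    have n0: "0 < n" using n c by simp
    let ?z = "\<lambda>j. of_real r * unity_root n j"
    have "(\<Sum>j<n. \<Sum>k<N. c k * ?z j ^ k) = (\<Sum>k<N. c k * of_real r ^ k * (\<Sum>j<n. unity_root n j ^ k))"
      by (subst sum.swap) (simp add: sum_distrib_left power_mult_distrib mult_ac)
    also have "\<dots> = (\<Sum>k<N. if k = 0 then c 0 * of_nat n else 0)"
      using n by (intro sum.cong) (auto simp: sum_unity_root_power)
    also have "\<dots> = h 0 * of_nat n" using c by simp
    finally have avg: "(\<Sum>j<n. \<Sum>k<N. c k * ?z j ^ k) = h 0 * of_nat n" .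
    have "cmod ((\<Sum>j<n. h (?z j)) - h 0 * of_nat n) = cmod (\<Sum>j<n. h (?z j) - (\<Sum>k<N. c k * ?z j ^ k))"
      unfolding avg[symmetric] by (simp add: sum_subtractf)
    also have "\<dots> \<le> (\<Sum>j<n. cmod (h (?z j) - (\<Sum>k<N. c k * ?z j ^ k)))" by (rule norm_sum)
    also have "\<dots> < (\<Sum>j<n. e)"
      using n0 r by (intro sum_strict_mono ap) (auto simp: norm_mult)
    finally have "cmod ((\<Sum>j<n. h (?z j)) - h 0 * of_nat n) < e * n" by (simp add: mult.commute)
    moreover have "(\<Sum>j<n. h (?z j)) / of_nat n - h 0 = ((\<Sum>j<n. h (?z j)) - h 0 * of_nat n) / of_nat n"
      using n0 by (simp add: field_simps)
    ultimately show ?thesis using n0 by (simp add: norm_divide divide_less_eq)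
  qed
  then show "\<exists>no. \<forall>n\<ge>no. norm ((\<Sum>j<n. h (of_real r * unity_root n j)) / of_nat n - h 0) < e" by blast
qed

text \<open>A root inside the circle is reflected to the outside; this keeps the modulus on the circle
  and does not decrease it at the centre.\<close>

lemma poly_reflect_roots:
  fixes P :: "complex poly"
  assumes "P \<noteq> 0" and r: "0 < r"
  obtains Q where "Q holomorphic_on UNIV" "\<And>z. cmod z = r \<Longrightarrow> cmod (Q z) = cmod (poly P z)"
    "\<And>z. cmod z < r \<Longrightarrow> Q z \<noteq> 0" "cmod (poly P 0) \<le> cmod (Q 0)"
proof -
  have "\<exists>Q. Q holomorphic_on UNIV \<and> (\<forall>z. cmod z = r \<longrightarrow> cmod (Q z) = cmod (poly P z)) \<and>
    (\<forall>z. cmod z < r \<longrightarrow> Q z \<noteq> 0) \<and> cmod (poly P 0) \<le> cmod (Q 0)"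
    using assms(1)
  proof (induction "degree P" arbitrary: P)
    case 0
    then obtain c where "P = [:c:]" "c \<noteq> 0" by (metis degree_eq_zeroE pCons_0_0)
    then show ?case by (intro exI[of _ "\<lambda>_. c"]) auto
  next
    case (Suc d)
    then have "\<not> constant (poly P)" by (simp add: constant_degree)
    then obtain a where "poly P a = 0" using fundamental_theorem_of_algebra by blast
    then obtain P' where P': "P = [:-a, 1:] * P'" by (auto simp: poly_eq_0_iff_dvd dvd_def)
    have ne: "P' \<noteq> 0" using P' Suc.prems by auto
    have "degree P = Suc (degree P')" using P' ne by (simp add: degree_mult_eq del: mult_pCons_left)
    then obtain Q where Q: "Q holomorphic_on UNIV" "\<And>z. cmod z = r \<Longrightarrow> cmod (Q z) = cmod (poly P' z)"
      "\<And>z. cmod z < r \<Longrightarrow> Q z \<noteq> 0" "cmod (poly P' 0) \<le> cmod (Q 0)" using Suc.hyps(1)[of P'] Suc.hyps(2) ne by auto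
    define f where "f z = (if cmod a < r then of_real r - cnj a * z / of_real r else z - a)" for z
    have f1: "f holomorphic_on UNIV" unfolding f_def using r by (cases "cmod a < r") (auto intro!: holomorphic_intros)
    have f2: "cmod (f z) = cmod (z - a)" if z: "cmod z = r" for z
    proof (cases "cmod a < r")
      case True
      have "z * cnj z = of_real (r^2)" using z complex_norm_square[of z] by simp
      then have "f z = z * (cnj z - cnj a) / of_real r" using True r by (simp add: f_def field_simps power2_eq_square)
      also have "cmod \<dots> = cmod (cnj (z - a))" using z r by (simp add: norm_mult norm_divide)
      finally show ?thesis by (simp only: complex_mod_cnj)
    qed (simp add: f_def)
    have f3: "f z \<noteq> 0" if z: "cmod z < r" for z
    proof (cases "cmod a < r")
      case True
      have "cmod (cnj a * z / of_real r) < r"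
        using mult_strict_mono[OF True z] r by (simp add: norm_mult norm_divide divide_less_eq)
      then have "cnj a * z / of_real r \<noteq> of_real r" using r by auto
      then show ?thesis using True by (auto simp: f_def)
    qed (use z in \<open>auto simp: f_def\<close>)
    have f4: "cmod a \<le> cmod (f 0)" using r by (auto simp: f_def)
    show ?case
    proof (intro exI[of _ "\<lambda>z. f z * Q z"] conjI allI impI)
      show "(\<lambda>z. f z * Q z) holomorphic_on UNIV" by (intro holomorphic_on_mult f1 Q)
      show "cmod (f z * Q z) = cmod (poly P z)" if "cmod z = r" for z
        unfolding norm_mult f2[OF that] Q(2)[OF that] P' by (simp flip: norm_mult add: algebra_simps)
      show "f z * Q z \<noteq> 0" if "cmod z < r" for z using f3 Q(3) that by auto
      show "cmod (poly P 0) \<le> cmod (f 0 * Q 0)"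
        using mult_mono[OF f4 Q(4)] by (simp add: P' norm_mult)
    qed
  qed
  then show thesis using that by blast
qed

text \<open>A Taylor polynomial has finitely many roots, which can be reflected out of the disc. The
  resulting Q has no zero there, so a holomorphic p-th power h exists and the mean value property
  applies to it. This h lives on the open disc only, so the mean is taken at a radius s slightly
  below r and compared with radius r by uniform continuity of |Q|^p.\<close>

lemma powr_subharmonic:
  assumes H: "H holomorphic_on ball 0 1" and r: "0 < r" "r < 1" and p: "0 < p" "p \<le> 1"
    and c: "c < cmod (H 0) powr p"
  shows "eventually (\<lambda>n. c * real n < (\<Sum>j<n. cmod (H (of_real r * unity_root n j)) powr p)) sequentially"
proof (cases "H 0 = 0")
  case True
  then have "c < 0" using c by simp
  have "c * real n < (\<Sum>j<n. cmod (H (of_real r * unity_root n j)) powr p)" if "1 \<le> n" for n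
  proof (rule less_le_trans)
    show "c * real n < 0" using that \<open>c < 0\<close> by (simp add: mult_neg_pos)
    show "0 \<le> (\<Sum>j<n. cmod (H (of_real r * unity_root n j)) powr p)" by (rule sum_nonneg) simp
  qed
  then show ?thesis unfolding eventually_sequentially by blast
next
  case False
  \<comment> \<open>One e is lost for moving from radius r to s, one for the Taylor error and one
    for the finite average; the fourth keeps the inequality strict.\<close>
  define e where "e = (cmod (H 0) powr p - c) / 4"
  have e: "0 < e" using c by (simp add: e_def)
  \<comment> \<open>The Taylor error is chosen so that its p-th power is below e, as subadditivity
    of the p-th power requires.\<close>
  have "0 < e powr (1/p)" using e by simp
  from holomorphic_taylor_approx[OF H r this] obtain a N where a: "a 0 = H 0" "0 < N"
    and ap: "\<And>z. cmod z \<le> r \<Longrightarrow> cmod (H z - (\<Sum>k<N. a k * z ^ k)) < e powr (1/p)" by blast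
  define P where "P = (\<Sum>k<N. monom (a k) k)"
  have P: "poly P z = (\<Sum>k<N. a k * z ^ k)" for z by (simp add: P_def poly_sum poly_monom)
  have "poly P 0 = (\<Sum>k<N. if k = 0 then a 0 else 0)" unfolding P by (intro sum.cong) (auto simp: power_0_left)
  then have P0: "poly P 0 = H 0" using a by simp
  then have "P \<noteq> 0" using False by auto
  from poly_reflect_roots[OF this r(1)] obtain Q where Q: "Q holomorphic_on UNIV"
    "\<And>z. cmod z = r \<Longrightarrow> cmod (Q z) = cmod (poly P z)"
    "\<And>z. cmod z < r \<Longrightarrow> Q z \<noteq> 0" "cmod (poly P 0) \<le> cmod (Q 0)" by blast
  have "Q holomorphic_on ball 0 r" using Q(1) holomorphic_on_subset by blast
  moreover have "contractible (ball (0::complex) r)" by (simp add: convex_imp_contractible)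
  ultimately obtain g where g: "g holomorphic_on ball 0 r" "\<And>z. z \<in> ball 0 r \<Longrightarrow> Q z = exp (g z)"
    using contractible_imp_holomorphic_log[of Q "ball 0 r"] Q(3) by auto
  define h where "h z = exp (of_real p * g z)" for z
  have h: "h holomorphic_on ball 0 r" unfolding h_def by (intro holomorphic_intros g)
  have hQ: "cmod (h z) = cmod (Q z) powr p" if "cmod z < r" for z
    using g(2)[of z] that by (simp add: h_def norm_exp_eq_Re powr_def)
  have "continuous_on (cball 0 r) (\<lambda>z. cmod (Q z) powr p)"
  proof (rule continuous_on_powr')
    show "continuous_on (cball 0 r) (\<lambda>z. cmod (Q z))"
      by (intro continuous_on_norm holomorphic_on_imp_continuous_on holomorphic_on_subset[OF Q(1)]) simp
  qed (use p in auto)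
  then have "uniformly_continuous_on (cball 0 r) (\<lambda>z. cmod (Q z) powr p)" by (rule compact_uniformly_continuous[OF _ compact_cball])
  then obtain d where d: "0 < d" "\<And>z w. cmod z \<le> r \<Longrightarrow> cmod w \<le> r \<Longrightarrow> cmod (w - z) < d \<Longrightarrow>
     \<bar>cmod (Q w) powr p - cmod (Q z) powr p\<bar> < e"
  proof -
    obtain d where d: "0 < d" "\<forall>z\<in>cball 0 r. \<forall>w\<in>cball 0 r. dist w z < d \<longrightarrow> dist (cmod (Q w) powr p) (cmod (Q z) powr p) < e"
      using \<open>uniformly_continuous_on _ _\<close>[unfolded uniformly_continuous_on_def, rule_format, OF e] by blast
    show thesis
    proof (rule that[OF d(1)])
      fix z w assume "cmod z \<le> r" "cmod w \<le> r" "cmod (w - z) < d"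
      then show "\<bar>cmod (Q w) powr p - cmod (Q z) powr p\<bar> < e"
        using d(2)[rule_format, of z w] by (simp add: dist_norm)
    qed
  qed
  define s where "s = max (r / 2) (r - d / 2)"
  have s: "0 < s" "s < r" "r - s < d" using r d(1) by (auto simp: s_def)
  from LIMSEQ_D[OF unity_root_average[OF h s(1,2)] e] obtain n0 where
    n0: "\<And>n. n0 \<le> n \<Longrightarrow> cmod ((\<Sum>j<n. h (of_real s * unity_root n j)) / of_nat n - h 0) < e" by blast
  have "c * real n < (\<Sum>j<n. cmod (H (of_real r * unity_root n j)) powr p)" if n: "max 1 n0 \<le> n" for n
  proof -
    have np: "0 < n" using n by simp
    have each: "cmod (h (of_real s * unity_root n j)) - 2 * e \<le> cmod (H (of_real r * unity_root n j)) powr p" for j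
    proof -
      let ?z = "of_real r * unity_root n j" and ?w = "of_real s * unity_root n j"
      have zw: "cmod ?z = r" "cmod ?w = s" using r s by (auto simp: norm_mult)
      have "?w - ?z = of_real (s - r) * unity_root n j" by (simp add: algebra_simps)
      then have "cmod (?w - ?z) = r - s" using s by (simp add: norm_mult del: of_real_diff)
      then have "cmod (h ?w) \<le> cmod (Q ?z) powr p + e"
        using d(2)[of ?z ?w] hQ[of ?w] zw s by auto
      also have "cmod (Q ?z) = cmod (poly P ?z)" by (rule Q(2)[OF zw(1)])
      also have "\<dots> powr p \<le> (cmod (H ?z) + cmod (H ?z - poly P ?z)) powr p"
        using norm_triangle_ineq3[of "H ?z" "poly P ?z"] p by (intro powr_mono2) auto
      also have "\<dots> \<le> cmod (H ?z) powr p + cmod (H ?z - poly P ?z) powr p"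
        using p by (intro powr_add_le_sum) auto
      also have "cmod (H ?z - poly P ?z) powr p \<le> (e powr (1/p)) powr p"
        using ap[of ?z] zw p by (intro powr_mono2) (auto simp: P less_imp_le)
      also have "\<dots> = e" using p e by (simp add: powr_powr)
      finally show ?thesis by simp
    qed
    have "cmod (H 0) powr p \<le> cmod (h 0)" using Q(4) P0 hQ[of 0] r p by (auto intro: powr_mono2)
    moreover have "cmod (h 0) \<le> cmod ((\<Sum>j<n. h (of_real s * unity_root n j)) / of_nat n) + e"
      using n0[of n] n norm_triangle_ineq2[of "h 0" "(\<Sum>j<n. h (of_real s * unity_root n j)) / of_nat n"]
      by (simp add: norm_minus_commute)
    moreover have "cmod ((\<Sum>j<n. h (of_real s * unity_root n j)) / of_nat n) * n \<le> (\<Sum>j<n. cmod (h (of_real s * unity_root n j)))"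
      using np norm_sum[of "\<lambda>j. h (of_real s * unity_root n j)" "{..<n}"] by (simp add: norm_divide)
    ultimately have "(cmod (H 0) powr p - e) * n \<le> (\<Sum>j<n. cmod (h (of_real s * unity_root n j)))"
      by (smt (verit) mult_right_mono of_nat_0_le_iff)
    moreover have "(\<Sum>j<n. cmod (h (of_real s * unity_root n j)) - 2 * e) \<le> (\<Sum>j<n. cmod (H (of_real r * unity_root n j)) powr p)"
      by (rule sum_mono) (rule each)
    moreover have "(\<Sum>j<n. cmod (h (of_real s * unity_root n j)) - 2 * e) = (\<Sum>j<n. cmod (h (of_real s * unity_root n j))) - 2 * e * n"
      by (simp add: sum_subtractf)
    ultimately have "(cmod (H 0) powr p - 3 * e) * n \<le> (\<Sum>j<n. cmod (H (of_real r * unity_root n j)) powr p)"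
      by (simp add: algebra_simps)
    moreover have "c < cmod (H 0) powr p - 3 * e" using e by (simp add: e_def field_simps)
    then have "c * n < (cmod (H 0) powr p - 3 * e) * n" using np by (intro mult_strict_right_mono) auto
    ultimately show ?thesis by linarith
  qed
  then show ?thesis unfolding eventually_sequentially by blast
qed

section \<open>A conformal map onto the strip\<close>

text \<open>A conformal map of the unit disc onto the strip taking 0 to \<open>\<theta>\<close>: a Moebius map onto the
  right half plane, followed by a logarithm. Its only boundary singularities are 1 and
  \<open>cis (2 * pi * \<theta>)\<close>, where \<open>disc_weight\<close> vanishes.\<close>

definition half_plane_map :: "real \<Rightarrow> complex \<Rightarrow> complex" where
  "half_plane_map \<theta> w = - \<i> * (cis (pi * \<theta>) - cis (- (pi * \<theta>)) * w) / (1 - w)"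

definition strip_map :: "real \<Rightarrow> complex \<Rightarrow> complex" where
  "strip_map \<theta> w = 1 / 2 - \<i> / of_real pi * Ln (half_plane_map \<theta> w)"

definition disc_weight :: "real \<Rightarrow> complex \<Rightarrow> complex" where
  "disc_weight \<theta> w = (1 - w) * (1 - cis (- (2 * pi * \<theta>)) * w)"

lemma disc_weight_0 [simp]: "disc_weight \<theta> 0 = 1"
  by (simp add: disc_weight_def)

lemma holomorphic_disc_weight: "disc_weight \<theta> holomorphic_on S"
  unfolding disc_weight_def[abs_def] by (intro holomorphic_intros)

lemma disc_weight_eq_0: "disc_weight \<theta> w = 0 \<longleftrightarrow> w = 1 \<or> w = cis (2 * pi * \<theta>)"
proof -
  have "cis (- (2 * pi * \<theta>)) * w = 1 \<longleftrightarrow> w = cis (2 * pi * \<theta>)"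
  proof
    assume *: "cis (- (2 * pi * \<theta>)) * w = 1"
    have "w = cis (2 * pi * \<theta>) * (cis (- (2 * pi * \<theta>)) * w)" by (simp add: cis_mult flip: mult.assoc)
    then show "w = cis (2 * pi * \<theta>)" by (simp only: * mult_1_right)
  qed (simp add: cis_mult)
  then show ?thesis by (auto simp: disc_weight_def)
qed

lemma norm_disc_weight_le: "cmod w \<le> 1 \<Longrightarrow> cmod (disc_weight \<theta> w) \<le> 4"
proof -
  assume w: "cmod w \<le> 1"
  have 1: "cmod (1 - w) \<le> 2" using norm_triangle_ineq4[of 1 w] w by simp
  have 2: "cmod (1 - cis (- (2 * pi * \<theta>)) * w) \<le> 2"
    using norm_triangle_ineq4[of 1 "cis (- (2 * pi * \<theta>)) * w"] w by (simp add: norm_mult)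
  show ?thesis using mult_mono[OF 1 2] by (simp add: disc_weight_def norm_mult)
qed

context
  fixes \<theta> :: real
  assumes \<theta>: "0 < \<theta>" "\<theta> < 1"
begin

lemma sin_pi_theta_pos: "0 < sin (pi * \<theta>)"
  by (rule sin_gt_zero) (use \<theta> in auto)

text \<open>A multiple of the Poisson kernel with pole at 1: positive inside the disc and zero on
  the circle away from the pole.\<close>

lemma Re_half_plane_map:
  assumes "w \<noteq> 1"
  shows "Re (half_plane_map \<theta> w) = sin (pi * \<theta>) * (1 - (cmod w)\<^sup>2) / (cmod (1 - w))\<^sup>2"
proof -
  have "half_plane_map \<theta> w = - \<i> * ((cis (pi * \<theta>) - cis (- (pi * \<theta>)) * w) * cnj (1 - w)) / (of_real ((cmod (1 - w))\<^sup>2))"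
    using assms complex_norm_square[of "1 - w"] by (simp add: half_plane_map_def divide_simps)
  then have "Re (half_plane_map \<theta> w) = Im ((cis (pi * \<theta>) - cis (- (pi * \<theta>)) * w) * cnj (1 - w)) / (cmod (1 - w))\<^sup>2"
    by (simp only: Re_divide_of_real) simp
  also have "Im ((cis (pi * \<theta>) - cis (- (pi * \<theta>)) * w) * cnj (1 - w)) = sin (pi * \<theta>) * (1 - (cmod w)\<^sup>2)"
    unfolding cmod_power2 by (simp add: algebra_simps power2_eq_square)
  finally show ?thesis .
qed

lemma half_plane_map_nonzero:
  assumes "w \<noteq> 1" "w \<noteq> cis (2 * pi * \<theta>)"
  shows "half_plane_map \<theta> w \<noteq> 0"
proof
  assume "half_plane_map \<theta> w = 0"
  then have "cis (- (pi * \<theta>)) * w = cis (pi * \<theta>)" using assms by (auto simp: half_plane_map_def)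
  then have "cis (pi * \<theta>) * (cis (- (pi * \<theta>)) * w) = cis (pi * \<theta>) * cis (pi * \<theta>)" by simp
  then have "w = cis (2 * pi * \<theta>)" by (simp add: cis_mult flip: mult.assoc)
  then show False using assms by simp
qed

lemma Re_half_plane_map_pos: "cmod w < 1 \<Longrightarrow> 0 < Re (half_plane_map \<theta> w)"
proof -
  assume w: "cmod w < 1"
  then have "w \<noteq> 1" by auto
  moreover have "(cmod w)\<^sup>2 < 1" using w by (simp add: power_less_one_iff abs_square_less_1)
  ultimately show ?thesis using sin_pi_theta_pos by (simp add: Re_half_plane_map)
qed

lemma Re_half_plane_map_circle: "cmod w = 1 \<Longrightarrow> w \<noteq> 1 \<Longrightarrow> Re (half_plane_map \<theta> w) = 0"
  by (simp add: Re_half_plane_map)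

lemma Re_strip_map: "Re (strip_map \<theta> w) = 1 / 2 + Im (Ln (half_plane_map \<theta> w)) / pi"
  by (simp add: strip_map_def Re_divide_of_real)

lemma strip_map_in_strip: "cmod w < 1 \<Longrightarrow> strip_map \<theta> w \<in> strip"
proof -
  assume w: "cmod w < 1"
  have "half_plane_map \<theta> w \<noteq> 0" using Re_half_plane_map_pos[OF w] by auto
  then have "\<bar>Im (Ln (half_plane_map \<theta> w))\<bar> < pi / 2" using Re_half_plane_map_pos[OF w] Re_Ln_pos_lt by blast
  then have "\<bar>Im (Ln (half_plane_map \<theta> w)) / pi\<bar> < 1 / 2" by (simp add: divide_less_eq)
  then show ?thesis unfolding strip_def mem_Collect_eq Re_strip_map by linarith
qed

lemma strip_map_circle:
  assumes "cmod w = 1" "w \<noteq> 1" "w \<noteq> cis (2 * pi * \<theta>)"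
  shows "Re (strip_map \<theta> w) = 0 \<or> Re (strip_map \<theta> w) = 1"
proof -
  have nz: "half_plane_map \<theta> w \<noteq> 0" by (rule half_plane_map_nonzero[OF assms(2,3)])
  have "\<bar>Im (Ln (half_plane_map \<theta> w))\<bar> = pi / 2"
    using Re_Ln_pos_le[OF nz] Re_Ln_pos_lt[OF nz] Re_half_plane_map_circle[OF assms(1,2)] by linarith
  then have "\<bar>Im (Ln (half_plane_map \<theta> w)) / pi\<bar> = 1 / 2" by simp
  then show ?thesis unfolding Re_strip_map by linarith
qed

lemma strip_map_0: "strip_map \<theta> 0 = of_real \<theta>"
proof -
  have "half_plane_map \<theta> 0 = exp (\<i> * of_real (pi * \<theta> - pi / 2))"
  proof -
    have "exp (\<i> * of_real (pi * \<theta> - pi / 2)) = cis (pi * \<theta> - pi / 2)" by (simp add: cis_conv_exp)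
    also have "\<dots> = cis (pi * \<theta>) * cis (- (pi / 2))" by (simp only: cis_mult diff_conv_add_uminus)
    also have "cis (- (pi / 2)) = - \<i>" by (simp add: complex_eq_iff)
    finally show ?thesis by (simp add: half_plane_map_def)
  qed
  moreover have "Ln (exp (\<i> * of_real (pi * \<theta> - pi / 2))) = \<i> * of_real (pi * \<theta> - pi / 2)"
  proof (rule Ln_exp)
    have "0 < pi * \<theta>" "pi * \<theta> < pi" using \<theta> by auto
    moreover have "Im (\<i> * of_real (pi * \<theta> - pi / 2)) = pi * \<theta> - pi / 2" by simp
    ultimately show "- pi < Im (\<i> * of_real (pi * \<theta> - pi / 2))" "Im (\<i> * of_real (pi * \<theta> - pi / 2)) \<le> pi"
      using pi_gt_zero by linarith+
  qed
  ultimately have "strip_map \<theta> 0 = 1 / 2 - \<i> / of_real pi * (\<i> * of_real (pi * \<theta> - pi / 2))"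
    by (simp only: strip_map_def)
  also have "\<dots> = of_real (1 / 2 + (pi * \<theta> - pi / 2) / pi)"
    by (simp add: complex_eq_iff Re_divide_of_real Im_divide_of_real diff_divide_distrib)
  also have "\<dots> = of_real \<theta>" by (simp add: field_simps)
  finally show ?thesis .
qed

lemma holomorphic_strip_map: "strip_map \<theta> holomorphic_on ball 0 1"
proof -
  have "half_plane_map \<theta> holomorphic_on ball 0 1"
    unfolding half_plane_map_def[abs_def] by (intro holomorphic_intros) auto
  then show ?thesis unfolding strip_map_def[abs_def]
    using Re_half_plane_map_pos by (intro holomorphic_intros) (force simp: complex_nonpos_Reals_iff)+
qed

lemma isCont_strip_map:
  assumes "cmod w = 1" "w \<noteq> 1" "w \<noteq> cis (2 * pi * \<theta>)"
  shows "isCont (strip_map \<theta>) w"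
proof -
  have "isCont (half_plane_map \<theta>) w"
    unfolding half_plane_map_def[abs_def] using assms by (intro continuous_intros) auto
  moreover have "half_plane_map \<theta> w \<notin> \<real>\<^sub>\<le>\<^sub>0"
    using half_plane_map_nonzero[OF assms(2,3)] Re_half_plane_map_circle[OF assms(1,2)]
    by (auto simp: complex_nonpos_Reals_iff complex_eq_iff)
  ultimately have "isCont (\<lambda>w. Ln (half_plane_map \<theta> w)) w"
    by (rule isCont_Ln')
  then show ?thesis unfolding strip_map_def[abs_def]
    by (rule continuous_diff[OF continuous_const continuous_mult[OF continuous_const]])
qed

end

lemma closure_strip: "closure strip = {z. 0 \<le> Re z \<and> Re z \<le> 1}"
proof -
  have "closure (strip :: complex set) \<subseteq> {z. 0 \<le> Re z} \<inter> {z. Re z \<le> 1}"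
    by (intro closure_minimal closed_Int closed_halfspace_Re_ge closed_halfspace_Re_le) (auto simp: strip_def)
  moreover have "z \<in> closure strip" if z: "0 \<le> Re z" "Re z \<le> 1" for z
  proof -
    let ?f = "\<lambda>n. of_real (1 - 1 / (real n + 2)) * (z - of_real (1/2)) + of_real (1/2)"
    have "?f n \<in> strip" for n
    proof -
      define c where "c = 1 - 1 / (real n + 2)"
      have c: "0 < c" "c < 1" by (auto simp: c_def field_simps)
      have "Re (of_real c * (z - of_real (1/2)) + of_real (1/2)) = c * (Re z - 1/2) + 1/2" by simp
      moreover have "\<bar>c * (Re z - 1/2)\<bar> < 1/2"
      proof -
        have zh: "\<bar>Re z - 1/2\<bar> \<le> 1/2" using z by linarith
        have "\<bar>c * (Re z - 1/2)\<bar> = c * \<bar>Re z - 1/2\<bar>" using c by (simp add: abs_mult)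
        also have "\<dots> \<le> c * (1/2)" using c zh by (intro mult_left_mono) auto
        also have "\<dots> < 1/2" using c by simp
        finally show ?thesis .
      qed
      ultimately show ?thesis unfolding strip_def mem_Collect_eq c_def[symmetric] by (simp only: abs_less_iff) linarith
    qed
    moreover have "?f \<longlonglongrightarrow> of_real (1 - 0) * (z - of_real (1/2)) + of_real (1/2)"
    proof (intro tendsto_intros)
      show "(\<lambda>n. 1 / (real n + 2)) \<longlonglongrightarrow> 0"
        using LIMSEQ_ignore_initial_segment[OF lim_1_over_n, of 2] by (simp add: add.commute)
    qed
    ultimately show ?thesis unfolding closure_sequential by (intro exI[of _ ?f]) simp
  qed
  ultimately show ?thesis by blast
qed

section \<open>The modular estimate\<close>

lemma young_function_bij: 
  assumes "young_function \<Phi>"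
  shows "bij_betw \<Phi> {0..} {0..}"
proof -
  have Y: "strict_mono_on {0..} \<Phi>" "continuous_on {0..} \<Phi>" "\<Phi> 0 = 0" "\<And>t. 0 \<le> t \<Longrightarrow> 0 \<le> \<Phi> t" "filterlim \<Phi> at_top at_top"
    using assms by (auto simp: young_function_def)
  have "s \<in> \<Phi> ` {0..}" if s: "0 \<le> s" for s
  proof -
    have "eventually (\<lambda>t. s \<le> \<Phi> t \<and> 0 \<le> t) at_top"
      using Y(5) eventually_ge_at_top[of 0] by (auto simp: filterlim_at_top intro: eventually_conj)
    then obtain t where t: "s \<le> \<Phi> t" "0 \<le> t" by (auto dest: eventually_happens)
    have "continuous_on {0..t} \<Phi>" using Y(2) by (rule continuous_on_subset) auto
    from IVT'[OF _ t(1) t(2) this] Y(3) s obtain x where "0 \<le> x" "\<Phi> x = s" by auto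
    then show ?thesis by auto
  qed
  moreover have "inj_on \<Phi> {0..}" using Y(1) by (rule strict_mono_on_imp_inj_on)
  ultimately show ?thesis using Y(4) by (auto simp: bij_betw_def)
qed

context young_orlicz
begin

lemma inv_half_nonneg: "0 \<le> s \<Longrightarrow> 0 \<le> inv_half \<Phi> s"
  using inv_into_into[of s \<Phi> "{0..}"] young_function_bij[OF young] by (auto simp: bij_betw_def)

lemma Phi_inv_half: "0 \<le> s \<Longrightarrow> \<Phi> (inv_half \<Phi> s) = s"
  using f_inv_into_f[of s \<Phi> "{0..}"] young_function_bij[OF young] by (auto simp: bij_betw_def)

lemma inv_half_Phi: "0 \<le> t \<Longrightarrow> inv_half \<Phi> (\<Phi> t) = t"
  using inv_into_f_f[of \<Phi> "{0..}" t] young_function_bij[OF young] by (auto simp: bij_betw_def)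

lemma Phi_strict: "0 \<le> s \<Longrightarrow> s < t \<Longrightarrow> \<Phi> s < \<Phi> t"
  using young strict_mono_onD[of "{0..}" \<Phi> s t] unfolding young_function_def by auto

lemma inv_half_mono:
  assumes "0 \<le> s" "s \<le> t"
  shows "inv_half \<Phi> s \<le> inv_half \<Phi> t"
proof (rule ccontr)
  have t: "0 \<le> t" using assms by simp
  assume "\<not> inv_half \<Phi> s \<le> inv_half \<Phi> t"
  then have "\<Phi> (inv_half \<Phi> t) < \<Phi> (inv_half \<Phi> s)" by (intro Phi_strict inv_half_nonneg[OF t]) simp
  then show False using assms by (simp add: Phi_inv_half[OF assms(1)] Phi_inv_half[OF t])
qed

lemma inv_half_strict:
  assumes "0 \<le> s" "s < t"
  shows "inv_half \<Phi> s < inv_half \<Phi> t"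
proof -
  have "inv_half \<Phi> s \<noteq> inv_half \<Phi> t" using Phi_inv_half[of s] Phi_inv_half[of t] assms by auto
  then show ?thesis using inv_half_mono[of s t] assms by simp
qed

lemma inv_half_0 [simp]: "inv_half \<Phi> 0 = 0"
  using inv_half_Phi[of 0] by simp

lemma inv_half_pos: "0 < s \<Longrightarrow> 0 < inv_half \<Phi> s"
  using inv_half_strict[of 0 s] by simp

lemma inv_half_star: 
  assumes "0 \<le> c" "c \<le> 1" "0 \<le> s" 
  shows "c * inv_half \<Phi> s \<le> inv_half \<Phi> (c * s)"
proof -
  have "\<Phi> (c * inv_half \<Phi> s) \<le> c * s" using star[OF assms(1,2) inv_half_nonneg[OF assms(3)]] Phi_inv_half[OF assms(3)] by simp
  then have "inv_half \<Phi> (\<Phi> (c * inv_half \<Phi> s)) \<le> inv_half \<Phi> (c * s)"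
    using assms inv_half_nonneg[OF assms(3)] by (intro inv_half_mono Phi_nonneg) auto
  then show ?thesis using assms inv_half_nonneg[OF assms(3)] inv_half_Phi by simp
qed

lemma measurable_inv_half:
  assumes [measurable]: "s \<in> borel_measurable N" and "\<And>x. 0 \<le> s x"
  shows "(\<lambda>x. inv_half \<Phi> (s x)) \<in> borel_measurable N"
proof -
  have "Fun.mono (\<lambda>t. inv_half \<Phi> (max 0 t))" by (intro monoI inv_half_mono) auto
  then have [measurable]: "(\<lambda>t. inv_half \<Phi> (max 0 t)) \<in> borel_measurable borel" by (rule borel_measurable_mono)
  have "(\<lambda>x. inv_half \<Phi> (max 0 (s x))) \<in> borel_measurable N" by measurable
  then show ?thesis using assms(2) by simp
qed

end

section \<open>The interpolated function and the pointwise multiplier\<close>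

locale interpolation_pair = orlicz_pair M X K \<Phi>0 \<Phi>1
  for M :: "'a measure" and X K \<Phi>0 \<Phi>1 +
  fixes \<theta> :: real and \<Phi> :: "real \<Rightarrow> real"
  assumes theta: "0 < \<theta>" "\<theta> < 1"
    and bij: "bij_betw \<Phi> {0..} {0..}"
    and inverse: "\<forall>s\<ge>0. inv_half \<Phi> s = inv_half \<Phi>0 s powr (1 - \<theta>) * inv_half \<Phi>1 s powr \<theta>"
begin

abbreviation "\<Psi>0 \<equiv> inv_half \<Phi>0"
abbreviation "\<Psi>1 \<equiv> inv_half \<Phi>1"

lemma Phi_target_nonneg: "0 \<le> t \<Longrightarrow> 0 \<le> \<Phi> t"
  using bij by (auto simp: bij_betw_def)

lemma factor: "0 \<le> t \<Longrightarrow> t = \<Psi>0 (\<Phi> t) powr (1 - \<theta>) * \<Psi>1 (\<Phi> t) powr \<theta>"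
  using inverse Phi_target_nonneg[of t] inv_into_f_f[of \<Phi> "{0..}" t] bij by (auto simp: bij_betw_def)

lemma product_strict:
  assumes "0 \<le> s" "s < t"
  shows "\<Psi>0 s powr (1 - \<theta>) * \<Psi>1 s powr \<theta> < \<Psi>0 t powr (1 - \<theta>) * \<Psi>1 t powr \<theta>"
  by (intro mult_strict_mono' powr_less_mono2 A.inv_half_strict B.inv_half_strict A.inv_half_nonneg B.inv_half_nonneg)
     (use assms theta in auto)

lemma product_cancel: 
  assumes "0 \<le> s" "0 \<le> t" "\<Psi>0 s powr (1 - \<theta>) * \<Psi>1 s powr \<theta> \<le> \<Psi>0 t powr (1 - \<theta>) * \<Psi>1 t powr \<theta>"
  shows "s \<le> t"
  using product_strict[of t s] assms by (cases "s \<le> t") auto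

text \<open>\<Phi> is known only through its inverse. Its monotonicity and the star inequality come
  from comparing products of powers of \<Psi>0 and \<Psi>1, which increase strictly, together with
  the inequality c \<Psi>(s) \<le> \<Psi>(c s) for both factors.\<close>

sublocale T: star_orlicz M X K \<Phi>
proof (intro star_orlicz.intro star_young.intro)
  show "qideal M X K" by (rule A.qideal_axioms)
  show mono: "\<Phi> s \<le> \<Phi> t" if "0 \<le> s" "s \<le> t" for s t
  proof (rule product_cancel)
    show "\<Psi>0 (\<Phi> s) powr (1 - \<theta>) * \<Psi>1 (\<Phi> s) powr \<theta> \<le> \<Psi>0 (\<Phi> t) powr (1 - \<theta>) * \<Psi>1 (\<Phi> t) powr \<theta>"
      using that by (simp flip: factor)
  qed (use that Phi_target_nonneg in auto)
  have "\<Phi> 0 \<le> 0"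
    by (rule product_cancel) (use factor[of 0, symmetric] Phi_target_nonneg[of 0] theta in \<open>auto simp: A.inv_half_0 B.inv_half_0\<close>)
  then show "\<Phi> 0 = 0" using Phi_target_nonneg[of 0] by simp
  show "\<Phi> (c * t) \<le> c * \<Phi> t" if c: "0 \<le> c" "c \<le> 1" "0 \<le> t" for c t
  proof (rule product_cancel)
    have P: "0 \<le> \<Phi> t" by (rule Phi_target_nonneg[OF c(3)])
    show "0 \<le> \<Phi> (c * t)" "0 \<le> c * \<Phi> t" using c P Phi_target_nonneg by auto
    have "\<Psi>0 (\<Phi> (c * t)) powr (1 - \<theta>) * \<Psi>1 (\<Phi> (c * t)) powr \<theta> = c * t" using factor[of "c * t"] c by simp
    also have "\<dots> = c powr (1 - \<theta>) * c powr \<theta> * (\<Psi>0 (\<Phi> t) powr (1 - \<theta>) * \<Psi>1 (\<Phi> t) powr \<theta>)"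
      using factor[OF c(3)] c(1) by (simp flip: powr_add)
    also have "\<dots> = (c * \<Psi>0 (\<Phi> t)) powr (1 - \<theta>) * (c * \<Psi>1 (\<Phi> t)) powr \<theta>"
      using c(1) A.inv_half_nonneg[OF P] B.inv_half_nonneg[OF P] by (simp add: powr_mult)
    also have "\<dots> \<le> \<Psi>0 (c * \<Phi> t) powr (1 - \<theta>) * \<Psi>1 (c * \<Phi> t) powr \<theta>"
      using c(1,2) P theta A.inv_half_nonneg[OF P] B.inv_half_nonneg[OF P]
      by (intro mult_mono powr_mono2 A.inv_half_star B.inv_half_star) auto
    finally show "\<Psi>0 (\<Phi> (c * t)) powr (1 - \<theta>) * \<Psi>1 (\<Phi> (c * t)) powr \<theta> \<le> \<Psi>0 (c * \<Phi> t) powr (1 - \<theta>) * \<Psi>1 (c * \<Phi> t) powr \<theta>" .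
  qed
qed

text \<open>Just inside the circle G takes values in the sum space only. On a circle of suitable
  radius each value has a main part of size \<tau> in the space of the nearby boundary line and a
  remainder of arbitrarily small size \<eta>. The third alternative covers points near the two
  singularities, where the weight makes the whole value small.\<close>

definition boundary_split :: "real \<Rightarrow> (complex \<Rightarrow> 'a \<Rightarrow> complex) \<Rightarrow> bool" where
  "boundary_split \<tau> G \<longleftrightarrow> (\<forall>\<eta>>0. \<exists>r. 0 < r \<and> r < 1 \<and> (\<forall>\<zeta>. cmod \<zeta> = 1 \<longrightarrow>
     (\<exists>a\<in>elems X0. \<exists>b\<in>elems X1. (AE x in M. G (of_real r * \<zeta>) x = a x + b x) \<and>
        (Re (strip_map \<theta> (of_real r * \<zeta>)) \<le> \<eta> \<and> qnorm X0 a \<le> \<tau> \<and> qnorm X1 b \<le> \<eta> \<or>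
         1 - \<eta> \<le> Re (strip_map \<theta> (of_real r * \<zeta>)) \<and> qnorm X0 a \<le> \<eta> \<and> qnorm X1 b \<le> \<tau> \<or>
         qnorm X0 a \<le> \<eta> \<and> qnorm X1 b \<le> \<eta>))))"

text \<open>Near the matching boundary line the exponent of the multiplier is at most 1/N, so a
  ratio up to N contributes no more than 2.\<close>

lemma powr_inverse_le_two:
  fixes n :: nat
  assumes "1 \<le> n"
  shows "real n powr (1 / n) \<le> 2"
proof -
  have "real n \<le> 2 powr n" using of_nat_less_two_power[of n, where 'a = real] by (simp add: powr_realpow less_imp_le)
  then have "real n powr (1 / n) \<le> (2 powr n) powr (1 / n)" by (intro powr_mono2) auto
  also have "\<dots> = 2" using assms by (simp add: powr_powr)
  finally show ?thesis .
qed

lemma powr_le_bound: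
  fixes N l u :: real
  assumes "1 \<le> N" "0 < l" "l \<le> N" "0 \<le> u" "u \<le> 1"
  shows "l powr u \<le> N"
proof -
  have "l powr u \<le> N powr u" using assms by (intro powr_mono2) auto
  also have "\<dots> \<le> N powr 1" using assms by (intro powr_mono) auto
  finally show ?thesis using assms by simp
qed

text \<open>y and z are placeholders for \<Psi>0(s x) and \<Psi>1(s x), with \<lambda> = y / z. They
  are quantified inside the almost everywhere statement, so one null set serves all their values and
  s may vary with x.\<close>

definition dominating_pair :: "(complex \<Rightarrow> 'a \<Rightarrow> complex) \<Rightarrow> real \<Rightarrow> nat \<Rightarrow> real \<Rightarrow> complex \<Rightarrow>
    ('a \<Rightarrow> complex) \<Rightarrow> ('a \<Rightarrow> complex) \<Rightarrow> bool" where
  "dominating_pair G \<tau> N r \<zeta> a b \<longleftrightarrow> a \<in> elems X0 \<and> b \<in> elems X1 \<and> qnorm X0 a \<le> 2 * \<tau> \<and> qnorm X1 b \<le> 2 * \<tau> \<and> 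
     (AE x in M. \<forall>y z. 0 < y \<longrightarrow> 0 < z \<longrightarrow> y \<le> real N * z \<longrightarrow> z \<le> real N * y \<longrightarrow>
       cmod (G (of_real r * \<zeta>) x) * (y / z) powr Re (strip_map \<theta> (of_real r * \<zeta>)) / y \<le> cmod (a x) / y + cmod (b x) / z)"

text \<open>The pair absorbs the multiplier. The main part sits near its own boundary line, where
  the multiplier relative to that space is at most 2; a remainder may be multiplied by up to N, but
  is small enough to bear it.\<close>

lemma weighted_split:
  assumes G: "boundary_split \<tau> G" and \<tau>: "0 < \<tau>" and N: "1 \<le> (N::nat)"
  obtains r a b where "0 < r" "r < 1" "\<forall>\<zeta>. cmod \<zeta> = 1 \<longrightarrow> dominating_pair G \<tau> N r \<zeta> (a \<zeta>) (b \<zeta>)"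
proof -
  \<comment> \<open>The bound 1/N serves the exponent on the main part, the bound \<tau>/N
    compensates the factor N on the remainder.\<close>
  define \<eta> where "\<eta> = min (\<tau> / N) (1 / N)"
  have \<eta>: "0 < \<eta>" "\<eta> \<le> 1 / N" "N * \<eta> \<le> \<tau>" using \<tau> N by (auto simp: \<eta>_def min_def field_simps split: if_splits)
  have \<eta>\<tau>: "\<eta> \<le> \<tau>" 
  proof -
    have "1 * \<eta> \<le> N * \<eta>" using N \<eta>(1) by (intro mult_right_mono) auto
    then show ?thesis using \<eta>(3) by linarith
  qed
  obtain r where r: "0 < r" "r < 1" and sp: "\<And>\<zeta>. cmod \<zeta> = 1 \<Longrightarrow>
     (\<exists>a\<in>elems X0. \<exists>b\<in>elems X1. (AE x in M. G (of_real r * \<zeta>) x = a x + b x) \<and>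
        (Re (strip_map \<theta> (of_real r * \<zeta>)) \<le> \<eta> \<and> qnorm X0 a \<le> \<tau> \<and> qnorm X1 b \<le> \<eta> \<or>
         1 - \<eta> \<le> Re (strip_map \<theta> (of_real r * \<zeta>)) \<and> qnorm X0 a \<le> \<eta> \<and> qnorm X1 b \<le> \<tau> \<or>
         qnorm X0 a \<le> \<eta> \<and> qnorm X1 b \<le> \<eta>))"
    using G \<eta>(1) unfolding boundary_split_def by blast
  have "\<exists>a b. dominating_pair G \<tau> N r \<zeta> a b"
    if \<zeta>: "cmod \<zeta> = 1" for \<zeta>
  proof -
    define \<rho> where "\<rho> = Re (strip_map \<theta> (of_real r * \<zeta>))"
    have "strip_map \<theta> (of_real r * \<zeta>) \<in> strip" by (rule strip_map_in_strip[OF theta]) (use r \<zeta> in \<open>auto simp: norm_mult\<close>)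
    then have \<rho>: "0 \<le> \<rho>" "\<rho> \<le> 1" by (auto simp: strip_def \<rho>_def)
    obtain a b where ab: "a \<in> elems X0" "b \<in> elems X1" "AE x in M. G (of_real r * \<zeta>) x = a x + b x"
      and cs: "\<rho> \<le> \<eta> \<and> qnorm X0 a \<le> \<tau> \<and> qnorm X1 b \<le> \<eta> \<or> 1 - \<eta> \<le> \<rho> \<and> qnorm X0 a \<le> \<eta> \<and> qnorm X1 b \<le> \<tau> \<or>
         qnorm X0 a \<le> \<eta> \<and> qnorm X1 b \<le> \<eta>"
      using sp[OF \<zeta>] unfolding \<rho>_def by blast
    obtain c d :: real where cd: "0 \<le> c" "0 \<le> d" "c * qnorm X0 a \<le> 2 * \<tau>" "d * qnorm X1 b \<le> 2 * \<tau>"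
      "\<And>l :: real. 0 < l \<Longrightarrow> l \<le> N \<Longrightarrow> 1 / l \<le> N \<Longrightarrow> l powr \<rho> \<le> c \<and> (1 / l) powr (1 - \<rho>) \<le> d"
    proof -
      have big: "l powr \<rho> \<le> N" "(1 / l) powr (1 - \<rho>) \<le> N" if "0 < l" "l \<le> N" "1 / l \<le> N" for l :: real
        using powr_le_bound[of "real N" l \<rho>] powr_le_bound[of "real N" "1 / l" "1 - \<rho>"] that \<rho> N by auto
      have two: "l powr u \<le> 2" if "0 < l" "l \<le> N" "0 \<le> u" "u \<le> \<eta>" for l u :: real
      proof -
        have "l powr u \<le> N powr u" using that by (intro powr_mono2) auto
        also have "\<dots> \<le> N powr (1 / N)" using that \<eta> N by (intro powr_mono) auto
        also have "\<dots> \<le> 2" by (rule powr_inverse_le_two[OF N])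
        finally show ?thesis .
      qed
      have sm: "N * q \<le> 2 * \<tau>" if "q \<le> \<eta>" for q :: real
        using mult_left_mono[OF that, of "real N"] \<eta>(3) \<tau> by simp
      consider "\<rho> \<le> \<eta>" "qnorm X0 a \<le> \<tau>" "qnorm X1 b \<le> \<eta>" | "1 - \<eta> \<le> \<rho>" "qnorm X0 a \<le> \<eta>" "qnorm X1 b \<le> \<tau>" |
        "qnorm X0 a \<le> \<eta>" "qnorm X1 b \<le> \<eta>" using cs by blast
      then show thesis
      proof cases
        case 1
        then show ?thesis using big two[of _ \<rho>] sm \<rho> by (intro that[of 2 "real N"]) auto
      next
        case 2
        then show ?thesis using big two[of _ "1 - \<rho>"] sm \<rho> by (intro that[of "real N" 2]) auto
      next
        case 3
        then show ?thesis using big sm by (intro that[of "real N" "real N"]) auto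
      qed
    qed
    show ?thesis unfolding dominating_pair_def
    proof (rule exI[of _ "\<lambda>x. of_real c * a x"], rule exI[of _ "\<lambda>x. of_real d * b x"], intro conjI)
      show "(\<lambda>x. of_real c * a x) \<in> elems X0" "(\<lambda>x. of_real d * b x) \<in> elems X1"
        by (rule A.O.scale[OF ab(1)], rule B.O.scale[OF ab(2)])
      show "qnorm X0 (\<lambda>x. of_real c * a x) \<le> 2 * \<tau>" "qnorm X1 (\<lambda>x. of_real d * b x) \<le> 2 * \<tau>"
        using A.O.qnorm_scale_real[OF ab(1) cd(1)] B.O.qnorm_scale_real[OF ab(2) cd(2)] cd(3,4) by auto
      show "AE x in M. \<forall>y z. 0 < y \<longrightarrow> 0 < z \<longrightarrow> y \<le> real N * z \<longrightarrow> z \<le> real N * y \<longrightarrow>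
       cmod (G (of_real r * \<zeta>) x) * (y / z) powr Re (strip_map \<theta> (of_real r * \<zeta>)) / y \<le> cmod (of_real c * a x) / y + cmod (of_real d * b x) / z"
        using ab(3)
      proof (eventually_elim, intro allI impI)
        fix x and y z :: real assume x: "G (of_real r * \<zeta>) x = a x + b x" and yz: "0 < y" "0 < z" "y \<le> real N * z" "z \<le> real N * y"
        have l: "(y / z) powr \<rho> \<le> c" "(1 / (y / z)) powr (1 - \<rho>) \<le> d"
          using cd(5)[of "y / z"] yz by (auto simp: field_simps)
        \<comment> \<open>The same weight read from the other side: with \<lambda> = y / z, dividing
          \<lambda>^\<rho> by y equals dividing \<lambda>^-(1 - \<rho>) by z.\<close>
        have e: "(y / z) powr \<rho> / y = (1 / (y / z)) powr (1 - \<rho>) / z"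
          using yz by (simp add: powr_divide powr_diff field_simps)
        have "cmod (G (of_real r * \<zeta>) x) * (y / z) powr \<rho> / y \<le> (cmod (a x) + cmod (b x)) * ((y / z) powr \<rho> / y)"
          using norm_triangle_ineq[of "a x" "b x"] yz unfolding x by (simp add: mult_right_mono divide_right_mono)
        also have "\<dots> = cmod (a x) * ((y / z) powr \<rho> / y) + cmod (b x) * ((1 / (y / z)) powr (1 - \<rho>) / z)"
          unfolding distrib_right by (simp only: e)
        also have "\<dots> \<le> cmod (a x) * (c / y) + cmod (b x) * (d / z)"
          using l yz by (intro add_mono mult_left_mono divide_right_mono) auto
        finally show "cmod (G (of_real r * \<zeta>) x) * (y / z) powr Re (strip_map \<theta> (of_real r * \<zeta>)) / y \<le> cmod (of_real c * a x) / y + cmod (of_real d * b x) / z"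
          using cd(1,2) by (simp add: \<rho>_def norm_mult mult_ac)
      qed
    qed
  qed
  then obtain a b where "\<forall>\<zeta>. cmod \<zeta> = 1 \<longrightarrow> dominating_pair G \<tau> N r \<zeta> (a \<zeta>) (b \<zeta>)" by metis
  then show thesis by (rule that[OF r])
qed

end

context lconvex_space
begin

text \<open>A substitute for the Fatou property: h is already known to lie in X, so g n tends to h
  in quasi-norm by dominated convergence. The factor K is the price of one quasi-triangle
  inequality.\<close>

lemma weak_fatou:
  fixes g :: "nat \<Rightarrow> 'a \<Rightarrow> complex"
  assumes h: "h \<in> elems X" and g: "\<And>n. g n \<in> borel_measurable M"
    and le: "\<And>n. AE x in M. cmod (g n x) \<le> cmod (h x)"
    and lim: "AE x in M. (\<lambda>n. g n x) \<longlonglongrightarrow> h x"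
    and bound: "eventually (\<lambda>n. qnorm X (g n) \<le> c) sequentially"
  shows "qnorm X h \<le> K * c"
proof -
  have gX: "g n \<in> elems X" for n using idealD(1)[OF g h le] .
  have l0: "(\<lambda>n. qnorm X (\<lambda>x. h x - g n x)) \<longlonglongrightarrow> 0"
  proof (rule dominated_convergence[OF _ scale[OF h, of 2]])
    show "(\<lambda>x. h x - g n x) \<in> borel_measurable M" for n using meas[OF h] g by measurable
    show "AE x in M. cmod (h x - g n x) \<le> cmod (2 * h x)" for n
      using le[of n]
    proof eventually_elim
      case (elim x)
      then show ?case using norm_triangle_ineq4[of "h x" "g n x"] by (simp add: norm_mult)
    qed
    show "AE x in M. (\<lambda>n. h x - g n x) \<longlonglongrightarrow> 0"
      using lim
    proof eventually_elim
      case (elim x)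
      from tendsto_diff[OF tendsto_const[of "h x"] elim] show ?case by simp
    qed
  qed
  have l1: "(\<lambda>n. K * (qnorm X (\<lambda>x. h x - g n x) + c)) \<longlonglongrightarrow> K * (0 + c)"
    by (intro tendsto_intros l0)
  from bound obtain n0 where n0: "\<And>n. n0 \<le> n \<Longrightarrow> qnorm X (g n) \<le> c" unfolding eventually_sequentially by blast
  have "qnorm X h \<le> K * (qnorm X (\<lambda>x. h x - g n x) + c)" if "n0 \<le> n" for n
  proof -
    have "qnorm X h \<le> K * (qnorm X (\<lambda>x. h x - g n x) + qnorm X (g n))" by (rule qnorm_le_approx[OF h gX])
    also have "\<dots> \<le> K * (qnorm X (\<lambda>x. h x - g n x) + c)" using n0[OF that] K1 by (intro mult_left_mono add_left_mono) auto
    finally show ?thesis .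
  qed
  then have "qnorm X h \<le> K * (0 + c)" by (intro LIMSEQ_le_const[OF l1]) blast
  then show ?thesis by simp
qed

end

context interpolation_pair
begin

text \<open>With x fixed, H = g \<lambda>^(strip_map - \<theta>) has the same value as g at the
  centre, and on the circle |H| \<le> m (al / y + be / z), where m = y^(1-\<theta>) z^\<theta>.
  Subharmonicity of |H|^p compares this with |g 0| = \<tau> M0 m, so m cancels; since \<Phi>0 y =
  \<Phi>1 z = s, the linear bound turns al / y and be / z into modulars divided by s.\<close>

lemma pointwise_estimate:
  fixes g :: "complex \<Rightarrow> complex" and al be :: "complex \<Rightarrow> real"
  assumes g: "g holomorphic_on ball 0 1" and r: "0 < r" "r < 1" and p: "0 < p" "p \<le> 1" and \<tau>: "0 < \<tau>"
  defines "s \<equiv> \<Phi> (cmod (g 0) / (\<tau> * (3 * 8 powr (1 / p))))"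
  assumes s: "0 < s" and pos: "\<And>\<zeta>. 0 \<le> al \<zeta>" "\<And>\<zeta>. 0 \<le> be \<zeta>"
    and le: "\<And>n j. cmod (g (of_real r * unity_root n j)) * (\<Psi>0 s / \<Psi>1 s) powr Re (strip_map \<theta> (of_real r * unity_root n j)) / \<Psi>0 s
       \<le> al (unity_root n j) / \<Psi>0 s + be (unity_root n j) / \<Psi>1 s"
  shows "eventually (\<lambda>n. 2 * real n * s powr p \<le> (\<Sum>j<n. \<Phi>0 (al (unity_root n j) / (3 * \<tau>)) powr p) +
     (\<Sum>j<n. \<Phi>1 (be (unity_root n j) / (3 * \<tau>)) powr p)) sequentially"
proof -
  \<comment> \<open>3 \<tau> is the scale of the modulars. Of the 8, half is given up for a strict
    subharmonic inequality; the summands 1 of the two linear bounds take 2 of the remaining 4, which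
    leaves the 2 of the conclusion.\<close>
  define M0 where "M0 = 3 * 8 powr (1 / p)"
  have M0: "0 < M0" by (simp add: M0_def)
  define y where "y = \<Psi>0 s"
  define z where "z = \<Psi>1 s"
  have yz: "0 < y" "0 < z" using s A.inv_half_pos B.inv_half_pos by (auto simp: y_def z_def)
  have \<Phi>y: "\<Phi>0 y = s" "\<Phi>1 z = s" using s A.Phi_inv_half B.Phi_inv_half by (auto simp: y_def z_def)
  \<comment> \<open>By \<open>factor\<close> this is |g 0| / (\<tau> M0).\<close>
  define m where "m = y powr (1 - \<theta>) * z powr \<theta>"
  have m: "0 < m" using yz by (simp add: m_def)
  have "s = \<Phi> (cmod (g 0) / (\<tau> * M0))" by (simp add: s_def M0_def)
  then have "cmod (g 0) / (\<tau> * M0) = m"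
    using factor[of "cmod (g 0) / (\<tau> * M0)"] \<tau> M0 by (simp add: m_def y_def z_def)
  then have g0: "cmod (g 0) = \<tau> * M0 * m" using \<tau> M0 by (simp add: field_simps)
  \<comment> \<open>Subtracting \<theta> in the exponent makes the multiplier 1 at the centre; its
    modulus elsewhere is \<lambda>^Re(strip_map) m / y.\<close>
  define H where "H w = g w * exp (of_real (ln (y / z)) * (strip_map \<theta> w - of_real \<theta>))" for w
  have H: "H holomorphic_on ball 0 1"
    unfolding H_def by (intro holomorphic_intros g holomorphic_strip_map[OF theta])
  have H0: "H 0 = g 0" by (simp add: H_def strip_map_0[OF theta])
  have Hn: "cmod (H w) = cmod (g w) * (y / z) powr Re (strip_map \<theta> w) / y * m" for w
  proof -
    have "cmod (H w) = cmod (g w) * (y / z) powr (Re (strip_map \<theta> w) - \<theta>)"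
      using yz by (simp add: H_def norm_mult norm_exp_eq_Re powr_def mult.commute)
    also have "(y / z) powr (Re (strip_map \<theta> w) - \<theta>) = (y / z) powr Re (strip_map \<theta> w) / y * m"
      using yz by (simp add: powr_diff powr_divide m_def field_simps)
    finally show ?thesis by simp
  qed
  have "eventually (\<lambda>n. cmod (g 0) powr p / 2 * real n < (\<Sum>j<n. cmod (H (of_real r * unity_root n j)) powr p)) sequentially"
  proof (rule powr_subharmonic[OF H r p])
    show "cmod (g 0) powr p / 2 < cmod (H 0) powr p" unfolding H0 g0 using \<tau> M0 m by simp
  qed
  then show ?thesis
  proof eventually_elim
    case (elim n)
    define U where "U j = \<Phi>0 (al (unity_root n j) / (3 * \<tau>))" for j
    define V where "V j = \<Phi>1 (be (unity_root n j) / (3 * \<tau>))" for j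
    have U0: "0 \<le> U j" "0 \<le> V j" for j
      unfolding U_def V_def using pos \<tau> by (auto intro!: A.Phi_nonneg B.Phi_nonneg)
    have part: "((3 * \<tau>) * (1 + q / s)) powr p \<le> (3 * \<tau>) powr p * (1 + q powr p / s powr p)" if "0 \<le> q" for q
    proof -
      have "((3 * \<tau>) * (1 + q / s)) powr p = (3 * \<tau>) powr p * (1 + q / s) powr p"
        using \<tau> that s by (simp add: powr_mult)
      also have "\<dots> \<le> (3 * \<tau>) powr p * (1 powr p + (q / s) powr p)"
        using that s p by (intro mult_left_mono powr_add_le_sum) auto
      finally show ?thesis using that s by (simp add: powr_divide)
    qed
    have bound: "cmod (H (of_real r * unity_root n j)) powr p \<le> m powr p * ((3 * \<tau>) powr p * (2 + (U j powr p + V j powr p) / s powr p))" for j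
    proof -
      let ?a = "al (unity_root n j)" and ?b = "be (unity_root n j)"
      have rescale: "t / u \<le> 3 * \<tau> * q" if "t / (3 * \<tau>) / u \<le> q" for t u q
      proof -
        have "t / u = 3 * \<tau> * (t / (3 * \<tau>) / u)" using \<tau> by simp
        also have "\<dots> \<le> 3 * \<tau> * q" using that \<tau> by (intro mult_left_mono) auto
        finally show ?thesis .
      qed
      have a: "?a / y \<le> 3 * \<tau> * (1 + U j / s)"
        by (rule rescale) (use A.linear_bound[OF yz(1), of "?a / (3 * \<tau>)"] pos \<tau> in \<open>simp add: \<Phi>y U_def\<close>)
      have b: "?b / z \<le> 3 * \<tau> * (1 + V j / s)"
        by (rule rescale) (use B.linear_bound[OF yz(2), of "?b / (3 * \<tau>)"] pos \<tau> in \<open>simp add: \<Phi>y V_def\<close>)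
      have "cmod (H (of_real r * unity_root n j)) \<le> (?a / y + ?b / z) * m"
        unfolding Hn using le[of n j] m by (intro mult_right_mono) (auto simp: y_def z_def)
      then have "cmod (H (of_real r * unity_root n j)) powr p \<le> ((?a / y + ?b / z) * m) powr p"
        using p by (intro powr_mono2) auto
      also have "\<dots> = m powr p * (?a / y + ?b / z) powr p"
        using pos yz m by (simp add: powr_mult)
      also have "(?a / y + ?b / z) powr p \<le> (?a / y) powr p + (?b / z) powr p"
        using p pos yz by (intro powr_add_le_sum) auto
      also have "\<dots> \<le> (3 * \<tau> * (1 + U j / s)) powr p + (3 * \<tau> * (1 + V j / s)) powr p"
        using a b p pos yz by (intro add_mono powr_mono2) auto
      also have "\<dots> \<le> (3 * \<tau>) powr p * (1 + U j powr p / s powr p) + (3 * \<tau>) powr p * (1 + V j powr p / s powr p)"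
        using U0 by (intro add_mono part) auto
      also have "\<dots> = (3 * \<tau>) powr p * (2 + (U j powr p + V j powr p) / s powr p)"
        by (simp add: algebra_simps add_divide_distrib)
      finally show ?thesis using m by (simp add: mult_left_mono)
    qed
    have "cmod (g 0) powr p / 2 = m powr p * ((3 * \<tau>) powr p * 4)"
    proof -
      have "cmod (g 0) = m * ((3 * \<tau>) * 8 powr (1 / p))" unfolding g0 M0_def by simp
      then have "cmod (g 0) powr p = m powr p * ((3 * \<tau>) powr p * (8 powr (1 / p)) powr p)"
        using m \<tau> by (simp only: powr_mult)
      then show ?thesis using p by (simp add: powr_powr)
    qed
    then have "m powr p * ((3 * \<tau>) powr p * 4) * n \<le> (\<Sum>j<n. cmod (H (of_real r * unity_root n j)) powr p)" using elim by simp
    also have "\<dots> \<le> (\<Sum>j<n. m powr p * ((3 * \<tau>) powr p * (2 + (U j powr p + V j powr p) / s powr p)))"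
      by (rule sum_mono) (rule bound)
    also have "\<dots> = m powr p * ((3 * \<tau>) powr p * (2 * n + ((\<Sum>j<n. U j powr p) + (\<Sum>j<n. V j powr p)) / s powr p))"
      by (simp add: sum_distrib_left[symmetric] sum.distrib sum_divide_distrib[symmetric])
    finally have "m powr p * ((3 * \<tau>) powr p * (4 * n)) \<le> m powr p * ((3 * \<tau>) powr p * (2 * n + ((\<Sum>j<n. U j powr p) + (\<Sum>j<n. V j powr p)) / s powr p))"
      by (simp add: mult_ac)
    then have "4 * n \<le> 2 * n + ((\<Sum>j<n. U j powr p) + (\<Sum>j<n. V j powr p)) / s powr p"
      using m \<tau> by simp
    then have "2 * n \<le> ((\<Sum>j<n. U j powr p) + (\<Sum>j<n. V j powr p)) / s powr p" by simp
    then show ?case using s unfolding U_def V_def by (simp add: pos_le_divide_eq)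
  qed
qed

text \<open>h stands in for the modular of f, which is not yet known to lie in X. M0 and C depend
  neither on \<tau> nor on G; this later allows the estimate to be used with arbitrarily small
  \<tau>.\<close>

lemma modular_estimate:
  obtains M0 C :: real where "0 < M0" "0 < C"
    "\<forall>\<tau> G f h. 0 < \<tau> \<longrightarrow> boundary_split \<tau> G \<longrightarrow> (AE x in M. (\<lambda>w. G w x) holomorphic_on ball 0 1) \<longrightarrow>
      f \<in> borel_measurable M \<longrightarrow> (AE x in M. G 0 x = f x) \<longrightarrow> (\<forall>x. 0 \<le> h x) \<longrightarrow> (\<lambda>x. complex_of_real (h x)) \<in> elems X \<longrightarrow>
      (AE x in M. h x \<le> \<Phi> (cmod (f x) / (\<tau> * M0))) \<longrightarrow> qnorm X (\<lambda>x. complex_of_real (h x)) \<le> C"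
proof -
  obtain p C1 :: real where p: "0 < p" "p \<le> 1" and C1: "0 < C1" and PM:
    "\<And>us c s. us \<noteq> [] \<Longrightarrow> (\<And>u. u \<in> set us \<Longrightarrow> A.pos_le c u) \<Longrightarrow> s \<in> borel_measurable M \<Longrightarrow> (\<And>x. 0 \<le> s x) \<Longrightarrow>
       (\<And>x. length us * s x powr p \<le> (\<Sum>u\<leftarrow>us. u x powr p)) \<Longrightarrow> A.pos_le (C1 * c) s"
    using A.power_mean by metis
  define M0 where "M0 = 3 * 8 powr (1 / p)"
  have M0: "0 < M0" by (simp add: M0_def)
  have K0: "0 < K" using A.K1 by simp
  show thesis
  \<comment> \<open>One factor K for each of two exhaustions, first of D N by the sets E n and then
    of the set where s > 0 by the sets D N.\<close>
  proof (rule that[of M0 "K * (K * C1)"])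
    show "0 < M0" "0 < K * (K * C1)" using M0 K0 C1 by auto
    show "\<forall>\<tau> G f h. 0 < \<tau> \<longrightarrow> boundary_split \<tau> G \<longrightarrow> (AE x in M. (\<lambda>w. G w x) holomorphic_on ball 0 1) \<longrightarrow>
      f \<in> borel_measurable M \<longrightarrow> (AE x in M. G 0 x = f x) \<longrightarrow> (\<forall>x. 0 \<le> h x) \<longrightarrow> (\<lambda>x. complex_of_real (h x)) \<in> elems X \<longrightarrow>
      (AE x in M. h x \<le> \<Phi> (cmod (f x) / (\<tau> * M0))) \<longrightarrow> qnorm X (\<lambda>x. complex_of_real (h x)) \<le> K * (K * C1)"
    proof (intro allI impI)
      fix \<tau> G f and h :: "'a \<Rightarrow> real"
      assume \<tau>: "0 < \<tau>" and G: "boundary_split \<tau> G" and hol: "AE x in M. (\<lambda>w. G w x) holomorphic_on ball 0 1"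
        and fm[measurable]: "f \<in> borel_measurable M" and G0: "AE x in M. G 0 x = f x" and h0': "\<forall>x. 0 \<le> h x"
        and hX: "(\<lambda>x. complex_of_real (h x)) \<in> elems X" and hs: "AE x in M. h x \<le> \<Phi> (cmod (f x) / (\<tau> * M0))"
      note h0 = h0'[rule_format]
      define s where "s x = \<Phi> (cmod (f x) / (\<tau> * M0))" for x
      have s0: "0 \<le> s x" for x unfolding s_def using \<tau> M0 by (intro Phi_target_nonneg) auto
      have [measurable]: "s \<in> borel_measurable M" unfolding s_def using \<tau> M0 by (intro T.measurable_comp_div) auto
      have [measurable]: "(\<lambda>x. \<Psi>0 (s x)) \<in> borel_measurable M" "(\<lambda>x. \<Psi>1 (s x)) \<in> borel_measurable M"
        using s0 by (auto intro: A.measurable_inv_half B.measurable_inv_half)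
      have [measurable]: "(\<lambda>x. complex_of_real (h x)) \<in> borel_measurable M" using A.meas[OF hX] .
      \<comment> \<open>The points where s > 0 and 1/N \<le> \<lambda> \<le> N. N is fixed first
        because the radius and the dominating pair depend on it.\<close>
      define D where "D N = {x \<in> space M. 0 < s x \<and> \<Psi>0 (s x) \<le> real N * \<Psi>1 (s x) \<and> \<Psi>1 (s x) \<le> real N * \<Psi>0 (s x)}" for N :: nat
      have [measurable]: "D N \<in> sets M" for N unfolding D_def by measurable
      have DX: "(\<lambda>x. complex_of_real (h x) * indicator (D N) x) \<in> elems X" for N
        by (rule A.indicator_mem[OF hX]) simp
      have DN: "qnorm X (\<lambda>x. complex_of_real (h x) * indicator (D N) x) \<le> K * C1" if N: "1 \<le> N" for N
      proof -
        obtain r a b where r: "0 < r" "r < 1" and dp: "\<forall>\<zeta>. cmod \<zeta> = 1 \<longrightarrow> dominating_pair G \<tau> N r \<zeta> (a \<zeta>) (b \<zeta>)"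
          using weighted_split[OF G \<tau> N] by metis
        have ab: "\<And>\<zeta>. cmod \<zeta> = 1 \<Longrightarrow> a \<zeta> \<in> elems X0" "\<And>\<zeta>. cmod \<zeta> = 1 \<Longrightarrow> b \<zeta> \<in> elems X1"
          "\<And>\<zeta>. cmod \<zeta> = 1 \<Longrightarrow> qnorm X0 (a \<zeta>) \<le> 2 * \<tau>" "\<And>\<zeta>. cmod \<zeta> = 1 \<Longrightarrow> qnorm X1 (b \<zeta>) \<le> 2 * \<tau>" and
          sp: "\<And>\<zeta>. cmod \<zeta> = 1 \<Longrightarrow> AE x in M. \<forall>y z. 0 < y \<longrightarrow> 0 < z \<longrightarrow> y \<le> real N * z \<longrightarrow> z \<le> real N * y \<longrightarrow>
         cmod (G (of_real r * \<zeta>) x) * (y / z) powr Re (strip_map \<theta> (of_real r * \<zeta>)) / y \<le> cmod (a \<zeta> x) / y + cmod (b \<zeta> x) / z"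
          using dp unfolding dominating_pair_def by blast+
        define U where "U \<zeta> x = \<Phi>0 (cmod (a \<zeta> x) / (3 * \<tau>))" for \<zeta> x
        define V where "V \<zeta> x = \<Phi>1 (cmod (b \<zeta> x) / (3 * \<tau>))" for \<zeta> x
        \<comment> \<open>The pair has quasi-norm at most 2 \<tau>; the scale 3 \<tau> lies strictly
          above, so the modulars are in the unit ball.\<close>
        have U: "A.pos_le 1 (U \<zeta>)" if "cmod \<zeta> = 1" for \<zeta>
          using A.modular_le1[OF ab(1), of \<zeta> "3 * \<tau>"] ab(3)[OF that] that \<tau> A.Phi_nonneg unfolding A.pos_le_def U_def by auto
        have V: "A.pos_le 1 (V \<zeta>)" if "cmod \<zeta> = 1" for \<zeta>
          using B.modular_le1[OF ab(2), of \<zeta> "3 * \<tau>"] ab(4)[OF that] that \<tau> B.Phi_nonneg unfolding A.pos_le_def V_def by auto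
        have [measurable]: "U (unity_root n j) \<in> borel_measurable M" "V (unity_root n j) \<in> borel_measurable M" for n j
          using U V A.pos_le_measurable by auto
        \<comment> \<open>The number of roots from which the pointwise estimate holds depends on x.
          E n collects the points where it holds for n; almost every point of D N lies in E n
          eventually, though the sets need not increase.\<close>
        define E where "E n = {x \<in> D N. 2 * real n * s x powr p \<le> (\<Sum>j<n. U (unity_root n j) x powr p) + (\<Sum>j<n. V (unity_root n j) x powr p)}" for n
        have [measurable]: "E n \<in> sets M" for n
        proof -
          have "E n = D N \<inter> {x \<in> space M. 2 * real n * s x powr p \<le> (\<Sum>j<n. U (unity_root n j) x powr p) + (\<Sum>j<n. V (unity_root n j) x powr p)}"
            unfolding E_def D_def by auto
          also have "\<dots> \<in> sets M" by measurable
          finally show ?thesis .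
        qed
        have "AE x in M. \<forall>n j. \<forall>y z. 0 < y \<longrightarrow> 0 < z \<longrightarrow> y \<le> real N * z \<longrightarrow> z \<le> real N * y \<longrightarrow>
         cmod (G (of_real r * unity_root n j) x) * (y / z) powr Re (strip_map \<theta> (of_real r * unity_root n j)) / y
           \<le> cmod (a (unity_root n j) x) / y + cmod (b (unity_root n j) x) / z"
          unfolding AE_all_countable by (intro allI sp) simp
        with hol G0 have ev: "AE x in M. x \<in> D N \<longrightarrow> eventually (\<lambda>n. x \<in> E n) sequentially"
        proof eventually_elim
          case (elim x)
          show ?case
          proof
            assume xD: "x \<in> D N"
            have x: "0 < s x" "\<Psi>0 (s x) \<le> real N * \<Psi>1 (s x)" "\<Psi>1 (s x) \<le> real N * \<Psi>0 (s x)" using xD by (auto simp: D_def)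
            have sx: "s x = \<Phi> (cmod (G 0 x) / (\<tau> * (3 * 8 powr (1 / p))))" using elim(2) by (simp add: s_def M0_def)
            have "eventually (\<lambda>n. 2 * real n * s x powr p \<le> (\<Sum>j<n. \<Phi>0 (cmod (a (unity_root n j) x) / (3 * \<tau>)) powr p) +
               (\<Sum>j<n. \<Phi>1 (cmod (b (unity_root n j) x) / (3 * \<tau>)) powr p)) sequentially"
              unfolding sx
              by (rule pointwise_estimate[OF elim(1) r p \<tau>, of "\<lambda>\<zeta>. cmod (a \<zeta> x)" "\<lambda>\<zeta>. cmod (b \<zeta> x)"])
                (use x elim(3) A.inv_half_pos B.inv_half_pos in \<open>auto simp flip: sx\<close>)
            then show "eventually (\<lambda>n. x \<in> E n) sequentially"
              by eventually_elim (use xD in \<open>auto simp: E_def U_def V_def\<close>)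
          qed
        qed
        have EC: "qnorm X (\<lambda>x. complex_of_real (h x) * indicator (E n) x) \<le> C1" if n: "1 \<le> n" for n
        proof -
          \<comment> \<open>These are 2n functions, matching the factor 2n in the pointwise
            estimate.\<close>
          let ?us = "map (\<lambda>j. U (unity_root n j)) [0..<n] @ map (\<lambda>j. V (unity_root n j)) [0..<n]"
          have "A.pos_le (C1 * 1) (\<lambda>x. s x * indicator (E n) x)"
          proof (rule PM[of ?us])
            show "?us \<noteq> []" using n by simp
            show "A.pos_le 1 u" if "u \<in> set ?us" for u
              using that U V by auto
            show "0 \<le> s x * indicator (E n) x" for x using s0 by simp
            fix x
            have S: "(\<Sum>u\<leftarrow>?us. u x powr p) =
              (\<Sum>j<n. U (unity_root n j) x powr p) + (\<Sum>j<n. V (unity_root n j) x powr p)"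
              by (simp add: o_def sum_list_distinct_conv_sum_set atLeast0LessThan)
            \<comment> \<open>Off E n the left side vanishes, because 0 powr p is 0.\<close>
            show "real (length ?us) * (s x * indicator (E n) x) powr p
               \<le> (\<Sum>u\<leftarrow>?us. u x powr p)"
              unfolding S by (cases "x \<in> E n") (auto simp: E_def intro!: add_nonneg_nonneg sum_nonneg)
          qed measurable
          then have s: "(\<lambda>x. complex_of_real (s x * indicator (E n) x)) \<in> elems X"
            "qnorm X (\<lambda>x. complex_of_real (s x * indicator (E n) x)) \<le> C1" by (auto simp: A.pos_le_def)
          have "AE x in M. cmod (complex_of_real (h x) * indicator (E n) x) \<le> cmod (complex_of_real (s x * indicator (E n) x))"
            using hs
          proof eventually_elim
            case (elim x)
            then show ?case using h0[of x] s0[of x] by (auto simp: indicator_def s_def)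
          qed
          from A.idealD(2)[OF _ s(1) this] s(2) show ?thesis by simp
        qed
        show ?thesis
        proof (rule A.weak_fatou[OF DX])
          show "(\<lambda>x. complex_of_real (h x) * indicator (E n) x) \<in> borel_measurable M" for n by measurable
          show "AE x in M. cmod (complex_of_real (h x) * indicator (E n) x) \<le> cmod (complex_of_real (h x) * indicator (D N) x)" for n
            by (auto simp: indicator_def E_def)
          show "AE x in M. (\<lambda>n. complex_of_real (h x) * indicator (E n) x) \<longlonglongrightarrow> complex_of_real (h x) * indicator (D N) x"
            using ev
          proof eventually_elim
            case (elim x)
            show ?case
            proof (cases "x \<in> D N")
              case True
              then have "eventually (\<lambda>n. x \<in> E n) sequentially" using elim by simp
              then have "eventually (\<lambda>n. complex_of_real (h x) * indicator (E n) x = complex_of_real (h x) * indicator (D N) x) sequentially"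
                by eventually_elim (simp add: True)
              then show ?thesis by (rule tendsto_eventually)
            qed (auto simp: E_def)
          qed
          show "eventually (\<lambda>n. qnorm X (\<lambda>x. complex_of_real (h x) * indicator (E n) x) \<le> C1) sequentially"
            unfolding eventually_sequentially using EC by blast
        qed
      qed
      show "qnorm X (\<lambda>x. complex_of_real (h x)) \<le> K * (K * C1)"
      proof (rule A.weak_fatou[OF hX])
        show "(\<lambda>x. complex_of_real (h x) * indicator (D N) x) \<in> borel_measurable M" for N by measurable
        show "AE x in M. cmod (complex_of_real (h x) * indicator (D N) x) \<le> cmod (complex_of_real (h x))" for N
          by (auto simp: indicator_def)
        show "eventually (\<lambda>N. qnorm X (\<lambda>x. complex_of_real (h x) * indicator (D N) x) \<le> K * C1) sequentially"
          unfolding eventually_sequentially using DN by blast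
        show "AE x in M. (\<lambda>N. complex_of_real (h x) * indicator (D N) x) \<longlonglongrightarrow> complex_of_real (h x)"
          using hs AE_space
        proof eventually_elim
          case (elim x)
          show ?case
          proof (cases "0 < s x")
            case True
            then have pos: "0 < \<Psi>0 (s x)" "0 < \<Psi>1 (s x)" using A.inv_half_pos B.inv_half_pos by auto
            obtain N0 :: nat where N0: "\<Psi>0 (s x) / \<Psi>1 (s x) + \<Psi>1 (s x) / \<Psi>0 (s x) \<le> N0" using real_arch_simple by blast
            have "x \<in> D N" if "N0 \<le> N" for N
            proof -
              have "0 < \<Psi>0 (s x) / \<Psi>1 (s x)" "0 < \<Psi>1 (s x) / \<Psi>0 (s x)" using pos by auto
              then have "\<Psi>0 (s x) / \<Psi>1 (s x) \<le> N" "\<Psi>1 (s x) / \<Psi>0 (s x) \<le> N" using N0 that by linarith+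
              then show ?thesis using pos True elim(2) by (simp add: D_def pos_divide_le_eq)
            qed
            then have "eventually (\<lambda>N. x \<in> D N) sequentially" unfolding eventually_sequentially by blast
            then have "eventually (\<lambda>N. complex_of_real (h x) * indicator (D N) x = complex_of_real (h x)) sequentially"
              by eventually_elim simp
            then show ?thesis by (rule tendsto_eventually)
          next
            case False
            then have "h x = 0" using elim(1) s0[of x] h0[of x] by (simp add: s_def)
            then show ?thesis by simp
          qed
        qed
      qed
    qed
  qed
qed

end

section \<open>Boundary values\<close>

context qideal
begin

lemma qcontinuous_seq:
  fixes z :: "'b::t2_space"
  assumes F: "qcontinuous_on X S F" and z: "z \<in> S" "\<And>n. w n \<in> S" and lim: "w \<longlonglongrightarrow> z"
  shows "(\<lambda>n. qnorm X (\<lambda>x. F (w n) x - F z x)) \<longlonglongrightarrow> 0"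
proof -
  have "((\<lambda>u. qnorm X (\<lambda>x. F u x - F z x)) \<longlongrightarrow> 0) (at z within S)" using F z(1) by (auto simp: qcontinuous_on_def)
  then have "continuous (at z within S) (\<lambda>u. qnorm X (\<lambda>x. F u x - F z x))"
    unfolding continuous_within by simp
  from continuous_within_tendsto_compose'[OF this z(2) lim] show ?thesis by simp
qed

end

context young_orlicz
begin

text \<open>Either the coefficients tend to 0 against bounded traces, or the arguments converge. In
  the second case T (t n) may be replaced by the fixed function T t0, whose restriction to B n
  vanishes by dominated convergence.\<close>

lemma trace_vanish:
  fixes T :: "real \<Rightarrow> 'a \<Rightarrow> complex" and c :: "nat \<Rightarrow> complex"
  assumes bd: "qbounded_on Y UNIV T" and cont: "qcontinuous_on Y UNIV T"
    and B[measurable]: "\<And>n. B n \<in> sets M" and Bn: "AE x in M. eventually (\<lambda>n. x \<notin> B n) sequentially"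
    and c: "c \<longlonglongrightarrow> c0" and alt: "c0 = 0 \<or> t \<longlonglongrightarrow> t0"
  shows "(\<lambda>n. qnorm Y (\<lambda>x. c n * T (t n) x * indicator (B n) x)) \<longlonglongrightarrow> 0"
proof -
  let ?Y = "orlicz M X \<Phi>"
  have T: "T s \<in> elems ?Y" for s using bd by (auto simp: qbounded_on_def)
  have [measurable]: "T s \<in> borel_measurable M" for s using O.meas[OF T] .
  have ind: "(\<lambda>x. a * f x * indicator (B n) x) \<in> elems ?Y" "qnorm ?Y (\<lambda>x. a * f x * indicator (B n) x) \<le> cmod a * qnorm ?Y f"
    if "f \<in> elems ?Y" for a f n
    using O.indicator_mem[OF O.scale[OF that, of a] B] O.qnorm_scale[OF that, of a] by auto
  show ?thesis
    using alt
  proof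
    assume c0: "c0 = 0"
    obtain C where C: "\<And>s. qnorm ?Y (T s) \<le> C" using bd by (auto simp: qbounded_on_def)
    have le: "norm (qnorm ?Y (\<lambda>x. c n * T (t n) x * indicator (B n) x)) \<le> cmod (c n) * C" for n
    proof -
      have "qnorm ?Y (\<lambda>x. c n * T (t n) x * indicator (B n) x) \<le> cmod (c n) * qnorm ?Y (T (t n))" by (rule ind(2)[OF T])
      also have "\<dots> \<le> cmod (c n) * C" by (intro mult_left_mono C) auto
      finally show ?thesis using O.nonneg[OF ind(1)[OF T]] by simp
    qed
    have "(\<lambda>n. cmod (c n) * C) \<longlonglongrightarrow> 0" using c c0 by (intro tendsto_mult_left_zero) (simp add: tendsto_norm_zero_iff)
    then show ?thesis by (rule Lim_null_comparison[OF always_eventually[OF allI[OF le]]])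
  next
    assume t: "t \<longlonglongrightarrow> t0"
    have l1: "(\<lambda>n. qnorm ?Y (\<lambda>x. T (t n) x - T t0 x)) \<longlonglongrightarrow> 0" by (rule O.qcontinuous_seq[OF cont _ _ t]) auto
    have l2: "(\<lambda>n. qnorm ?Y (\<lambda>x. T t0 x * indicator (B n) x)) \<longlonglongrightarrow> 0"
    proof (rule orlicz_dominated[OF _ T[of t0]])
      show "AE x in M. (\<lambda>n. T t0 x * indicator (B n) x) \<longlonglongrightarrow> 0"
        using Bn
      proof eventually_elim
        case (elim x)
        then have "eventually (\<lambda>n. T t0 x * indicator (B n) x = 0) sequentially" by eventually_elim simp
        then show ?case by (rule tendsto_eventually)
      qed
      show "AE x in M. cmod (T t0 x * indicator (B n) x) \<le> cmod (T t0 x)" for n by (auto simp: indicator_def)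
    qed measurable
    have le: "norm (qnorm ?Y (\<lambda>x. c n * T (t n) x * indicator (B n) x)) \<le>
       K * (cmod (c n) * qnorm ?Y (\<lambda>x. T (t n) x - T t0 x) + cmod (c n) * qnorm ?Y (\<lambda>x. T t0 x * indicator (B n) x))" for n
    proof -
      have d: "(\<lambda>x. T (t n) x - T t0 x) \<in> elems ?Y" by (rule O.diff[OF T T])
      have i: "(\<lambda>x. T t0 x * indicator (B n) x) \<in> elems ?Y" by (rule O.indicator_mem[OF T B])
      have "(\<lambda>x. c n * T (t n) x * indicator (B n) x) =
        (\<lambda>x. c n * (T (t n) x - T t0 x) * indicator (B n) x + c n * (T t0 x * indicator (B n) x))" by (auto simp: algebra_simps)
      then have "qnorm ?Y (\<lambda>x. c n * T (t n) x * indicator (B n) x) \<le>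
        K * (qnorm ?Y (\<lambda>x. c n * (T (t n) x - T t0 x) * indicator (B n) x) + qnorm ?Y (\<lambda>x. c n * (T t0 x * indicator (B n) x)))"
        using O.triangle[OF ind(1)[OF d] O.scale[OF i]] by simp
      also have "\<dots> \<le> K * (cmod (c n) * qnorm ?Y (\<lambda>x. T (t n) x - T t0 x) + cmod (c n) * qnorm ?Y (\<lambda>x. T t0 x * indicator (B n) x))"
        using ind(2)[OF d] O.qnorm_scale[OF i] K1 by (intro mult_left_mono add_mono) auto
      finally show ?thesis using O.nonneg[OF ind(1)[OF T]] by simp
    qed
    have "(\<lambda>n. K * (cmod (c n) * qnorm ?Y (\<lambda>x. T (t n) x - T t0 x) + cmod (c n) * qnorm ?Y (\<lambda>x. T t0 x * indicator (B n) x)))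
       \<longlonglongrightarrow> K * (cmod c0 * 0 + cmod c0 * 0)"
      by (intro tendsto_intros l1 l2 c)
    then have l3: "(\<lambda>n. K * (cmod (c n) * qnorm ?Y (\<lambda>x. T (t n) x - T t0 x) + cmod (c n) * qnorm ?Y (\<lambda>x. T t0 x * indicator (B n) x))) \<longlonglongrightarrow> 0"
      by simp
    show ?thesis by (rule Lim_null_comparison[OF always_eventually[OF allI[OF le]] l3])
  qed
qed

text \<open>Uniformity in \<zeta> comes from compactness of the circle: points violating it would
  accumulate somewhere. Away from the two singularities their parameters converge; at the
  singularities the parameter may escape to infinity, but there the weight tends to 0.\<close>

lemma circle_trace_small:
  fixes T :: "real \<Rightarrow> 'a \<Rightarrow> complex"
  assumes th: "0 < \<theta>" "\<theta> < 1"
    and bd: "qbounded_on Y UNIV T" and cont: "qcontinuous_on Y UNIV T"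
    and B: "\<And>n. B n \<in> sets M" and Bn: "AE x in M. eventually (\<lambda>n. x \<notin> B n) sequentially" and \<tau>: "0 < \<tau>"
  shows "eventually (\<lambda>n. \<forall>\<zeta>. cmod \<zeta> = 1 \<longrightarrow> 
    qnorm Y (\<lambda>x. disc_weight \<theta> \<zeta> * T (Im (strip_map \<theta> \<zeta>)) x * indicator (B n) x) \<le> \<tau>) sequentially"
proof (rule ccontr)
  let ?q = "\<lambda>n \<zeta>. qnorm Y (\<lambda>x. disc_weight \<theta> \<zeta> * T (Im (strip_map \<theta> \<zeta>)) x * indicator (B n) x)"
  assume "\<not> ?thesis"
  then have "\<forall>k. \<exists>n\<ge>k. \<exists>\<zeta>. cmod \<zeta> = 1 \<and> \<tau> < ?q n \<zeta>" unfolding eventually_sequentially by (simp add: not_le)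
  then obtain n \<zeta> where n: "\<And>k. k \<le> n k" and \<zeta>: "\<And>k. cmod (\<zeta> k) = 1" and big: "\<And>k. \<tau> < ?q (n k) (\<zeta> k)" by metis
  have "\<forall>k. \<zeta> k \<in> sphere 0 1" using \<zeta> by simp
  then obtain \<xi> \<sigma> where \<xi>: "\<xi> \<in> sphere 0 1" and \<sigma>: "strict_mono (\<sigma> :: nat \<Rightarrow> nat)" and lim: "(\<zeta> \<circ> \<sigma>) \<longlonglongrightarrow> \<xi>"
    using compact_sphere[unfolded compact_def, rule_format, of \<zeta>] by metis
  have lim': "(\<lambda>k. \<zeta> (\<sigma> k)) \<longlonglongrightarrow> \<xi>" using lim by (simp add: o_def)
  have nk: "k \<le> n (\<sigma> k)" for k using n[of "\<sigma> k"] seq_suble[OF \<sigma>, of k] by linarith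
  have "isCont (disc_weight \<theta>) \<xi>" unfolding disc_weight_def[abs_def] by (intro continuous_intros)
  then have c: "(\<lambda>k. disc_weight \<theta> (\<zeta> (\<sigma> k))) \<longlonglongrightarrow> disc_weight \<theta> \<xi>" using isCont_tendsto_compose lim' by blast
  have "(\<lambda>k. ?q (n (\<sigma> k)) (\<zeta> (\<sigma> k))) \<longlonglongrightarrow> 0"
  proof (rule trace_vanish[OF bd cont _ _ c])
    show "B (n (\<sigma> k)) \<in> sets M" for k by (rule B)
    show "AE x in M. eventually (\<lambda>k. x \<notin> B (n (\<sigma> k))) sequentially"
      using Bn
    proof eventually_elim
      case (elim x)
      then obtain N where "\<And>m. N \<le> m \<Longrightarrow> x \<notin> B m" unfolding eventually_sequentially by blast
      then show ?case unfolding eventually_sequentially using nk order_trans by blast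
    qed
    show "disc_weight \<theta> \<xi> = 0 \<or> (\<lambda>k. Im (strip_map \<theta> (\<zeta> (\<sigma> k)))) \<longlonglongrightarrow> Im (strip_map \<theta> \<xi>)"
    proof (cases "disc_weight \<theta> \<xi> = 0")
      case False
      then have "isCont (strip_map \<theta>) \<xi>" using \<xi> by (intro isCont_strip_map[OF th]) (auto simp: disc_weight_eq_0)
      from tendsto_Im[OF isCont_tendsto_compose[OF this lim']] show ?thesis by blast
    qed blast
  qed
  then have "eventually (\<lambda>k. ?q (n (\<sigma> k)) (\<zeta> (\<sigma> k)) < \<tau>) sequentially" using \<tau> by (rule order_tendstoD(2))
  then obtain k where "?q (n (\<sigma> k)) (\<zeta> (\<sigma> k)) < \<tau>" unfolding eventually_sequentially by blast
  then show False using big[of "\<sigma> k"] by linarith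
qed

end

context interpolation_pair
begin

text \<open>The weight is 1 at the centre, so the value there is still that of F at \<theta>, cut to
  B.\<close>

definition disc_lift :: "(complex \<Rightarrow> 'a \<Rightarrow> complex) \<Rightarrow> 'a set \<Rightarrow> complex \<Rightarrow> 'a \<Rightarrow> complex" where
  "disc_lift F B w x = disc_weight \<theta> w * F (strip_map \<theta> w) x * indicator B x"

text \<open>If for some \<eta> every radius had a point without splitting, such points would
  accumulate at some \<xi> on the circle. If the weight vanishes at \<xi>, the values tend to 0 in
  the sum space. Otherwise strip_map sends \<xi> to a boundary line, the value at \<xi> lies in the
  space of that line, and nearby values differ from it by little in the sum space. The part of the
  difference in that space is merged with the value at \<xi>, which gives K (\<tau> +
  \<tau>).\<close>

lemma boundary_split_disc_lift:
  assumes F: "F \<in> calF M X0 X1" and Ft: "\<And>z. z \<in> strip \<Longrightarrow> AE x in M. F z x = Ft z x"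
    and B: "B \<in> sets M" and \<tau>: "0 < \<tau>"
    and L: "\<And>\<zeta>. cmod \<zeta> = 1 \<Longrightarrow> qnorm X0 (\<lambda>x. disc_weight \<theta> \<zeta> * F (Complex 0 (Im (strip_map \<theta> \<zeta>))) x * indicator B x) \<le> \<tau>"
    and R: "\<And>\<zeta>. cmod \<zeta> = 1 \<Longrightarrow> qnorm X1 (\<lambda>x. disc_weight \<theta> \<zeta> * F (Complex 1 (Im (strip_map \<theta> \<zeta>))) x * indicator B x) \<le> \<tau>"
  shows "boundary_split (2 * K * \<tau>) (disc_lift Ft B)"
proof (rule ccontr)
  have FD: "qanalytic_on XS strip F" "qbounded_on XS strip F" "qcontinuous_on XS (closure strip) F"
     "qcontinuous_on X0 UNIV (\<lambda>t. F (Complex 0 t))" "qcontinuous_on X1 UNIV (\<lambda>t. F (Complex 1 t))"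
    using F by (auto simp: calF_def)
  have F0: "F (Complex 0 t) \<in> elems X0" and F1: "F (Complex 1 t) \<in> elems X1" for t
    using FD(4,5) by (auto simp: qcontinuous_on_def)
  have FS: "F z \<in> elems XS" if "z \<in> closure strip" for z using FD(3) that by (auto simp: qcontinuous_on_def)
  define good where "good \<eta> r \<zeta> \<longleftrightarrow> (\<exists>a\<in>elems X0. \<exists>b\<in>elems X1. (AE x in M. disc_lift Ft B (of_real r * \<zeta>) x = a x + b x) \<and>
        (Re (strip_map \<theta> (of_real r * \<zeta>)) \<le> \<eta> \<and> qnorm X0 a \<le> 2 * K * \<tau> \<and> qnorm X1 b \<le> \<eta> \<or>
         1 - \<eta> \<le> Re (strip_map \<theta> (of_real r * \<zeta>)) \<and> qnorm X0 a \<le> \<eta> \<and> qnorm X1 b \<le> 2 * K * \<tau> \<or>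
         qnorm X0 a \<le> \<eta> \<and> qnorm X1 b \<le> \<eta>))" for \<eta> r \<zeta>
  assume "\<not> ?thesis"
  then obtain \<eta> where \<eta>: "0 < \<eta>" and "\<forall>r. 0 < r \<and> r < 1 \<longrightarrow> (\<exists>\<zeta>. cmod \<zeta> = 1 \<and> \<not> good \<eta> r \<zeta>)"
    unfolding boundary_split_def good_def[symmetric] by blast
  then obtain \<zeta> where \<zeta>': "\<And>r. 0 < r \<Longrightarrow> r < 1 \<Longrightarrow> cmod (\<zeta> r) = 1" "\<And>r. 0 < r \<Longrightarrow> r < 1 \<Longrightarrow> \<not> good \<eta> r (\<zeta> r)" by metis
  define \<rho> where "\<rho> m = 1 - 1 / (real m + 2)" for m :: nat
  have \<rho>: "0 < \<rho> m" "\<rho> m < 1" for m by (auto simp: \<rho>_def field_simps)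
  have \<rho>1: "\<rho> \<longlonglongrightarrow> 1 - 0" unfolding \<rho>_def
  proof (intro tendsto_intros)
    show "(\<lambda>m. 1 / (real m + 2)) \<longlonglongrightarrow> 0"
      using LIMSEQ_ignore_initial_segment[OF lim_1_over_n, of 2] by (simp add: add.commute)
  qed
  have "\<forall>m. \<zeta> (\<rho> m) \<in> sphere 0 1" using \<zeta>'(1) \<rho> by simp
  then obtain \<xi> \<sigma> where \<xi>: "\<xi> \<in> sphere 0 1" and \<sigma>: "strict_mono (\<sigma> :: nat \<Rightarrow> nat)" and lim: "((\<lambda>m. \<zeta> (\<rho> m)) \<circ> \<sigma>) \<longlonglongrightarrow> \<xi>"
    using compact_sphere[unfolded compact_def, rule_format, of "\<lambda>m. \<zeta> (\<rho> m)"] by metis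
  define w where "w k = of_real (\<rho> (\<sigma> k)) * \<zeta> (\<rho> (\<sigma> k))" for k
  have "(\<lambda>k. \<rho> (\<sigma> k)) \<longlonglongrightarrow> 1" using LIMSEQ_subseq_LIMSEQ[OF \<rho>1 \<sigma>] by (simp add: o_def)
  then have "w \<longlonglongrightarrow> of_real 1 * \<xi>" unfolding w_def
    by (intro tendsto_intros lim[unfolded o_def])
  then have wlim: "w \<longlonglongrightarrow> \<xi>" by simp
  have w1: "cmod (w k) < 1" for k using \<rho>[of "\<sigma> k"] \<zeta>'(1)[OF \<rho>, of "\<sigma> k"] by (simp add: w_def norm_mult)
  \<comment> \<open>Formed with F itself: F has values on the boundary lines, while Ft is known only
    on the open strip.\<close>
  define G where "G u x = disc_weight \<theta> u * F (strip_map \<theta> u) x * indicator B x" for u x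
  have st: "strip_map \<theta> (w k) \<in> strip" for k by (rule strip_map_in_strip[OF theta w1])
  then have stc: "strip_map \<theta> (w k) \<in> closure strip" for k using closure_subset by blast
  have GFt: "AE x in M. disc_lift Ft B (w k) x = G (w k) x" for k
    using Ft[OF st[of k]] by eventually_elim (simp add: disc_lift_def G_def)
  have bad: "\<not> (Re (strip_map \<theta> (w k)) \<le> \<eta> \<and> qnorm X0 a \<le> 2 * K * \<tau> \<and> qnorm X1 b \<le> \<eta> \<or>
         1 - \<eta> \<le> Re (strip_map \<theta> (w k)) \<and> qnorm X0 a \<le> \<eta> \<and> qnorm X1 b \<le> 2 * K * \<tau> \<or>
         qnorm X0 a \<le> \<eta> \<and> qnorm X1 b \<le> \<eta>)"
    if ab: "a \<in> elems X0" "b \<in> elems X1" "AE x in M. G (w k) x = a x + b x" for k a b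
  proof
    assume cs: "Re (strip_map \<theta> (w k)) \<le> \<eta> \<and> qnorm X0 a \<le> 2 * K * \<tau> \<and> qnorm X1 b \<le> \<eta> \<or>
         1 - \<eta> \<le> Re (strip_map \<theta> (w k)) \<and> qnorm X0 a \<le> \<eta> \<and> qnorm X1 b \<le> 2 * K * \<tau> \<or>
         qnorm X0 a \<le> \<eta> \<and> qnorm X1 b \<le> \<eta>"
    have "AE x in M. disc_lift Ft B (w k) x = a x + b x" using GFt[of k] ab(3) by eventually_elim simp
    then have "good \<eta> (\<rho> (\<sigma> k)) (\<zeta> (\<rho> (\<sigma> k)))" unfolding good_def w_def[symmetric] using ab(1,2) cs by blast
    then show False using \<zeta>'(2)[OF \<rho>] by blast
  qed
  have "isCont (disc_weight \<theta>) \<xi>" unfolding disc_weight_def[abs_def] by (intro continuous_intros)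
  then have qlim: "(\<lambda>k. disc_weight \<theta> (w k)) \<longlonglongrightarrow> disc_weight \<theta> \<xi>" using isCont_tendsto_compose wlim by blast
  have ind: "(\<lambda>x. a * f x * indicator B x) \<in> elems XS" "qnorm XS (\<lambda>x. a * f x * indicator B x) \<le> cmod a * qnorm XS f"
    if "f \<in> elems XS" for a f
    using S.indicator_mem[OF S.scale[OF that, of a] B] S.qnorm_scale[OF that, of a] by auto
  have GS: "G (w k) \<in> elems XS" for k unfolding G_def[abs_def] by (rule ind(1)[OF FS[OF stc]])
  show False
  proof (cases "disc_weight \<theta> \<xi> = 0")
    case True
    obtain C where C: "\<And>z. z \<in> strip \<Longrightarrow> qnorm XS (F z) \<le> C" using FD(2) by (auto simp: qbounded_on_def)
    have le: "norm (qnorm XS (G (w k))) \<le> cmod (disc_weight \<theta> (w k)) * C" for k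
    proof -
      have "qnorm XS (G (w k)) \<le> cmod (disc_weight \<theta> (w k)) * qnorm XS (F (strip_map \<theta> (w k)))"
        unfolding G_def[abs_def] by (rule ind(2)[OF FS[OF stc]])
      also have "\<dots> \<le> cmod (disc_weight \<theta> (w k)) * C" by (intro mult_left_mono C st) auto
      finally show ?thesis using S.nonneg[OF GS] by simp
    qed
    have "(\<lambda>k. cmod (disc_weight \<theta> (w k)) * C) \<longlonglongrightarrow> 0"
      using qlim True by (intro tendsto_mult_left_zero) (simp add: tendsto_norm_zero_iff)
    then have "(\<lambda>k. qnorm XS (G (w k))) \<longlonglongrightarrow> 0" by (rule Lim_null_comparison[OF always_eventually[OF allI[OF le]]])
    then have "eventually (\<lambda>k. qnorm XS (G (w k)) < \<eta>) sequentially" using \<eta> by (rule order_tendstoD(2))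
    then obtain k where k: "qnorm XS (G (w k)) < \<eta>" unfolding eventually_sequentially by blast
    from sum_space_split[OF GS k] obtain a b where ab: "a \<in> elems X0" "b \<in> elems X1" "AE x in M. G (w k) x = a x + b x"
      "qnorm X0 a + qnorm X1 b < \<eta>" .
    then have "qnorm X0 a \<le> \<eta>" "qnorm X1 b \<le> \<eta>" using A.O.nonneg[OF ab(1)] B.O.nonneg[OF ab(2)] by auto
    then show False using bad[OF ab(1-3)] by blast
  next
    case False
    have \<xi>': "cmod \<xi> = 1" "\<xi> \<noteq> 1" "\<xi> \<noteq> cis (2 * pi * \<theta>)" using \<xi> False by (auto simp: disc_weight_eq_0)
    define z0 where "z0 = strip_map \<theta> \<xi>"
    have zlim: "(\<lambda>k. strip_map \<theta> (w k)) \<longlonglongrightarrow> z0"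
      unfolding z0_def by (rule isCont_tendsto_compose[OF isCont_strip_map[OF theta \<xi>'] wlim])
    have z0: "Re z0 = 0 \<or> Re z0 = 1" unfolding z0_def by (rule strip_map_circle[OF theta \<xi>'])
    then have z0c: "z0 \<in> closure strip" by (auto simp: closure_strip)
    have l1: "(\<lambda>k. qnorm XS (\<lambda>x. F (strip_map \<theta> (w k)) x - F z0 x)) \<longlonglongrightarrow> 0"
      by (rule S.qcontinuous_seq[OF FD(3) z0c stc zlim])
    have G\<xi>: "G \<xi> \<in> elems XS" unfolding G_def[abs_def] z0_def[symmetric] by (rule ind(1)[OF FS[OF z0c]])
    have le: "norm (qnorm XS (\<lambda>x. G (w k) x - G \<xi> x)) \<le> K * (cmod (disc_weight \<theta> (w k)) * qnorm XS (\<lambda>x. F (strip_map \<theta> (w k)) x - F z0 x)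
         + cmod (disc_weight \<theta> (w k) - disc_weight \<theta> \<xi>) * qnorm XS (F z0))" for k
    proof -
      have d: "(\<lambda>x. F (strip_map \<theta> (w k)) x - F z0 x) \<in> elems XS" by (rule S.diff[OF FS[OF stc] FS[OF z0c]])
      have "(\<lambda>x. G (w k) x - G \<xi> x) = (\<lambda>x. disc_weight \<theta> (w k) * (F (strip_map \<theta> (w k)) x - F z0 x) * indicator B x
         + (disc_weight \<theta> (w k) - disc_weight \<theta> \<xi>) * F z0 x * indicator B x)" by (auto simp: G_def z0_def algebra_simps)
      then have "qnorm XS (\<lambda>x. G (w k) x - G \<xi> x) \<le> K * (qnorm XS (\<lambda>x. disc_weight \<theta> (w k) * (F (strip_map \<theta> (w k)) x - F z0 x) * indicator B x)
         + qnorm XS (\<lambda>x. (disc_weight \<theta> (w k) - disc_weight \<theta> \<xi>) * F z0 x * indicator B x))"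
        using S.triangle[OF ind(1)[OF d] ind(1)[OF FS[OF z0c]]] by simp
      also have "\<dots> \<le> K * (cmod (disc_weight \<theta> (w k)) * qnorm XS (\<lambda>x. F (strip_map \<theta> (w k)) x - F z0 x)
         + cmod (disc_weight \<theta> (w k) - disc_weight \<theta> \<xi>) * qnorm XS (F z0))"
        using ind(2)[OF d] ind(2)[OF FS[OF z0c]] A.K1 by (intro mult_left_mono add_mono) auto
      finally show ?thesis using S.nonneg[OF S.diff[OF GS G\<xi>]] by simp
    qed
    have "(\<lambda>k. K * (cmod (disc_weight \<theta> (w k)) * qnorm XS (\<lambda>x. F (strip_map \<theta> (w k)) x - F z0 x)
         + cmod (disc_weight \<theta> (w k) - disc_weight \<theta> \<xi>) * qnorm XS (F z0))) \<longlonglongrightarrow>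
       K * (cmod (disc_weight \<theta> \<xi>) * 0 + cmod (disc_weight \<theta> \<xi> - disc_weight \<theta> \<xi>) * qnorm XS (F z0))"
      by (intro tendsto_intros l1 qlim)
    then have l2: "(\<lambda>k. K * (cmod (disc_weight \<theta> (w k)) * qnorm XS (\<lambda>x. F (strip_map \<theta> (w k)) x - F z0 x)
         + cmod (disc_weight \<theta> (w k) - disc_weight \<theta> \<xi>) * qnorm XS (F z0))) \<longlonglongrightarrow> 0" by simp
    have l3: "(\<lambda>k. qnorm XS (\<lambda>x. G (w k) x - G \<xi> x)) \<longlonglongrightarrow> 0"
      by (rule Lim_null_comparison[OF always_eventually[OF allI[OF le]] l2])
    \<comment> \<open>The part merged with the boundary value need only be at most \<tau>, the other
      part must be at most \<eta>.\<close>
    have "0 < min \<eta> \<tau>" using \<eta> \<tau> by simp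
    with l3 have e1: "eventually (\<lambda>k. qnorm XS (\<lambda>x. G (w k) x - G \<xi> x) < min \<eta> \<tau>) sequentially" by (rule order_tendstoD(2))
    have Relim: "(\<lambda>k. Re (strip_map \<theta> (w k))) \<longlonglongrightarrow> Re z0" by (rule tendsto_Re[OF zlim])
    show False
      using z0
    proof
      assume re: "Re z0 = 0"
      then have "eventually (\<lambda>k. Re (strip_map \<theta> (w k)) < \<eta>) sequentially"
        using Relim \<eta> by (intro order_tendstoD(2)) auto
      with e1 have "eventually (\<lambda>k. qnorm XS (\<lambda>x. G (w k) x - G \<xi> x) < min \<eta> \<tau> \<and> Re (strip_map \<theta> (w k)) < \<eta>) sequentially"
        by (rule eventually_conj)
      then obtain k where k: "qnorm XS (\<lambda>x. G (w k) x - G \<xi> x) < min \<eta> \<tau>" "Re (strip_map \<theta> (w k)) < \<eta>"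
        unfolding eventually_sequentially by blast
      from sum_space_split[OF S.diff[OF GS G\<xi>] k(1)] obtain a b where ab: "a \<in> elems X0" "b \<in> elems X1"
        "AE x in M. G (w k) x - G \<xi> x = a x + b x" "qnorm X0 a + qnorm X1 b < min \<eta> \<tau>" .
      have n: "qnorm X0 a \<le> \<tau>" "qnorm X1 b \<le> \<eta>" using ab(4) A.O.nonneg[OF ab(1)] B.O.nonneg[OF ab(2)] by auto
      have z: "z0 = Complex 0 (Im z0)" using re by (simp add: complex_eq_iff)
      have G1: "G \<xi> \<in> elems X0"
        unfolding G_def[abs_def] z0_def[symmetric] by (subst z, intro A.O.indicator_mem(1) A.O.scale F0 B)
      have G2: "qnorm X0 (G \<xi>) \<le> \<tau>" using L[OF \<xi>'(1)] z unfolding G_def[abs_def] z0_def[symmetric] by simp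
      have "qnorm X0 (\<lambda>x. G \<xi> x + a x) \<le> K * (qnorm X0 (G \<xi>) + qnorm X0 a)" by (rule A.O.triangle[OF G1 ab(1)])
      also have "\<dots> \<le> K * (\<tau> + \<tau>)" using G2 n A.K1 by (intro mult_left_mono) auto
      finally have "qnorm X0 (\<lambda>x. G \<xi> x + a x) \<le> 2 * K * \<tau>" by simp
      moreover have ae: "AE x in M. G (w k) x = (G \<xi> x + a x) + b x" using ab(3) by eventually_elim (simp add: algebra_simps)
      ultimately show False using bad[OF A.O.add[OF G1 ab(1)] ab(2) ae] n(2) less_imp_le[OF k(2)] by blast
    next
      assume re: "Re z0 = 1"
      then have "eventually (\<lambda>k. 1 - \<eta> < Re (strip_map \<theta> (w k))) sequentially"
        using Relim \<eta> by (intro order_tendstoD(1)) auto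
      with e1 have "eventually (\<lambda>k. qnorm XS (\<lambda>x. G (w k) x - G \<xi> x) < min \<eta> \<tau> \<and> 1 - \<eta> < Re (strip_map \<theta> (w k))) sequentially"
        by (rule eventually_conj)
      then obtain k where k: "qnorm XS (\<lambda>x. G (w k) x - G \<xi> x) < min \<eta> \<tau>" "1 - \<eta> < Re (strip_map \<theta> (w k))"
        unfolding eventually_sequentially by blast
      from sum_space_split[OF S.diff[OF GS G\<xi>] k(1)] obtain a b where ab: "a \<in> elems X0" "b \<in> elems X1"
        "AE x in M. G (w k) x - G \<xi> x = a x + b x" "qnorm X0 a + qnorm X1 b < min \<eta> \<tau>" .
      have n: "qnorm X0 a \<le> \<eta>" "qnorm X1 b \<le> \<tau>" using ab(4) A.O.nonneg[OF ab(1)] B.O.nonneg[OF ab(2)] by auto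
      have z: "z0 = Complex 1 (Im z0)" using re by (simp add: complex_eq_iff)
      have G1: "G \<xi> \<in> elems X1"
        unfolding G_def[abs_def] z0_def[symmetric] by (subst z, intro B.O.indicator_mem(1) B.O.scale F1 B)
      have G2: "qnorm X1 (G \<xi>) \<le> \<tau>" using R[OF \<xi>'(1)] z unfolding G_def[abs_def] z0_def[symmetric] by simp
      have "qnorm X1 (\<lambda>x. G \<xi> x + b x) \<le> K * (qnorm X1 (G \<xi>) + qnorm X1 b)" by (rule B.O.triangle[OF G1 ab(2)])
      also have "\<dots> \<le> K * (\<tau> + \<tau>)" using G2 n A.K1 by (intro mult_left_mono) auto
      finally have "qnorm X1 (\<lambda>x. G \<xi> x + b x) \<le> 2 * K * \<tau>" by simp
      moreover have ae: "AE x in M. G (w k) x = a x + (G \<xi> x + b x)" using ab(3) by eventually_elim (simp add: algebra_simps)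
      ultimately show False using bad[OF ab(1) B.O.add[OF G1 ab(2)] ae] n(1) less_imp_le[OF k(2)] by blast
    qed
  qed
qed

section \<open>The two inclusions\<close>

lemma calF_norm_bounds:
  assumes F: "F \<in> calF M X0 X1"
  shows "qnorm X0 (F (Complex 0 t)) \<le> calF_norm X0 X1 F" "qnorm X1 (F (Complex 1 t)) \<le> calF_norm X0 X1 F"
    "0 \<le> calF_norm X0 X1 F"
proof -
  have "bdd_above (range (\<lambda>t. qnorm X0 (F (Complex 0 t))))" "bdd_above (range (\<lambda>t. qnorm X1 (F (Complex 1 t))))"
    using F by (auto simp: calF_def qbounded_on_def bdd_above_def)
  then have "qnorm X0 (F (Complex 0 t)) \<le> (SUP t. qnorm X0 (F (Complex 0 t)))"
    "qnorm X1 (F (Complex 1 t)) \<le> (SUP t. qnorm X1 (F (Complex 1 t)))" for t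
    by (auto intro: cSUP_upper)
  then show 1: "qnorm X0 (F (Complex 0 t)) \<le> calF_norm X0 X1 F" "qnorm X1 (F (Complex 1 t)) \<le> calF_norm X0 X1 F" for t
    unfolding calF_norm_def by (auto intro: order_trans max.coboundedI1 max.coboundedI2)
  have "F (Complex 0 0) \<in> elems X0" using F by (auto simp: calF_def qbounded_on_def)
  then show "0 \<le> calF_norm X0 X1 F" using 1(1)[of 0] A.O.nonneg order_trans by blast
qed

text \<open>The norm estimate alone does not give membership, since \<open>X\<close> need not have the Fatou
  property. But the estimate also applies to \<open>F\<close> cut down to the sets where the limit function
  is large, and there the traces of \<open>F\<close> are uniformly small.\<close>

lemma interpolation_subset:
  obtains C :: real where "0 < C"
    "\<And>F f. F \<in> calF M X0 X1 \<Longrightarrow> f \<in> borel_measurable M \<Longrightarrow> (AE x in M. F (of_real \<theta>) x = f x) \<Longrightarrow>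
       f \<in> elems (orlicz M X \<Phi>) \<and> qnorm (orlicz M X \<Phi>) f \<le> C * calF_norm X0 X1 F"
proof -
  from modular_estimate obtain M0 C :: real where M0: "0 < M0" and C: "0 < C" and est0:
    "\<forall>\<tau> G f h. 0 < \<tau> \<longrightarrow> boundary_split \<tau> G \<longrightarrow> (AE x in M. (\<lambda>w. G w x) holomorphic_on ball 0 1) \<longrightarrow>
      f \<in> borel_measurable M \<longrightarrow> (AE x in M. G 0 x = f x) \<longrightarrow> (\<forall>x. 0 \<le> h x) \<longrightarrow> (\<lambda>x. complex_of_real (h x)) \<in> elems X \<longrightarrow>
      (AE x in M. h x \<le> \<Phi> (cmod (f x) / (\<tau> * M0))) \<longrightarrow> qnorm X (\<lambda>x. complex_of_real (h x)) \<le> C" .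
  note est = est0[rule_format]
  have K0: "0 < K" using A.K1 by simp
  \<comment> \<open>At least 1, so that it can serve as a dilation factor in
    \<open>modular_star\<close>.\<close>
  define C' where "C' = max 1 C"
  have C': "1 \<le> C'" "C \<le> C'" by (auto simp: C'_def)
  show thesis
  proof (rule that[of "8 * K * M0 * C'"])
    show "0 < 8 * K * M0 * C'" using K0 M0 C' by simp
    fix F f
    assume F: "F \<in> calF M X0 X1" and fm[measurable]: "f \<in> borel_measurable M" and Ff: "AE x in M. F (of_real \<theta>) x = f x"
    have FD: "qanalytic_on XS strip F" "qbounded_on X0 UNIV (\<lambda>t. F (Complex 0 t))" "qbounded_on X1 UNIV (\<lambda>t. F (Complex 1 t))"
     "qcontinuous_on X0 UNIV (\<lambda>t. F (Complex 0 t))" "qcontinuous_on X1 UNIV (\<lambda>t. F (Complex 1 t))"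
      using F by (auto simp: calF_def)
    have F0: "F (Complex 0 t) \<in> elems X0" and F1: "F (Complex 1 t) \<in> elems X1" for t
      using FD(4,5) by (auto simp: qcontinuous_on_def)
    obtain Ft where hol: "AE x in M. (\<lambda>z. Ft z x) holomorphic_on strip" and Ft: "\<forall>z\<in>strip. AE x in M. F z x = Ft z x"
      using S.holomorphic_version[OF FD(1)] by metis
    have \<theta>s: "of_real \<theta> \<in> strip" using theta by (simp add: strip_def)
    have lift_hol: "AE x in M. (\<lambda>w. disc_lift Ft B w x) holomorphic_on ball 0 1" for B
      using hol
    proof eventually_elim
      case (elim x)
      have "(\<lambda>w. Ft (strip_map \<theta> w) x) holomorphic_on ball 0 1"
        using holomorphic_on_compose_gen[OF holomorphic_strip_map[OF theta] elim] strip_map_in_strip[OF theta]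
        by (auto simp: o_def image_subset_iff)
      then show ?case unfolding disc_lift_def
        by (intro holomorphic_intros holomorphic_disc_weight)
    qed
    have lift_0: "AE x in M. disc_lift Ft B 0 x = f x * indicator B x" for B
      using Ff Ft[rule_format, OF \<theta>s] by eventually_elim (simp add: disc_lift_def strip_map_0[OF theta])
    \<comment> \<open>A positive N replaces \<open>calF_norm\<close>, which may be 0 and could then
      not serve as a scale.\<close>
    have bound: "f \<in> elems (orlicz M X \<Phi>) \<and> qnorm (orlicz M X \<Phi>) f \<le> 8 * K * M0 * C' * N" if N: "0 < N" "calF_norm X0 X1 F \<le> N" for N
    proof -
      \<comment> \<open>4N bounds the weighted traces, because the weight has modulus at most 4, and
        2K is lost in \<open>boundary_split_disc_lift\<close>.\<close>
      define \<sigma> where "\<sigma> = 8 * K * N"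
      have \<sigma>: "0 < \<sigma>" using K0 N by (simp add: \<sigma>_def)
      define v where "v x = \<Phi> (cmod (f x) / (\<sigma> * M0))" for x
      have v0: "0 \<le> v x" for x unfolding v_def using \<sigma> M0 by (intro Phi_target_nonneg) auto
      have [measurable]: "v \<in> borel_measurable M" unfolding v_def using \<sigma> M0 by (intro T.measurable_comp_div) auto
      have split1: "boundary_split (2 * K * (4 * N)) (disc_lift Ft (space M))"
      proof (rule boundary_split_disc_lift[OF F Ft[rule_format]])
        show "0 < 4 * N" using N by simp
        fix \<zeta> :: complex assume \<zeta>: "cmod \<zeta> = 1"
        have q: "cmod (disc_weight \<theta> \<zeta>) \<le> 4" using \<zeta> by (intro norm_disc_weight_le) auto
        let ?t = "Im (strip_map \<theta> \<zeta>)"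
        have "qnorm X0 (\<lambda>x. disc_weight \<theta> \<zeta> * F (Complex 0 ?t) x * indicator (space M) x) \<le> cmod (disc_weight \<theta> \<zeta>) * qnorm X0 (F (Complex 0 ?t))"
          using A.O.indicator_mem(2)[OF A.O.scale[OF F0] sets.top, of "disc_weight \<theta> \<zeta>" ?t] A.O.qnorm_scale[OF F0] by simp
        also have "\<dots> \<le> 4 * N" using q calF_norm_bounds(1)[OF F, of ?t] N A.O.nonneg[OF F0] by (intro mult_mono) auto
        finally show "qnorm X0 (\<lambda>x. disc_weight \<theta> \<zeta> * F (Complex 0 ?t) x * indicator (space M) x) \<le> 4 * N" .
        have "qnorm X1 (\<lambda>x. disc_weight \<theta> \<zeta> * F (Complex 1 ?t) x * indicator (space M) x) \<le> cmod (disc_weight \<theta> \<zeta>) * qnorm X1 (F (Complex 1 ?t))"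
          using B.O.indicator_mem(2)[OF B.O.scale[OF F1] sets.top, of "disc_weight \<theta> \<zeta>" ?t] B.O.qnorm_scale[OF F1] by simp
        also have "\<dots> \<le> 4 * N" using q calF_norm_bounds(2)[OF F, of ?t] N B.O.nonneg[OF F1] by (intro mult_mono) auto
        finally show "qnorm X1 (\<lambda>x. disc_weight \<theta> \<zeta> * F (Complex 1 ?t) x * indicator (space M) x) \<le> 4 * N" .
      qed auto
      have f0: "AE x in M. disc_lift Ft (space M) 0 x = f x"
        using lift_0[of "space M"] AE_space by eventually_elim simp
      have est_v: "qnorm X (\<lambda>x. complex_of_real (h x)) \<le> C"
        if "\<And>x. 0 \<le> h x" "(\<lambda>x. complex_of_real (h x)) \<in> elems X" "AE x in M. h x \<le> v x" for h
        using est[OF \<sigma> _ lift_hol fm f0 that(1,2)] split1 that(3) by (simp add: \<sigma>_def v_def mult.assoc)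
      define u where "u n x = complex_of_real (if v x \<le> real n then v x else 0)" for n :: nat and x
      have [measurable]: "u n \<in> borel_measurable M" for n unfolding u_def by measurable
      have uX: "u n \<in> elems X" for n
      proof (rule A.idealD(1)[OF _ A.scale[OF A.const_one, of "of_nat n"]])
        show "AE x in M. cmod (u n x) \<le> cmod (of_nat n * 1)" using v0 by (auto simp: u_def)
      qed measurable
      have cauchy: "\<exists>n0. \<forall>m\<ge>n0. \<forall>n\<ge>n0. qnorm X (\<lambda>x. u m x - u n x) < e" if e: "0 < e" for e
      proof -
        define \<delta> where "\<delta> = min 1 (e / (2 * C))"
        have \<delta>: "0 < \<delta>" "\<delta> \<le> 1" "\<delta> * C < e" using e C by (auto simp: \<delta>_def min_def field_simps)
        define B where "B n = {x \<in> space M. real n < v x}" for n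
        have [measurable]: "B n \<in> sets M" for n unfolding B_def by measurable
        have Bn: "AE x in M. eventually (\<lambda>n. x \<notin> B n) sequentially"
        proof (rule AE_I2)
          fix x
          obtain n0 :: nat where "v x \<le> n0" using real_arch_simple by blast
          then have "x \<notin> B n" if "n0 \<le> n" for n using that by (auto simp: B_def)
          then show "eventually (\<lambda>n. x \<notin> B n) sequentially" unfolding eventually_sequentially by blast
        qed
        let ?\<tau> = "\<delta> * \<sigma> / (2 * K)"
        have \<tau>: "0 < ?\<tau>" using \<delta> \<sigma> K0 by simp
        obtain n0 where n0: "\<And>n \<zeta>. n0 \<le> n \<Longrightarrow> cmod \<zeta> = 1 \<Longrightarrow> qnorm X0 (\<lambda>x. disc_weight \<theta> \<zeta> * F (Complex 0 (Im (strip_map \<theta> \<zeta>))) x * indicator (B n) x) \<le> ?\<tau>"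
          using A.circle_trace_small[OF theta FD(2,4) _ Bn \<tau>] unfolding eventually_sequentially by auto
        obtain n1 where n1: "\<And>n \<zeta>. n1 \<le> n \<Longrightarrow> cmod \<zeta> = 1 \<Longrightarrow> qnorm X1 (\<lambda>x. disc_weight \<theta> \<zeta> * F (Complex 1 (Im (strip_map \<theta> \<zeta>))) x * indicator (B n) x) \<le> ?\<tau>"
          using B.circle_trace_small[OF theta FD(3,5) _ Bn \<tau>] unfolding eventually_sequentially by auto
        have diff: "qnorm X (\<lambda>x. u m x - u n x) < e" if n: "max n0 n1 \<le> n" and mn: "n \<le> m" for m n
        proof -
          have "boundary_split (2 * K * ?\<tau>) (disc_lift Ft (B n))"
            by (rule boundary_split_disc_lift[OF F Ft[rule_format] _ \<tau> n0 n1]) (use n in auto)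
          moreover have "2 * K * ?\<tau> = \<delta> * \<sigma>" using K0 by simp
          ultimately have sp: "boundary_split (\<delta> * \<sigma>) (disc_lift Ft (B n))" by simp
          \<comment> \<open>On the band n < v \<le> m the star inequality gives v / \<delta> \<le>
            \<Phi>(|f| / (\<delta> \<sigma> M0)). So h is admissible for the estimate at size
            \<delta> \<sigma>, available because the traces cut to B n are small, and u m - u n =
            \<delta> h gains the factor \<delta>.\<close>
          define h where "h x = (if real n < v x \<and> v x \<le> real m then v x / \<delta> else 0)" for x
          have h0: "0 \<le> h x" for x using v0 \<delta> by (simp add: h_def)
          have uh: "u m x - u n x = complex_of_real \<delta> * complex_of_real (h x)" for x
            using mn \<delta> by (auto simp: u_def h_def)
          have hu: "complex_of_real (h x) = complex_of_real (1 / \<delta>) * (u m x - u n x)" for x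
            unfolding uh using \<delta> by simp
          have hX: "(\<lambda>x. complex_of_real (h x)) \<in> elems X"
            unfolding hu by (intro A.scale A.diff uX)
          have "qnorm X (\<lambda>x. complex_of_real (h x)) \<le> C"
          proof (rule est[OF _ sp lift_hol _ lift_0 h0 hX])
            show "0 < \<delta> * \<sigma>" using \<delta> \<sigma> by simp
            show "(\<lambda>x. f x * indicator (B n) x) \<in> borel_measurable M" by measurable
            show "AE x in M. h x \<le> \<Phi> (cmod (f x * indicator (B n) x) / (\<delta> * \<sigma> * M0))"
            proof (rule AE_I2)
              fix x assume x: "x \<in> space M"
              show "h x \<le> \<Phi> (cmod (f x * indicator (B n) x) / (\<delta> * \<sigma> * M0))"
              proof (cases "real n < v x \<and> v x \<le> real m")
                case True
                then have xB: "x \<in> B n" using x by (simp add: B_def)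
                have "v x = \<Phi> (\<delta> * (cmod (f x) / (\<delta> * \<sigma> * M0)))" unfolding v_def using \<delta> by simp
                also have "\<dots> \<le> \<delta> * \<Phi> (cmod (f x) / (\<delta> * \<sigma> * M0))"
                  using \<delta> \<sigma> M0 by (intro T.star) auto
                finally have "v x / \<delta> \<le> \<Phi> (cmod (f x) / (\<delta> * \<sigma> * M0))" using \<delta> by (simp add: pos_divide_le_eq mult.commute)
                then show ?thesis using True xB by (simp add: h_def)
              next
                case False
                then have "h x = 0" by (auto simp: h_def)
                then show ?thesis using \<delta> \<sigma> M0 by (simp add: Phi_target_nonneg)
              qed
            qed
          qed
          moreover have "qnorm X (\<lambda>x. u m x - u n x) = \<delta> * qnorm X (\<lambda>x. complex_of_real (h x))"
            unfolding uh by (rule A.qnorm_scale_real[OF hX]) (use \<delta> in simp)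
          ultimately have "qnorm X (\<lambda>x. u m x - u n x) \<le> \<delta> * C" using \<delta> by (simp add: mult_left_mono)
          then show ?thesis using \<delta>(3) by linarith
        qed
        show ?thesis
        proof (intro exI allI impI)
          fix m n assume "max n0 n1 \<le> m" "max n0 n1 \<le> n"
          then show "qnorm X (\<lambda>x. u m x - u n x) < e"
            using diff[of m n] diff[of n m] A.qnorm_diff_commute[OF uX uX, of m n] by (cases "m \<le> n") auto
        qed
      qed
      then obtain g where g: "g \<in> elems X" and glim: "(\<lambda>n. qnorm X (\<lambda>x. u n x - g x)) \<longlonglongrightarrow> 0"
        using A.complete uX unfolding qnorm_complete_def by blast
      have [measurable]: "g \<in> borel_measurable M" by (rule A.meas[OF g])
      have "AE x in M. v x \<le> real n \<longrightarrow> complex_of_real (v x) = g x" for n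
      proof -
        define A where "A = {x \<in> space M. v x \<le> real n}"
        have [measurable]: "A \<in> sets M" unfolding A_def by measurable
        define d where "d x = (u n x - g x) * indicator A x" for x
        have d: "d \<in> elems X" unfolding d_def[abs_def] by (intro A.indicator_mem A.diff uX g) measurable
        have "qnorm X d \<le> qnorm X (\<lambda>x. u m x - g x)" if "n \<le> m" for m
        proof -
          \<comment> \<open>Where v \<le> n, all truncations u m with m \<ge> n equal v. So d does
            not depend on m, and its quasi-norm lies below every error of the convergence to
            g.\<close>
          have "d = (\<lambda>x. (u m x - g x) * indicator A x)" using that by (auto simp: d_def A_def u_def indicator_def)
          then show ?thesis using A.indicator_mem(2)[OF A.diff[OF uX g], of A m] by simp
        qed
        then have "qnorm X d \<le> 0" by (intro LIMSEQ_le_const[OF glim]) blast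
        then have "AE x in M. d x = 0" using A.nonneg[OF d] A.definite[OF d] by simp
        then show ?thesis using AE_space by eventually_elim (auto simp: d_def A_def u_def)
      qed
      then have "AE x in M. \<forall>n. v x \<le> real n \<longrightarrow> complex_of_real (v x) = g x" unfolding AE_all_countable by blast
      then have "AE x in M. complex_of_real (v x) = g x"
        by eventually_elim (use real_arch_simple in blast)
      then have vX: "(\<lambda>x. complex_of_real (v x)) \<in> elems X" by (intro A.AE_cong(1)[OF _ g]) measurable
      have vC: "qnorm X (\<lambda>x. complex_of_real (v x)) \<le> C" by (rule est_v[OF v0 vX]) simp
      have sM: "0 < \<sigma> * M0" using \<sigma> M0 by simp
      note ms = T.modular_star[OF fm sM C'(1) vX[unfolded v_def]]
      have "qnorm X (\<lambda>x. complex_of_real (v x)) / C' \<le> 1" using vC C' by (simp add: divide_le_eq)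
      then have "qnorm X (T.modular (\<sigma> * M0 * C') f) \<le> 1" using ms(2) unfolding v_def by linarith
      then have "f \<in> elems (orlicz M X \<Phi>)" "qnorm (orlicz M X \<Phi>) f \<le> \<sigma> * M0 * C'"
        using T.orlicz_qnorm_le[OF fm _ ms(1)] sM C' by auto
      then show ?thesis by (simp add: \<sigma>_def mult_ac)
    qed
    have cn: "0 \<le> calF_norm X0 X1 F" by (rule calF_norm_bounds[OF F])
    have "f \<in> elems (orlicz M X \<Phi>)" using bound[of "calF_norm X0 X1 F + 1"] cn by simp
    moreover have "qnorm (orlicz M X \<Phi>) f \<le> 8 * K * M0 * C' * calF_norm X0 X1 F"
    proof (rule field_le_epsilon)
      fix e :: real assume e: "0 < e"
      let ?c = "8 * K * M0 * C'"
      have c: "0 < ?c" using K0 M0 C' by simp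
      have "qnorm (orlicz M X \<Phi>) f \<le> ?c * (calF_norm X0 X1 F + e / ?c)"
        using bound[of "calF_norm X0 X1 F + e / ?c"] cn e c by (simp add: add_nonneg_pos)
      also have "?c * (y + e / ?c) = ?c * y + e" for y using c by (simp only: distrib_left nonzero_mult_div_cancel_left times_divide_eq_right less_imp_neq[symmetric] not_False_eq_True)
      finally show "qnorm (orlicz M X \<Phi>) f \<le> ?c * calF_norm X0 X1 F + e" .
    qed
    ultimately show "f \<in> elems (orlicz M X \<Phi>) \<and> qnorm (orlicz M X \<Phi>) f \<le> 8 * K * M0 * C' * calF_norm X0 X1 F" by simp
  qed
qed

end

section \<open>The explicit interpolating function\<close>

lemma exp_times_partial_sum_le:
  fixes L r :: real and w :: complex
  assumes "cmod w \<le> r"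
  shows "cmod (\<Sum>j<n. (w * of_real L) ^ j / fact j) \<le> exp (r * \<bar>L\<bar>)"
proof -
  have "cmod (\<Sum>j<n. (w * of_real L) ^ j / fact j) \<le> (\<Sum>j<n. cmod ((w * of_real L) ^ j / fact j))" by (rule norm_sum)
  also have "\<dots> \<le> (\<Sum>j<n. (r * \<bar>L\<bar>) ^ j / fact j)"
    using assms by (intro sum_mono) (auto simp: norm_divide norm_mult norm_power intro!: divide_right_mono power_mono mult_right_mono)
  also have "\<dots> \<le> exp (r * \<bar>L\<bar>)"
  proof -
    have r: "0 \<le> r" using assms norm_ge_zero order_trans by blast
    have "(\<lambda>j. (r * \<bar>L\<bar>) ^ j / fact j) sums exp (r * \<bar>L\<bar>)"
      using exp_converges[of "r * \<bar>L\<bar>"] by (simp add: divide_inverse mult.commute)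
    then show ?thesis using r sum_le_suminf[of "\<lambda>j. (r * \<bar>L\<bar>) ^ j / fact j" "{..<n}"] by (auto simp: sums_iff)
  qed
  finally show ?thesis .
qed

context young_orlicz
begin

lemma dominated_trace:
  fixes T :: "real \<Rightarrow> 'a \<Rightarrow> complex"
  assumes P: "P \<in> elems Y" and T[measurable]: "\<And>t. T t \<in> borel_measurable M"
    and le: "\<And>t x. cmod (T t x) \<le> cmod (P x)"
    and lim: "\<And>t t0 x. t \<longlonglongrightarrow> t0 \<Longrightarrow> (\<lambda>n. T (t n) x - T t0 x) \<longlonglongrightarrow> 0"
  shows "qcontinuous_on Y UNIV T" "qbounded_on Y UNIV T"
    "qnorm Y (T t) \<le> qnorm Y P"
proof -
  have TY: "T t \<in> elems Y" "qnorm Y (T t) \<le> qnorm Y P" for t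
    using O.idealD[OF T P AE_I2[OF le]] .
  show "qbounded_on Y UNIV T" unfolding qbounded_on_def using TY by blast
  show "qnorm Y (T t) \<le> qnorm Y P" by (rule TY)
  show "qcontinuous_on Y UNIV T"
    unfolding qcontinuous_on_def tendsto_at_iff_sequentially
  proof (intro conjI ballI allI impI TY)
    fix t0 :: real and t :: "nat \<Rightarrow> real" assume t: "t \<longlonglongrightarrow> t0"
    have "(\<lambda>n. qnorm Y (\<lambda>x. T (t n) x - T t0 x)) \<longlonglongrightarrow> 0"
    proof (rule orlicz_dominated[OF _ O.scale[OF P, of 2]])
      show "AE x in M. cmod (T (t n) x - T t0 x) \<le> cmod (2 * P x)" for n
      proof (rule AE_I2)
        fix x
        show "cmod (T (t n) x - T t0 x) \<le> cmod (2 * P x)"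
          using norm_triangle_ineq4[of "T (t n) x" "T t0 x"] le[of "t n" x] le[of t0 x] by (simp add: norm_mult)
      qed
      show "AE x in M. (\<lambda>n. T (t n) x - T t0 x) \<longlonglongrightarrow> 0" using lim[OF t] by simp
    qed measurable
    then show "((\<lambda>t. qnorm Y (\<lambda>x. T t x - T t0 x)) \<circ> t) \<longlonglongrightarrow> 0" by (simp add: o_def)
  qed
qed

end

context interpolation_pair
begin

text \<open>The delicate point is analyticity in the sum space. With L = ln (q / p), the expansion
  at z0 is F z0 times the exponential series in (z - z0) L; its partial sums are dominated by |F z0|
  exp (r |L|), which is the modulus of F at z0 shifted horizontally by r and hence at most |P| +
  |Q|.\<close>

lemma orlicz_subset:
  assumes f: "f \<in> elems (orlicz M X \<Phi>)" and k: "qnorm (orlicz M X \<Phi>) f < k"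
  obtains F where "F \<in> calF M X0 X1" "AE x in M. F (of_real \<theta>) x = f x" "calF_norm X0 X1 F \<le> k"
proof -
  have fm[measurable]: "f \<in> borel_measurable M" using f T.orlicz_mem by auto
  have k0: "0 < k" using k T.orlicz_qnorm_nonneg[OF f] by simp
  define g where "g x = \<Phi> (cmod (f x) / k)" for x
  have g0: "0 \<le> g x" for x unfolding g_def using k0 by (intro Phi_target_nonneg) auto
  have [measurable]: "g \<in> borel_measurable M" unfolding g_def using k0 by (intro T.measurable_comp_div) auto
  have gX: "(\<lambda>x. complex_of_real (g x)) \<in> elems X" "qnorm X (\<lambda>x. complex_of_real (g x)) \<le> 1"
    unfolding g_def using T.modular_le1[OF f k] by auto
  define p where "p x = \<Psi>0 (g x)" for x
  define q where "q x = \<Psi>1 (g x)" for x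
  have [measurable]: "p \<in> borel_measurable M" "q \<in> borel_measurable M"
    unfolding p_def q_def using g0 by (auto intro: A.measurable_inv_half B.measurable_inv_half)
  have pq0: "0 \<le> p x" "0 \<le> q x" for x using A.inv_half_nonneg B.inv_half_nonneg g0 by (auto simp: p_def q_def)
  have pq: "0 < p x" "0 < q x" if "g x \<noteq> 0" for x
    using A.inv_half_pos B.inv_half_pos g0[of x] that by (auto simp: p_def q_def)
  have pz: "p x = 0" "q x = 0" if "g x = 0" for x using that by (auto simp: p_def q_def A.inv_half_0 B.inv_half_0)
  have ff: "cmod (f x) = k * (p x powr (1 - \<theta>) * q x powr \<theta>)" for x
    using factor[of "cmod (f x) / k"] k0 by (simp add: g_def p_def q_def field_simps)
  define P where "P x = complex_of_real (k * p x)" for x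
  define Q where "Q x = complex_of_real (k * q x)" for x
  have [measurable]: "P \<in> borel_measurable M" "Q \<in> borel_measurable M" unfolding P_def Q_def by measurable
  have P: "P \<in> elems X0" "qnorm X0 P \<le> k"
    using A.orlicz_qnorm_le[of P k] k0 pq0 gX g0 by (auto simp: P_def norm_mult p_def A.Phi_inv_half)
  have Q: "Q \<in> elems X1" "qnorm X1 Q \<le> k"
    using B.orlicz_qnorm_le[of Q k] k0 pq0 gX g0 by (auto simp: Q_def norm_mult q_def B.Phi_inv_half)
  have nPQ: "cmod (P x) = k * p x" "cmod (Q x) = k * q x" for x using pq0 k0 by (auto simp: P_def Q_def norm_mult)
  \<comment> \<open>Where g vanishes, so does f, while p = q = 0 have no logarithm; the value 0 is
    set by hand.\<close>
  define F where "F z x = (if g x = 0 then 0 else of_real k * sgn (f x) * exp ((1 - z) * of_real (ln (p x)) + z * of_real (ln (q x))))" for z x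
  have [measurable]: "F z \<in> borel_measurable M" for z unfolding F_def[abs_def] by measurable
  have f_ne: "f x \<noteq> 0" if "g x \<noteq> 0" for x using that by (auto simp: g_def)
  have nF: "cmod (F z x) = (if g x = 0 then 0 else k * (p x powr (1 - Re z) * q x powr Re z))" for z x
  proof (cases "g x = 0")
    case False
    then show ?thesis using f_ne[OF False] k0 pq[OF False]
      by (simp add: F_def norm_mult norm_sgn norm_exp_eq_Re powr_def exp_add)
  qed (simp add: F_def)
  have nF_le: "cmod (F z x) \<le> cmod (P x) + cmod (Q x)" if z: "0 \<le> Re z" "Re z \<le> 1" for z x
  proof (cases "g x = 0")
    case False
    have m: "0 < max (p x) (q x)" using pq[OF False] by simp
    have "p x powr (1 - Re z) * q x powr Re z \<le> max (p x) (q x) powr (1 - Re z) * max (p x) (q x) powr Re z"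
      using pq[OF False] z by (intro mult_mono powr_mono2) auto
    also have "\<dots> = max (p x) (q x)" using m by (simp flip: powr_add)
    also have "\<dots> \<le> p x + q x" using pq0[of x] by auto
    finally have "k * (p x powr (1 - Re z) * q x powr Re z) \<le> k * (p x + q x)" using k0 by (intro mult_left_mono) auto
    then show ?thesis using False by (simp add: nF nPQ algebra_simps)
  qed (simp add: nF)
  define W where "W x = complex_of_real (cmod (P x) + cmod (Q x))" for x
  have nW: "cmod (W x) = cmod (P x) + cmod (Q x)" for x unfolding W_def by (subst norm_of_real) simp
  have [measurable]: "W \<in> borel_measurable M" unfolding W_def by measurable
  have W: "W \<in> elems XS" "qnorm XS W \<le> k + k"
    using sum_space_le[OF A.qideal_orlicz B.qideal_orlicz P(1) Q(1), of W] P(2) Q(2) nPQ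
    by (auto simp: W_def P_def Q_def simp flip: of_real_mult)
  have FS: "F z \<in> elems XS" "qnorm XS (F z) \<le> k + k" if z: "0 \<le> Re z" "Re z \<le> 1" for z
  proof -
    have le: "AE x in M. cmod (F z x) \<le> cmod (W x)" using nF_le[OF z] by (simp add: nW)
    show "F z \<in> elems XS" by (rule S.idealD(1)[OF _ W(1) le]) measurable
    have "qnorm XS (F z) \<le> qnorm XS W" by (rule S.idealD(2)[OF _ W(1) le]) measurable
    then show "qnorm XS (F z) \<le> k + k" using W(2) by simp
  qed
  have Fcont: "(\<lambda>n. F (w n) x - F z x) \<longlonglongrightarrow> 0" if "w \<longlonglongrightarrow> z" for w z x
  proof -
    have "(\<lambda>n. F (w n) x) \<longlonglongrightarrow> F z x"
      unfolding F_def using that by (cases "g x = 0") (auto intro!: tendsto_intros)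
    then show ?thesis by (simp add: LIM_zero)
  qed
  have 1: "qanalytic_on XS strip F"
    unfolding qanalytic_on_def
  proof (intro conjI ballI)
    show "F z \<in> elems XS" if "z \<in> strip" for z using FS that by (simp add: strip_def)
    fix z0 assume z0: "z0 \<in> strip"
    \<comment> \<open>The distance to the nearer boundary line, so that shifts by r stay in the
      closed strip.\<close>
    define r where "r = min (Re z0) (1 - Re z0)"
    have r: "0 < r" "r \<le> Re z0" "Re z0 + r \<le> 1" using z0 by (auto simp: r_def strip_def)
    define L where "L x = ln (q x) - ln (p x)" for x
    have [measurable]: "L \<in> borel_measurable M" unfolding L_def by measurable
    define a where "a j x = F z0 x * of_real (L x) ^ j / fact j" for j x
    have [measurable]: "a j \<in> borel_measurable M" for j unfolding a_def by measurable
    \<comment> \<open>A horizontal shift by u multiplies the modulus by exp (u L); shifting in the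
      direction of the sign of L produces exp (r |L|).\<close>
    have dom: "cmod (F z0 x) * exp (r * \<bar>L x\<bar>) \<le> cmod (P x) + cmod (Q x)" for x
    proof (cases "g x = 0")
      case False
      have sh: "cmod (F z0 x) * exp (u * L x) = cmod (F (z0 + of_real u) x)" for u
        using False pq[OF False] by (simp add: nF L_def powr_def algebra_simps flip: exp_add)
      show ?thesis
      proof (cases "0 \<le> L x")
        case True
        then show ?thesis using sh[of r] nF_le[of "z0 + of_real r" x] r by simp
      next
        case False
        then show ?thesis using sh[of "- r"] nF_le[of "z0 + of_real (- r)" x] r by simp
      qed
    qed (simp add: nF)
    have ball: "Re z \<in> {0..1}" "z \<in> strip" if "z \<in> ball z0 r" for z
    proof -
      have "\<bar>Re z - Re z0\<bar> < r" using that abs_Re_le_cmod[of "z - z0"] by (simp add: dist_norm norm_minus_commute)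
      then show "z \<in> strip" using r by (auto simp: strip_def)
      then show "Re z \<in> {0..1}" by (auto simp: strip_def)
    qed
    have partial: "(\<Sum>j<n. (z - z0) ^ j * a j x) = F z0 x * (\<Sum>j<n. ((z - z0) * of_real (L x)) ^ j / fact j)" for z n x
      by (simp add: a_def sum_distrib_left power_mult_distrib mult_ac)
    have Fz: "F z x = F z0 x * exp ((z - z0) * of_real (L x))" for z x
      by (auto simp: F_def L_def algebra_simps simp flip: exp_add)
    show "\<exists>r>0. ball z0 r \<subseteq> strip \<and> (\<exists>a. (\<forall>k. a k \<in> elems XS) \<and>
       (\<forall>z\<in>ball z0 r. (\<lambda>n. qnorm XS (\<lambda>x. F z x - (\<Sum>k<n. (z - z0) ^ k * a k x))) \<longlonglongrightarrow> 0))"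
    proof (rule exI[of _ r], intro conjI exI[of _ a] allI ballI)
      show "0 < r" "ball z0 r \<subseteq> strip" using r ball by auto
      fix j
      have "AE x in M. cmod (a j x) \<le> cmod (of_real (1 / r ^ j) * W x)"
      proof (rule AE_I2)
        fix x
        have "(r * \<bar>L x\<bar>) ^ j / fact j \<le> exp (r * \<bar>L x\<bar>)"
        proof -
          have "(r * \<bar>L x\<bar>) ^ j / fact j \<le> (\<Sum>i<Suc j. (r * \<bar>L x\<bar>) ^ i / fact i)"
            by (rule member_le_sum) (use r in auto)
          also have "\<dots> \<le> cmod (\<Sum>i<Suc j. (of_real r * of_real \<bar>L x\<bar>) ^ i / fact i)"
          proof -
            have "(\<Sum>i<Suc j. (of_real r * of_real \<bar>L x\<bar>) ^ i / fact i) = complex_of_real (\<Sum>i<Suc j. (r * \<bar>L x\<bar>) ^ i / fact i)" by simp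
            then show ?thesis by (simp only: norm_of_real)
          qed
          also have "\<dots> \<le> exp (r * \<bar>\<bar>L x\<bar>\<bar>)" by (rule exp_times_partial_sum_le) (use r in simp)
          finally show ?thesis by simp
        qed
        then have "cmod (F z0 x) * ((r * \<bar>L x\<bar>) ^ j / fact j) \<le> cmod (P x) + cmod (Q x)"
          using mult_left_mono[of "(r * \<bar>L x\<bar>) ^ j / fact j" "exp (r * \<bar>L x\<bar>)" "cmod (F z0 x)"] dom[of x] by simp
        moreover have "cmod (a j x) = 1 / r ^ j * (cmod (F z0 x) * ((r * \<bar>L x\<bar>) ^ j / fact j))"
          using r by (simp add: a_def norm_mult norm_divide norm_power power_mult_distrib)
        ultimately have "cmod (a j x) \<le> 1 / r ^ j * cmod (W x)"
          unfolding nW using r(1) by (metis mult_left_mono zero_le_divide_1_iff zero_le_power less_imp_le)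
        then show "cmod (a j x) \<le> cmod (of_real (1 / r ^ j) * W x)" using r by (simp add: norm_mult norm_divide norm_power)
      qed
      then show "a j \<in> elems XS" by (intro S.idealD(1)[OF _ S.scale[OF W(1)]]) measurable
    next
      fix z assume z: "z \<in> ball z0 r"
      show "(\<lambda>n. qnorm XS (\<lambda>x. F z x - (\<Sum>k<n. (z - z0) ^ k * a k x))) \<longlonglongrightarrow> 0"
      proof (rule sum_dominated(1)[OF _ A.O.scale[OF P(1), of 2] B.O.scale[OF Q(1), of 2]])
        show "(\<lambda>x. F z x - (\<Sum>k<n. (z - z0) ^ k * a k x)) \<in> borel_measurable M" for n by measurable
        show "AE x in M. cmod (F z x - (\<Sum>k<n. (z - z0) ^ k * a k x)) \<le> cmod (2 * P x) + cmod (2 * Q x)" for n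
        proof (rule AE_I2)
          fix x
          have "cmod (z - z0) \<le> r" using z by (simp add: dist_norm norm_minus_commute)
          then have "cmod (\<Sum>k<n. (z - z0) ^ k * a k x) \<le> cmod (F z0 x) * exp (r * \<bar>L x\<bar>)"
            unfolding partial norm_mult by (intro mult_left_mono exp_times_partial_sum_le) auto
          also have "\<dots> \<le> cmod (P x) + cmod (Q x)" by (rule dom)
          finally show "cmod (F z x - (\<Sum>k<n. (z - z0) ^ k * a k x)) \<le> cmod (2 * P x) + cmod (2 * Q x)"
            using norm_triangle_ineq4[of "F z x" "\<Sum>k<n. (z - z0) ^ k * a k x"] nF_le[of z x] ball(1)[OF z] by (simp add: norm_mult)
        qed
        show "AE x in M. (\<lambda>n. F z x - (\<Sum>k<n. (z - z0) ^ k * a k x)) \<longlonglongrightarrow> 0"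
        proof (rule AE_I2)
          fix x
          let ?w = "(z - z0) * of_real (L x)"
          have "(\<lambda>n. \<Sum>j<n. ?w ^ j / fact j) \<longlonglongrightarrow> exp ?w"
            using exp_converges[of ?w] by (simp add: sums_def scaleR_conv_of_real divide_inverse mult.commute)
          then have "(\<lambda>n. F z x - F z0 x * (\<Sum>j<n. ?w ^ j / fact j)) \<longlonglongrightarrow> F z x - F z0 x * exp ?w" by (intro tendsto_intros)
          then show "(\<lambda>n. F z x - (\<Sum>k<n. (z - z0) ^ k * a k x)) \<longlonglongrightarrow> 0" unfolding partial Fz[of z x] by simp
        qed
      qed
    qed
  qed
  have 2: "qbounded_on XS strip F"
    unfolding qbounded_on_def
  proof (intro conjI ballI exI[of _ "k + k"])
    fix z assume "z \<in> strip"
    then show "F z \<in> elems XS" "qnorm XS (F z) \<le> k + k" using FS by (auto simp: strip_def)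
  qed
  have 3: "qcontinuous_on XS (closure strip) F"
    unfolding qcontinuous_on_def
  proof (intro conjI ballI)
    fix z :: complex assume z: "z \<in> closure strip"
    then show "F z \<in> elems XS" using FS by (auto simp: closure_strip)
    show "((\<lambda>w. qnorm XS (\<lambda>x. F w x - F z x)) \<longlongrightarrow> 0) (at z within closure strip)"
      unfolding tendsto_at_iff_sequentially
    proof (intro allI impI)
      fix w :: "nat \<Rightarrow> complex" assume w: "\<forall>i. w i \<in> closure strip - {z}" "w \<longlonglongrightarrow> z"
      have "(\<lambda>n. qnorm XS (\<lambda>x. F (w n) x - F z x)) \<longlonglongrightarrow> 0"
      proof (rule sum_dominated(1)[OF _ A.O.scale[OF P(1), of 2] B.O.scale[OF Q(1), of 2]])
        show "(\<lambda>x. F (w n) x - F z x) \<in> borel_measurable M" for n by measurable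
        show "AE x in M. cmod (F (w n) x - F z x) \<le> cmod (2 * P x) + cmod (2 * Q x)" for n
        proof (rule AE_I2)
          fix x
          have "w n \<in> closure strip" using w(1) by blast
          then show "cmod (F (w n) x - F z x) \<le> cmod (2 * P x) + cmod (2 * Q x)"
            using norm_triangle_ineq4[of "F (w n) x" "F z x"] nF_le[of z x] nF_le[of "w n" x] z
            by (simp add: norm_mult closure_strip)
        qed
        show "AE x in M. (\<lambda>n. F (w n) x - F z x) \<longlonglongrightarrow> 0" using Fcont[OF w(2)] by simp
      qed
      then show "((\<lambda>w. qnorm XS (\<lambda>x. F w x - F z x)) \<circ> w) \<longlonglongrightarrow> 0" by (simp add: o_def)
    qed
  qed
  have lim: "(\<lambda>n. F (Complex c (t n)) x - F (Complex c t0) x) \<longlonglongrightarrow> 0" if "t \<longlonglongrightarrow> t0" for c t t0 x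
    using that by (intro Fcont tendsto_Complex tendsto_const)
  have "cmod (F (Complex 0 t) x) \<le> cmod (P x)" "cmod (F (Complex 1 t) x) \<le> cmod (Q x)" for t x
    using pq[of x] pq0[of x] k0 by (auto simp: nF nPQ)
  note F0 = A.dominated_trace[OF P(1) _ this(1) lim] and F1 = B.dominated_trace[OF Q(1) _ this(2) lim]
  show thesis
  proof (rule that)
    show "F \<in> calF M X0 X1"
      unfolding calF_def mem_Collect_eq by (intro conjI 1 2 3 F0(1,2) F1(1,2)) measurable
    show "calF_norm X0 X1 F \<le> k"
      unfolding calF_norm_def
      by (intro max.boundedI cSUP_least order_trans[OF F0(3) P(2)] order_trans[OF F1(3) Q(2)]) auto
    show "AE x in M. F (of_real \<theta>) x = f x"
    proof (rule AE_I2)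
      fix x
      show "F (of_real \<theta>) x = f x"
      proof (cases "g x = 0")
        case True
        then have "cmod (f x) = 0" using ff[of x] pz theta by simp
        then show ?thesis using True by (simp add: F_def)
      next
        case False
        have "exp ((1 - of_real \<theta>) * of_real (ln (p x)) + of_real \<theta> * of_real (ln (q x))) = complex_of_real (p x powr (1 - \<theta>) * q x powr \<theta>)"
          using pq[OF False] by (simp add: powr_def exp_add flip: exp_of_real)
        then have "F (of_real \<theta>) x = sgn (f x) * complex_of_real (k * (p x powr (1 - \<theta>) * q x powr \<theta>))"
          using False by (simp add: F_def)
        also have "\<dots> = sgn (f x) * complex_of_real (cmod (f x))" by (simp only: ff[of x])
        also have "\<dots> = f x" using f_ne[OF False] by (simp add: sgn_eq)
        finally show ?thesis .
      qed
    qed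
  qed
qed

lemma interpolation_same_space: "same_space (complex_interp M X0 X1 \<theta>) (orlicz M X \<Phi>)"
proof -
  obtain C :: real where C: "0 < C" and sub:
    "\<And>F f. F \<in> calF M X0 X1 \<Longrightarrow> f \<in> borel_measurable M \<Longrightarrow> (AE x in M. F (of_real \<theta>) x = f x) \<Longrightarrow>
       f \<in> elems (orlicz M X \<Phi>) \<and> qnorm (orlicz M X \<Phi>) f \<le> C * calF_norm X0 X1 F"
    using interpolation_subset by blast
  let ?I = "complex_interp M X0 X1 \<theta>" and ?Y = "orlicz M X \<Phi>"
  define V where "V f = {calF_norm X0 X1 F | F. F \<in> calF M X0 X1 \<and> (AE x in M. F (of_real \<theta>) x = f x)}" for f
  have q: "qnorm ?I f = Inf (V f)" for f by (simp add: complex_interp_def V_def)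
  have mem: "f \<in> elems ?I \<longleftrightarrow> f \<in> borel_measurable M \<and> V f \<noteq> {}" for f by (auto simp: complex_interp_def V_def)
  have bdd: "bdd_below (V f)" for f using calF_norm_bounds(3) by (intro bdd_belowI[of _ 0]) (auto simp: V_def)
  have fm: "f \<in> borel_measurable M" if "f \<in> elems ?Y" for f using that T.orlicz_mem by auto
  have ex: "\<exists>v\<in>V f. v \<le> k" if "f \<in> elems ?Y" "qnorm ?Y f < k" for f k
    by (rule orlicz_subset[OF that]) (auto simp: V_def)
  have els: "elems ?I = elems ?Y"
  proof (intro set_eqI iffI)
    fix f assume "f \<in> elems ?I"
    then obtain F where "F \<in> calF M X0 X1" "AE x in M. F (of_real \<theta>) x = f x" "f \<in> borel_measurable M"
      by (auto simp: complex_interp_def)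
    then show "f \<in> elems ?Y" using sub by blast
  next
    fix f assume f: "f \<in> elems ?Y"
    then show "f \<in> elems ?I" using ex[OF f, of "qnorm ?Y f + 1"] fm[OF f] mem by auto
  qed
  have equiv: "1 / C * qnorm ?Y f \<le> qnorm ?I f \<and> qnorm ?I f \<le> 1 * qnorm ?Y f" if f: "f \<in> elems ?Y" for f
  proof
    show "1 / C * qnorm ?Y f \<le> qnorm ?I f" unfolding q
    proof (rule cInf_greatest)
      show "V f \<noteq> {}" using f els mem by blast
      show "1 / C * qnorm ?Y f \<le> v" if "v \<in> V f" for v
        using that sub[OF _ fm[OF f]] C by (auto simp: V_def field_simps)
    qed
    show "qnorm ?I f \<le> 1 * qnorm ?Y f" unfolding mult_1
    proof (rule dense_ge)
      fix k assume "qnorm ?Y f < k"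
      from ex[OF f this] obtain v where "v \<in> V f" "v \<le> k" by blast
      then show "qnorm ?I f \<le> k" unfolding q using cInf_lower[OF _ bdd] order_trans by blast
    qed
  qed
  have "\<exists>c>0. \<exists>D>0. \<forall>f\<in>elems ?Y. c * qnorm ?Y f \<le> qnorm ?I f \<and> qnorm ?I f \<le> D * qnorm ?Y f"
  proof (rule exI[of _ "1 / C"], intro conjI)
    show "0 < 1 / C" using C by simp
    show "\<exists>D>0. \<forall>f\<in>elems ?Y. 1 / C * qnorm ?Y f \<le> qnorm ?I f \<and> qnorm ?I f \<le> D * qnorm ?Y f"
      by (rule exI[of _ 1], intro conjI ballI equiv) simp
  qed
  then show ?thesis unfolding same_space_def els by simp
qed

end

theorem corollary6p4:
  fixes M :: "'a::polish_space measure"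
    and X :: "'a fun_space"
    and \<Phi>0 \<Phi>1 \<Phi> :: "real \<Rightarrow> real"
    and \<theta> :: real
  assumes "sets M = sets borel" and "finite_measure M"
    and "quasi_banach_function_space M X"
    and "L_convex M X"
    and "sigma_order_continuous M X"
    and "young_function \<Phi>0" and "Delta2 \<Phi>0"
    and "young_function \<Phi>1" and "Delta2 \<Phi>1"
    and "0 < \<theta>" and "\<theta> < 1"
    and "bij_betw \<Phi> {0..} {0..}"
    and "\<forall>s\<ge>0. inv_half \<Phi> s = inv_half \<Phi>0 s powr (1 - \<theta>) * inv_half \<Phi>1 s powr \<theta>"
  shows "same_space (complex_interp M (orlicz M X \<Phi>0) (orlicz M X \<Phi>1) \<theta>) (orlicz M X \<Phi>)"
proof -
  have sub: "L0_subspace M (elems X)" and qn: "is_quasi_norm M X" and comp: "qnorm_complete X"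
    and id: "\<forall>f\<in>borel_measurable M. \<forall>g\<in>elems X. (AE x in M. cmod (f x) \<le> cmod (g x)) \<longrightarrow> f \<in> elems X \<and> qnorm X f \<le> qnorm X g"
    and one: "(\<lambda>x. 1) \<in> elems X"
    using assms(3) unfolding quasi_banach_function_space_def by blast+
  obtain K where K: "K \<ge> 1" "\<forall>f\<in>elems X. \<forall>g\<in>elems X. qnorm X (\<lambda>x. f x + g x) \<le> K * (qnorm X f + qnorm X g)"
    using qn unfolding is_quasi_norm_def by blast
  have "qideal M X K"
  proof (rule qideal.intro)
    show "f \<in> borel_measurable M" if "f \<in> elems X" for f
      using sub that unfolding L0_subspace_def by blast
    show "0 \<le> qnorm X f" if "f \<in> elems X" for f using qn that unfolding is_quasi_norm_def by blast
    show "f \<in> elems X \<and> qnorm X f \<le> qnorm X g"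
      if "f \<in> borel_measurable M" "g \<in> elems X" "AE x in M. cmod (f x) \<le> cmod (g x)" for f g
      using id that by blast
    show "(\<lambda>x. 0) \<in> elems X" using sub unfolding L0_subspace_def by blast
    show "(\<lambda>x. f x + g x) \<in> elems X" if "f \<in> elems X" "g \<in> elems X" for f g
      using sub that unfolding L0_subspace_def by blast
    show "qnorm X (\<lambda>x. f x + g x) \<le> K * (qnorm X f + qnorm X g)" if "f \<in> elems X" "g \<in> elems X" for f g
      using K(2) that by blast
    show "(\<lambda>x. a * f x) \<in> elems X" if "f \<in> elems X" for f a
      using sub that unfolding L0_subspace_def by blast
    show "qnorm X (\<lambda>x. a * f x) = cmod a * qnorm X f" if "f \<in> elems X" for f a
      using qn that unfolding is_quasi_norm_def by blast
  qed (rule K)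
  moreover have "lconvex_space_axioms M X"
  proof (rule lconvex_space_axioms.intro)
    show "AE x in M. f x = 0" if "f \<in> elems X" "qnorm X f = 0" for f
      using qn that unfolding is_quasi_norm_def by blast
  qed (rule comp assms one)+
  ultimately have "lconvex_space M X K" by (rule lconvex_space.intro)
  then interpret interpolation_pair M X K \<Phi>0 \<Phi>1 \<theta> \<Phi>
    using assms by (intro interpolation_pair.intro orlicz_pair.intro young_orlicz.intro young_orlicz_axioms.intro
        interpolation_pair_axioms.intro)
  show ?thesis by (rule interpolation_same_space)
qed

end
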